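(* Let $f\in C^{0,1}(\Omega\times\mathbb{R},\mathbb{R})$, let $\tau$ be the local skewproduct flow on $\Omega\times\mathbb{R}$ defined by the family $x'=f(\omega\cdot t,x)$, $\omega\in\Omega$, and let $\mathcal{K}\subset\Omega\times\mathbb{R}$ be a compact $\tau$-invariant set projecting onto $\Omega$ whose variation interval $J_{\mathcal{K}}$ does not reduce to a point. Then $\mathcal{K}$ contains at most three (pairwise) disjoint compact $\tau$-invariant sets projecting onto $\Omega$ at least in the following cases: (i) if $f$ is $(\mathrm{sDC})$ on $J_{\mathcal{K}}$; or (ii) if $f$ is $(\mathrm{SDC})$ on $J_{\mathcal{K}}$. In this case, if $\mathcal{K}$ contains three such sets and they are (fiber-)ordered, $\mathcal{K}_1<\mathcal{K}_2<\mathcal{K}_3$, then they are hyperbolic copies of the base, attractive the upper and lower ones ($\mathcal{K}_3$ and $\mathcal{K}_1$), and repulsive the middle one ($\mathcal{K}_2$).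
   Context: $\Omega$ is a compact metric space with a continuous flow $\sigma:\mathbb{R}\times\Omega\to\Omega$, written $\sigma(t,\omega)=\omega\cdot t$. $C^{0,1}(\Omega\times\mathbb{R},\mathbb{R})$ is the set of functions $f:\Omega\times\mathbb{R}\to\mathbb{R}$ such that $f$ and $f_x$ exist and are jointly continuous. $t\mapsto u(t,\omega,x_0)$ is the maximal solution of $x'=f(\omega\cdot t,x)$ with $u(0,\omega,x_0)=x_0$; the local skewproduct flow is $\tau(t,\omega,x_0)=(\omega\cdot t,u(t,\omega,x_0))$. A set is $\tau$-invariant if it is composed of globally defined $\tau$-orbits. A compact $\tau$-invariant set $\mathcal{K}$ projects onto $\Omega$ if $(\omega,x)\mapsto\omega$ maps $\mathcal{K}$ onto $\Omega$. Its variation interval is $J_{\mathcal{K}}=[\inf_{(\omega,x)\in\mathcal{K}}x,\ \sup_{(\omega,x)\in\mathcal{K}}x]$. For disjoint compact $\tau$-invariant sets projecting onto $\Omega$, $\mathcal{K}_1<\mathcal{K}_2$ (fiber-ordered) means $x<y$ whenever $(\omega,x)\in\mathcal{K}_1$ and $(\omega,y)\in\mathcal{K}_2$. A $\tau$-equilibrium is a map $\beta:\Omega\to\mathbb{R}$ with $\beta(\omega\cdot t)=u(t,\omega,\beta(\omega))$ for all $\omega\in\Omega$, $t\in\mathbb{R}$. A copy of the base is the graph of a continuous $\tau$-equilibrium. It is hyperbolic attractive (resp. repulsive) if it is uniformly exponentially asymptotically stable at $+\infty$ (resp. $-\infty$): there are $\delta>0$, $k\ge1$, $\gamma>0$ such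 that if $(\omega,x)$ is in the set and $|y-x|<\delta$, then $u(t,\omega,y)$ is defined and $|u(t,\omega,y)-u(t,\omega,x)|\le k e^{-\gamma|t|}|y-x|$ for all $t\ge0$ (resp. all $t\le0$). $\mathfrak{M}_{\mathrm{erg}}(\Omega,\sigma)$ is the set of normalized $\sigma$-ergodic Borel measures on $\Omega$. $f\in C^{0,1}(\Omega\times\mathbb{R},\mathbb{R})$ is $(\mathrm{DC})$ if $f_x(\omega,\cdot)$ is concave on $\mathbb{R}$ for all $\omega$. For a (DC) function $f$, a compact nondegenerate interval $J$ of length $l(J)$ and $\epsilon\in[0,l(J)]$, $$b_{J,\epsilon}(\omega)=\frac{\epsilon}{4\,l(J)^2}\min_{x\in J_\epsilon}\{2f_x(\omega,x)-f_x(\omega,x-\epsilon/2)-f_x(\omega,x+\epsilon/2)\},\quad J_\epsilon=\{x\in\mathbb{R}:[x-\epsilon/2,x+\epsilon/2]\subseteq J\}.$$ $f$ is $(\mathrm{sDC})$ on $J$ if it is (DC) and for every $\epsilon\in(0,l(J)/2]$ there exists $m_{J,\epsilon}\in\mathfrak{M}_{\mathrm{erg}}(\Omega,\sigma)$ with $m_{J,\epsilon}(\{\omega: b_{J,\epsilon}(\omega)>0\})>0$. $f$ is $(\mathrm{SDC})$ on $J$ if it is (DC) and $m(\{\omega: b_{J,\epsilon}(\omega)>0\})>0$ for every $\epsilon\in(0,l(J)/2]$ and every $m\in\mathfrak{M}_{\mathrm{erg}}(\Omega,\sigma)$. *)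

theory Defs
  imports "HOL-Probability.Probability"
begin

definition continuous_flow :: "(real \<Rightarrow> 'w::metric_space \<Rightarrow> 'w) \<Rightarrow> bool" where
  "continuous_flow \<sigma> \<longleftrightarrow>
     (\<forall>\<omega>. \<sigma> 0 \<omega> = \<omega>) \<and>
     (\<forall>s t \<omega>. \<sigma> (s + t) \<omega> = \<sigma> s (\<sigma> t \<omega>)) \<and>
     continuous_on UNIV (\<lambda>(t, \<omega>). \<sigma> t \<omega>)"

abbreviation partial_x :: "('w \<Rightarrow> real \<Rightarrow> real) \<Rightarrow> 'w \<Rightarrow> real \<Rightarrow> real" where
  "partial_x f \<omega> x \<equiv> deriv (f \<omega>) x"

definition C01 :: "('w::metric_space \<Rightarrow> real \<Rightarrow> real) \<Rightarrow> bool" where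
  "C01 f \<longleftrightarrow>
     continuous_on UNIV (\<lambda>(\<omega>, x). f \<omega> x) \<and>
     (\<forall>\<omega> x. f \<omega> field_differentiable at x) \<and>
     continuous_on UNIV (\<lambda>(\<omega>, x). partial_x f \<omega> x)"

definition solution_on ::
  "(real \<Rightarrow> 'w \<Rightarrow> 'w) \<Rightarrow> ('w \<Rightarrow> real \<Rightarrow> real) \<Rightarrow> 'w \<Rightarrow> real \<Rightarrow> real set \<Rightarrow> (real \<Rightarrow> real) \<Rightarrow> bool" where
  "solution_on \<sigma> f \<omega> x\<^sub>0 I y \<longleftrightarrow>
     open I \<and> is_interval I \<and> 0 \<in> I \<and> y 0 = x\<^sub>0 \<and>
     (\<forall>t\<in>I. (y has_real_derivative f (\<sigma> t \<omega>) (y t)) (at t))"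

text \<open>The maximal solution is the union of all solutions of the initial value problem on open
  intervals. When \<open>f\<close> is in \<open>C01\<close> and \<open>\<sigma>\<close> is continuous, local solutions are unique, so that the
  value selected by \<open>THE\<close> is determined for every \<open>t\<close> in the maximal interval \<open>sol_dom\<close>. Outside
  \<open>sol_dom\<close> the value is unspecified; ``\<open>u(t,\<omega>,x\<^sub>0)\<close> is defined'' is \<open>t \<in> sol_dom \<sigma> f \<omega> x\<^sub>0\<close>.\<close>

definition sol_dom ::
  "(real \<Rightarrow> 'w \<Rightarrow> 'w) \<Rightarrow> ('w \<Rightarrow> real \<Rightarrow> real) \<Rightarrow> 'w \<Rightarrow> real \<Rightarrow> real set" where
  "sol_dom \<sigma> f \<omega> x\<^sub>0 = \<Union>{I. \<exists>y. solution_on \<sigma> f \<omega> x\<^sub>0 I y}"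

definition sol ::
  "(real \<Rightarrow> 'w \<Rightarrow> 'w) \<Rightarrow> ('w \<Rightarrow> real \<Rightarrow> real) \<Rightarrow> real \<Rightarrow> 'w \<Rightarrow> real \<Rightarrow> real" where
  "sol \<sigma> f t \<omega> x\<^sub>0 = (THE z. \<exists>I y. solution_on \<sigma> f \<omega> x\<^sub>0 I y \<and> t \<in> I \<and> y t = z)"

definition skewproduct ::
  "(real \<Rightarrow> 'w \<Rightarrow> 'w) \<Rightarrow> ('w \<Rightarrow> real \<Rightarrow> real) \<Rightarrow> real \<Rightarrow> 'w \<times> real \<Rightarrow> 'w \<times> real" where
  "skewproduct \<sigma> f t = (\<lambda>(\<omega>, x). (\<sigma> t \<omega>, sol \<sigma> f t \<omega> x))"

definition skew_invariant ::
  "(real \<Rightarrow> 'w \<Rightarrow> 'w) \<Rightarrow> ('w \<Rightarrow> real \<Rightarrow> real) \<Rightarrow> ('w \<times> real) set \<Rightarrow> bool" where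
  "skew_invariant \<sigma> f K \<longleftrightarrow>
     (\<forall>(\<omega>, x)\<in>K. \<forall>t. t \<in> sol_dom \<sigma> f \<omega> x \<and> skewproduct \<sigma> f t (\<omega>, x) \<in> K)"

definition compact_invariant_onto ::
  "(real \<Rightarrow> 'w::metric_space \<Rightarrow> 'w) \<Rightarrow> ('w \<Rightarrow> real \<Rightarrow> real) \<Rightarrow> ('w \<times> real) set \<Rightarrow> bool" where
  "compact_invariant_onto \<sigma> f K \<longleftrightarrow> compact K \<and> skew_invariant \<sigma> f K \<and> fst ` K = UNIV"

definition variation_interval :: "('w \<times> real) set \<Rightarrow> real set" where
  "variation_interval K = {(INF p\<in>K. snd p) .. (SUP p\<in>K. snd p)}"

definition fiber_less :: "('w \<times> real) set \<Rightarrow> ('w \<times> real) set \<Rightarrow> bool" where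
  "fiber_less K\<^sub>1 K\<^sub>2 \<longleftrightarrow> (\<forall>\<omega> x y. (\<omega>, x) \<in> K\<^sub>1 \<and> (\<omega>, y) \<in> K\<^sub>2 \<longrightarrow> x < y)"

definition at_most_three_disjoint ::
  "(real \<Rightarrow> 'w::metric_space \<Rightarrow> 'w) \<Rightarrow> ('w \<Rightarrow> real \<Rightarrow> real) \<Rightarrow> ('w \<times> real) set \<Rightarrow> bool" where
  "at_most_three_disjoint \<sigma> f K \<longleftrightarrow>
     (\<forall>\<F>. (\<forall>L\<in>\<F>. L \<subseteq> K \<and> compact_invariant_onto \<sigma> f L) \<and> disjoint \<F> \<longrightarrow>
          finite \<F> \<and> card \<F> \<le> 3)"

definition equilibrium ::
  "(real \<Rightarrow> 'w \<Rightarrow> 'w) \<Rightarrow> ('w \<Rightarrow> real \<Rightarrow> real) \<Rightarrow> ('w \<Rightarrow> real) \<Rightarrow> bool" where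
  "equilibrium \<sigma> f \<beta> \<longleftrightarrow>
     (\<forall>\<omega> t. t \<in> sol_dom \<sigma> f \<omega> (\<beta> \<omega>) \<and> \<beta> (\<sigma> t \<omega>) = sol \<sigma> f t \<omega> (\<beta> \<omega>))"

definition copy_of_base ::
  "(real \<Rightarrow> 'w::metric_space \<Rightarrow> 'w) \<Rightarrow> ('w \<Rightarrow> real \<Rightarrow> real) \<Rightarrow> ('w \<times> real) set \<Rightarrow> bool" where
  "copy_of_base \<sigma> f K \<longleftrightarrow>
     (\<exists>\<beta>. continuous_on UNIV \<beta> \<and> equilibrium \<sigma> f \<beta> \<and> K = range (\<lambda>\<omega>. (\<omega>, \<beta> \<omega>)))"

text \<open>Uniform exponential stability over the set \<open>T\<close> of times; \<open>T = {0..}\<close> and \<open>T = {..0}\<close> give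
  stability at \<open>+\<infinity>\<close> and at \<open>-\<infinity>\<close>.\<close>

definition unif_exp_stable ::
  "(real \<Rightarrow> 'w \<Rightarrow> 'w) \<Rightarrow> ('w \<Rightarrow> real \<Rightarrow> real) \<Rightarrow> real set \<Rightarrow> ('w \<times> real) set \<Rightarrow> bool" where
  "unif_exp_stable \<sigma> f T K \<longleftrightarrow>
     (\<exists>\<delta> k \<gamma>. \<delta> > 0 \<and> k \<ge> 1 \<and> \<gamma> > 0 \<and>
       (\<forall>(\<omega>, x)\<in>K. \<forall>y. \<bar>y - x\<bar> < \<delta> \<longrightarrow>
         (\<forall>t\<in>T. t \<in> sol_dom \<sigma> f \<omega> y \<and>
           \<bar>sol \<sigma> f t \<omega> y - sol \<sigma> f t \<omega> x\<bar> \<le> k * exp (- \<gamma> * \<bar>t\<bar>) * \<bar>y - x\<bar>)))"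

definition hyperbolic_attractive_copy ::
  "(real \<Rightarrow> 'w::metric_space \<Rightarrow> 'w) \<Rightarrow> ('w \<Rightarrow> real \<Rightarrow> real) \<Rightarrow> ('w \<times> real) set \<Rightarrow> bool" where
  "hyperbolic_attractive_copy \<sigma> f K \<longleftrightarrow> copy_of_base \<sigma> f K \<and> unif_exp_stable \<sigma> f {0..} K"

definition hyperbolic_repulsive_copy ::
  "(real \<Rightarrow> 'w::metric_space \<Rightarrow> 'w) \<Rightarrow> ('w \<Rightarrow> real \<Rightarrow> real) \<Rightarrow> ('w \<times> real) set \<Rightarrow> bool" where
  "hyperbolic_repulsive_copy \<sigma> f K \<longleftrightarrow> copy_of_base \<sigma> f K \<and> unif_exp_stable \<sigma> f {..0} K"

definition ergodic_measures :: "(real \<Rightarrow> 'w::metric_space \<Rightarrow> 'w) \<Rightarrow> 'w measure set" where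
  "ergodic_measures \<sigma> =
     {m. prob_space m \<and> sets m = sets borel \<and>
         (\<forall>t. \<forall>A\<in>sets borel. measure m (\<sigma> t ` A) = measure m A) \<and>
         (\<forall>A\<in>sets borel. (\<forall>t. \<sigma> t ` A = A) \<longrightarrow> measure m A = 0 \<or> measure m A = 1)}"

definition DC :: "('w \<Rightarrow> real \<Rightarrow> real) \<Rightarrow> bool" where
  "DC f \<longleftrightarrow> (\<forall>\<omega>. concave_on UNIV (partial_x f \<omega>))"

definition interval_length :: "real set \<Rightarrow> real" where
  "interval_length J = Sup J - Inf J"

definition shrink :: "real set \<Rightarrow> real \<Rightarrow> real set" where
  "shrink J \<epsilon> = {x. {x - \<epsilon> / 2 .. x + \<epsilon> / 2} \<subseteq> J}"

text \<open>For a compact interval \<open>J\<close> of length at least \<open>\<epsilon> \<ge> 0\<close> the set \<open>shrink J \<epsilon>\<close> is compact and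
  nonempty, so that for \<open>f\<close> in \<open>C01\<close> the infimum below is a minimum.\<close>

definition b_fun :: "('w \<Rightarrow> real \<Rightarrow> real) \<Rightarrow> real set \<Rightarrow> real \<Rightarrow> 'w \<Rightarrow> real" where
  "b_fun f J \<epsilon> \<omega> =
     \<epsilon> / (4 * (interval_length J)\<^sup>2) *
     (INF x\<in>shrink J \<epsilon>.
        2 * partial_x f \<omega> x - partial_x f \<omega> (x - \<epsilon> / 2) - partial_x f \<omega> (x + \<epsilon> / 2))"

definition weak_sDC ::
  "(real \<Rightarrow> 'w::metric_space \<Rightarrow> 'w) \<Rightarrow> ('w \<Rightarrow> real \<Rightarrow> real) \<Rightarrow> real set \<Rightarrow> bool" where
  "weak_sDC \<sigma> f J \<longleftrightarrow> DC f \<and>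
     (\<forall>\<epsilon>\<in>{0 <.. interval_length J / 2}.
        \<exists>m\<in>ergodic_measures \<sigma>. measure m {\<omega>. b_fun f J \<epsilon> \<omega> > 0} > 0)"

definition strong_SDC ::
  "(real \<Rightarrow> 'w::metric_space \<Rightarrow> 'w) \<Rightarrow> ('w \<Rightarrow> real \<Rightarrow> real) \<Rightarrow> real set \<Rightarrow> bool" where
  "strong_SDC \<sigma> f J \<longleftrightarrow> DC f \<and>
     (\<forall>\<epsilon>\<in>{0 <.. interval_length J / 2}.
        \<forall>m\<in>ergodic_measures \<sigma>. measure m {\<omega>. b_fun f J \<epsilon> \<omega> > 0} > 0)"

end

theory Submission
  imports Defs
begin

text \<open>The proof compares solutions of \<open>x' = f(\<omega>\<cdot>t, x)\<close> over one base point through the cross ratio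
\<open>X = (x\<^sub>2 - x\<^sub>1)(x\<^sub>4 - x\<^sub>3) / ((x\<^sub>3 - x\<^sub>1)(x\<^sub>4 - x\<^sub>2))\<close> of four of them.  For a Riccati equation, where \<open>f\<close> is
quadratic in \<open>x\<close>, the cross ratio is constant in time.  In general its logarithmic derivative is
\<open>(x\<^sub>3 - x\<^sub>2)(x\<^sub>4 - x\<^sub>1)\<close> times the third divided difference of \<open>f(\<omega>\<cdot>t, \<cdot>)\<close> at the four values
(\<open>cross_ratio_deriv\<close>).  If \<open>f\<^sub>x\<close> is concave, this divided difference is nonpositive, and the second
difference of \<open>f\<^sub>x\<close> whose minimum enters \<open>b_fun\<close> bounds it away from zero
(\<open>divdiff3_le_curvature\<close>).  Hence cross ratios of ordered quadruples decrease, and they decrease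
strictly where \<open>b_fun\<close> is positive.

Suppose that there are four disjoint sets.  The lower boundaries of their fibers are Borel functions
that follow trajectories, and disjoint trajectories over one base point never change their order, so
the cross ratio of the four boundaries, sorted, is a bounded function on the base that does not increase
along orbits.  An invariant measure cannot see a decrease: the function and its
composition with the time-one map have the same integral.  Therefore \<open>b_fun\<close> is nonpositive almost
everywhere for each ergodic measure (\<open>four_sets_null\<close>), which contradicts (sDC).

For three ordered sets and (SDC), positivity for each ergodic measure is first made uniform: the
integral of the curvature along orbits grows at least linearly, at a common rate
(\<open>average_growth\<close>).  If it did not, averages along longer and longer orbit segments would accumulate at
an invariant positive functional on \<open>C(\<Omega>)\<close> with too small a value at the curvature; an extreme
minimizing functional is then represented by an ergodic measure, for which the curvature vanishes almost everywhere
(\<open>exists_ergodic_measure_below_average\<close>).  The same construction shows that ergodic measures exist,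
so that (SDC) implies (sDC).

Now take a pair of nearby solutions, one of them in one of the three sets, and complete it to a
quadruple by trajectories in the other two sets.  The cross ratio decays exponentially, and all its
factors but the difference of the pair are bounded and bounded away from zero.  Near the upper and the
lower set that difference stands in the numerator, hence it decays forward in time; near the middle
set it stands in the denominator, hence it decays backward in time (\<open>pair_decay_upper\<close>,
\<open>pair_decay_lower\<close>, \<open>pair_growth_middle\<close>).  Applied to two points of one fiber this contradicts
boundedness, so that fibers are singletons; applied to a point of the set and a point near it, it is
uniform exponential stability.\<close>

section \<open>Third divided differences and concave derivatives\<close>

text \<open>The third divided difference \<open>\<phi>[a, b, c, d]\<close>, as the symmetric sum over its nodes.  In this form
it does not depend on the order of the nodes, which allows one estimate for ordered nodes to serve
for cross ratios of differently ordered quadruples.\<close>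

definition divdiff3 :: "(real \<Rightarrow> real) \<Rightarrow> real \<Rightarrow> real \<Rightarrow> real \<Rightarrow> real \<Rightarrow> real" where
  "divdiff3 \<phi> a b c d =
     \<phi> a / ((a - b) * (a - c) * (a - d)) + \<phi> b / ((b - a) * (b - c) * (b - d)) +
     \<phi> c / ((c - a) * (c - b) * (c - d)) + \<phi> d / ((d - a) * (d - b) * (d - c))"

text \<open>The left side is what the logarithmic derivative of a cross ratio turns out to be: by the equation,
the logarithmic derivative of a difference of two solutions is a slope of \<open>\<phi>\<close>.\<close>

lemma divdiff3_slopes:
  assumes "distinct [a, b, c, d]"
  shows "(\<phi> b - \<phi> a) / (b - a) + (\<phi> d - \<phi> c) / (d - c) - (\<phi> c - \<phi> a) / (c - a) - (\<phi> d - \<phi> b) / (d - b)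
    = (c - b) * (d - a) * divdiff3 \<phi> a b c d"
proof -
  have *: "b - a \<noteq> 0" "d - c \<noteq> 0" "c - a \<noteq> 0" "d - b \<noteq> 0" "a - b \<noteq> 0" "c - d \<noteq> 0" "a - c \<noteq> 0" "b - d \<noteq> 0"
    "a - d \<noteq> 0" "d - a \<noteq> 0" "b - c \<noteq> 0" "c - b \<noteq> 0"
    using assms by auto
  define p q r where "p = b - a" and "q = c - b" and "r = d - c"
  have nz: "p \<noteq> 0" "q \<noteq> 0" "r \<noteq> 0" "p + q \<noteq> 0" "q + r \<noteq> 0" "p + q + r \<noteq> 0"
    using * by (auto simp: p_def q_def r_def)
  have t1: "q * (p + q + r) * (\<phi> a / (p * (p + q) * (p + q + r))) = \<phi> a / p - \<phi> a / (p + q)"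
    using nz by (simp add: divide_simps) (simp add: algebra_simps)
  have t2: "q * (p + q + r) * (\<phi> b / (p * q * (q + r))) = \<phi> b / p + \<phi> b / (q + r)"
    using nz by (simp add: divide_simps) (simp add: algebra_simps)
  have t3: "q * (p + q + r) * (\<phi> c / ((p + q) * q * r)) = \<phi> c / r + \<phi> c / (p + q)"
    using nz by (simp add: divide_simps) (simp add: algebra_simps)
  have t4: "q * (p + q + r) * (\<phi> d / ((p + q + r) * (q + r) * r)) = \<phi> d / r - \<phi> d / (q + r)"
    using nz by (simp add: divide_simps) (simp add: algebra_simps)
  have g: "b - a = p" "c - b = q" "d - c = r" "c - a = p + q" "d - b = q + r" "d - a = p + q + r"
    "a - b = - p" "b - c = - q" "c - d = - r" "a - c = - (p + q)" "b - d = - (q + r)" "a - d = - (p + q + r)"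
    by (auto simp: p_def q_def r_def)
  have D: "divdiff3 \<phi> a b c d = - (\<phi> a / (p * (p + q) * (p + q + r))) + \<phi> b / (p * q * (q + r))
      - \<phi> c / ((p + q) * q * r) + \<phi> d / ((p + q + r) * (q + r) * r)"
    unfolding divdiff3_def g
    by (simp only: mult_minus_left mult_minus_right minus_minus divide_minus_right)
  have lin: "k * (- X + Y - Z + W) = - (k * X) + k * Y - k * Z + k * W" for k X Y Z W :: real
    by (simp add: algebra_simps)
  show ?thesis
    unfolding D
    unfolding g lin t1 t2 t3 t4 diff_divide_distrib by simp
qed

lemma divdiff3_swap_last:
  "divdiff3 \<phi> a b d c = divdiff3 \<phi> a b c d"
  by (simp add: divdiff3_def mult.commute mult.left_commute)

lemma divdiff3_reflect: "divdiff3 (\<lambda>x. - \<phi> (- x)) (- d) (- c) (- b) (- a) = divdiff3 \<phi> a b c d"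
proof -
  have neg: "(- x - - y) * (- x - - z) * (- x - - w) = - ((x - y) * (x - z) * (x - w))" for x y z w :: real
    by (simp add: algebra_simps)
  show ?thesis
    unfolding divdiff3_def neg minus_minus by (simp add: mult.commute mult.left_commute)
qed

text \<open>Third divided differences annihilate quadratic polynomials; the quadratic is centered at \<open>b\<close>
because it will be fitted to \<open>\<phi>\<close> there.\<close>

lemma divdiff3_quadratic:
  assumes "distinct [a, b, c, d]"
  shows "divdiff3 (\<lambda>x. \<phi> x - (k + m * (x - b) + p / 2 * (x - b)\<^sup>2)) a b c d = divdiff3 \<phi> a b c d"
proof -
  let ?q = "\<lambda>x. k + m * (x - b) + p / 2 * (x - b)\<^sup>2"
  have lin: "divdiff3 (\<lambda>x. \<phi> x - ?q x) a b c d = divdiff3 \<phi> a b c d - divdiff3 ?q a b c d"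
    by (simp add: divdiff3_def diff_divide_distrib)
  have sl: "(?q y - ?q x) / (y - x) = m + p / 2 * (x + y - 2 * b)" if "x \<noteq> y" for x y
    using that by (simp add: field_simps power2_eq_square)
  have "(c - b) * (d - a) * divdiff3 ?q a b c d = 0"
  proof -
    have "b \<noteq> a" "d \<noteq> c" "c \<noteq> a" "d \<noteq> b" using assms by auto
    then have "a \<noteq> b" "c \<noteq> d" "a \<noteq> c" "b \<noteq> d" by auto
    show ?thesis
      unfolding divdiff3_slopes[OF assms, symmetric] sl[OF \<open>a \<noteq> b\<close>] sl[OF \<open>c \<noteq> d\<close>] sl[OF \<open>a \<noteq> c\<close>] sl[OF \<open>b \<noteq> d\<close>]
      by (simp add: field_simps)
  qed
  then show ?thesis using assms lin by simp
qed

lemma concave_supergradient: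
  assumes "concave_on UNIV (g :: real \<Rightarrow> real)"
  shows "\<exists>p. \<forall>y. g y \<le> g b + p * (y - b)"
proof -
  have "convex_on UNIV (\<lambda>x. - g x)" using assms by (simp add: concave_on_def)
  from convex_le_Inf_differential[OF this, of b]
  have "- g b + (INF t\<in>{b<..} \<inter> UNIV. (- g b - - g t) / (b - t)) * (y - b) \<le> - g y" for y by simp
  then show ?thesis
    by (intro exI[of _ "- (INF t\<in>{b<..} \<inter> UNIV. (- g b - - g t) / (b - t))"] allI) (smt (verit) mult_minus_left)
qed

text \<open>Let the quadratic agree with \<open>\<phi>\<close> at \<open>b\<close> and have as derivative a line that supports the concave
\<open>g\<close> at \<open>b\<close>; its subtraction from \<open>\<phi>\<close> leaves \<open>\<psi>\<close> with \<open>\<psi>' \<le> 0\<close> and \<open>\<psi>(b) = \<psi>'(b) = 0\<close>.  In the divided difference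
of \<open>\<psi>\<close>, the term of the node \<open>b\<close> is zero and those of \<open>c\<close> and \<open>d\<close> together are nonpositive, because \<open>\<psi>'\<close> is
concave to the right of \<open>b\<close>.  The
term of \<open>a\<close> is \<open>-\<psi>(a)\<close> over a positive product.  A second difference of \<open>g\<close> of size \<open>B\<close> somewhere in \<open>[a + \<eta>, b]\<close>
forces \<open>\<psi>' \<le> -B\<close> on \<open>[a, a + \<eta>]\<close>, so that \<open>\<psi>(a) \<ge> B \<eta>\<close>.\<close>

lemma divdiff3_le_left:
  fixes \<phi> g :: "real \<Rightarrow> real"
  assumes der: "\<And>x. (\<phi> has_real_derivative g x) (at x)" and conc: "concave_on UNIV g"
    and ord: "a < b" "b < c" "c < d"
    and x: "a + \<eta> \<le> x - h" "x + h \<le> b" "0 < \<eta>" "0 \<le> h"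
    and B: "B \<le> 2 * g x - g (x - h) - g (x + h)" "0 \<le> B"
  shows "divdiff3 \<phi> a b c d \<le> - (B * \<eta> / ((b - a) * (c - a) * (d - a)))"
proof -
  obtain p where p: "\<And>y. g y \<le> g b + p * (y - b)" using concave_supergradient[OF conc] by blast
  define \<psi> where "\<psi> = (\<lambda>x. \<phi> x - (\<phi> b + g b * (x - b) + p / 2 * (x - b)\<^sup>2))"
  define k where "k = (\<lambda>x. g x - (g b + p * (x - b)))"
  have dpsi: "(\<psi> has_real_derivative k y) (at y)" for y
    unfolding \<psi>_def k_def
    by (rule derivative_eq_intros der refl | simp add: field_simps)+
  have kle: "k y \<le> 0" for y using p[of y] by (simp add: k_def)
  have kb: "k b = 0" by (simp add: k_def)
  have kconc: "(1 - s) * k y + s * k z \<le> k ((1 - s) * y + s * z)" if "0 \<le> s" "s \<le> 1" for s y z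
  proof -
    have "(1 - s) * g y + s * g z \<le> g ((1 - s) * y + s * z)"
      using concave_onD[OF conc, of s y z] that by simp
    then show ?thesis unfolding k_def by (simp add: algebra_simps)
  qed
  have kmono: "k y \<le> k z" if "y \<le> z" "z \<le> b" for y z
  proof (cases "y = b")
    case True then show ?thesis using that by simp
  next
    case False
    define s where "s = (z - y) / (b - y)"
    have s: "0 \<le> s" "s \<le> 1" using that False by (auto simp: s_def)
    have "(1 - s) * y + s * b = y + s * (b - y)" by (simp add: algebra_simps)
    also have "\<dots> = z" using False by (simp add: s_def)
    finally have "(1 - s) * k y \<le> k z" using kconc[OF s, of y b] kb by simp
    moreover have "k y \<le> (1 - s) * k y" using kle[of y] s mult_nonneg_nonpos[of s "k y"] by (simp add: algebra_simps)
    ultimately show ?thesis by simp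
  qed
  have k2: "B \<le> 2 * k x - k (x - h) - k (x + h)" using B(1) by (simp add: k_def algebra_simps)
  have kB: "k y \<le> - B" if "y \<le> a + \<eta>" for y
  proof -
    have "k y \<le> k (x - h)" using that x ord by (intro kmono) auto
    moreover have "k x \<le> k (x + h)" using x by (intro kmono) auto
    ultimately show ?thesis using k2 kle[of x] by linarith
  qed
  have "B * \<eta> \<le> \<psi> a"
  proof -
    have "a + \<eta> \<le> b" using x by simp
    have anti: "\<psi> b \<le> \<psi> (a + \<eta>)"
      by (rule DERIV_nonpos_imp_nonincreasing[OF \<open>a + \<eta> \<le> b\<close>]) (use dpsi kle in blast)
    have "\<psi> (a + \<eta>) + B * (a + \<eta>) \<le> \<psi> a + B * a"
    proof (rule DERIV_nonpos_imp_nonincreasing[where f = "\<lambda>y. \<psi> y + B * y"])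
      show "a \<le> a + \<eta>" using x by simp
      fix y assume "a \<le> y" "y \<le> a + \<eta>"
      have "((\<lambda>y. \<psi> y + B * y) has_real_derivative k y + B) (at y)"
        by (auto intro!: derivative_eq_intros dpsi)
      then show "\<exists>z. ((\<lambda>y. \<psi> y + B * y) has_real_derivative z) (at y) \<and> z \<le> 0"
        using kB[OF \<open>y \<le> a + \<eta>\<close>] by (intro exI[of _ "k y + B"]) auto
    qed
    moreover have "\<psi> b = 0" by (simp add: \<psi>_def)
    ultimately show ?thesis using anti by (simp add: algebra_simps)
  qed
  have \<psi>b: "\<psi> b = 0" by (simp add: \<psi>_def)
  define s where "s = (c - b) / (d - b)"
  have s: "0 < s" "s \<le> 1" using ord by (auto simp: s_def)
  have bs: "b + s * (d - b) = c" using ord by (simp add: s_def)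
  \<comment> \<open>This is where concavity to the right of \<open>b\<close> enters: \<open>\<psi>(y) / (y - b)\<^sup>2\<close> decreases.\<close>
  have scal: "s\<^sup>2 * \<psi> d \<le> \<psi> c"
  proof -
    let ?K = "\<lambda>y. \<psi> (b + s * (y - b)) - s\<^sup>2 * \<psi> y"
    have "?K b \<le> ?K d"
    proof (rule DERIV_nonneg_imp_nondecreasing[of b d ?K])
      show "b \<le> d" using ord by simp
      fix y assume "b \<le> y" "y \<le> d"
      have "(?K has_real_derivative k (b + s * (y - b)) * s - s\<^sup>2 * k y) (at y)"
        by (rule derivative_eq_intros DERIV_chain2[OF dpsi] refl | simp)+
      moreover have "s * k y \<le> k (b + s * (y - b))"
        using kconc[of s b y] s kb by (simp add: algebra_simps)
      then have "0 \<le> s * (k (b + s * (y - b)) - s * k y)" using s by simp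
      then have "0 \<le> k (b + s * (y - b)) * s - s\<^sup>2 * k y" by (simp add: algebra_simps power2_eq_square)
      ultimately show "\<exists>z. (?K has_real_derivative z) (at y) \<and> 0 \<le> z" by blast
    qed
    then show ?thesis using \<psi>b bs by simp
  qed
  have d0: "\<psi> d \<le> 0"
  proof -
    have "\<psi> d \<le> \<psi> b"
      by (rule DERIV_nonpos_imp_nonincreasing[of b d]) (use ord dpsi kle in \<open>auto intro: less_imp_le\<close>)
    then show ?thesis using \<psi>b by simp
  qed
  have "divdiff3 \<phi> a b c d = divdiff3 \<psi> a b c d"
    unfolding \<psi>_def using ord by (intro divdiff3_quadratic[symmetric]) auto
  also have "\<dots> = - (\<psi> a / ((b - a) * (c - a) * (d - a)))
      + (\<psi> d / ((d - a) * (d - b)) - \<psi> c / ((c - a) * (c - b))) / (d - c)"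
  proof -
    have 1: "(a - b) * (a - c) * (a - d) = - ((b - a) * (c - a) * (d - a))" by (simp add: algebra_simps)
    have 2: "(c - a) * (c - b) * (c - d) = - ((c - a) * (c - b) * (d - c))" by (simp add: algebra_simps)
    show ?thesis unfolding divdiff3_def \<psi>b 1 2 by (simp add: diff_divide_distrib)
  qed
  also have "\<dots> \<le> - (B * \<eta> / ((b - a) * (c - a) * (d - a)))"
  proof -
    have "\<psi> d / ((d - a) * (d - b)) \<le> \<psi> c / ((c - a) * (c - b))"
    proof -
      have "(c - b) * (d - a) \<le> (d - b) * (c - a)"
        using mult_nonneg_nonneg[of "b - a" "d - c"] ord by (simp add: algebra_simps)
      then have "(c - b) / ((d - b) * (c - a)) \<le> 1 / (d - a)"
        using ord by (simp add: divide_simps)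
      then have "1 / (d - a) * (\<psi> d / (d - b)) \<le> (c - b) / ((d - b) * (c - a)) * (\<psi> d / (d - b))"
        using d0 ord by (intro mult_right_mono_neg divide_nonpos_pos) auto
      also have "\<dots> = s\<^sup>2 * \<psi> d / ((c - a) * (c - b))"
        using ord by (simp add: s_def power2_eq_square divide_simps)
      also have "\<dots> \<le> \<psi> c / ((c - a) * (c - b))"
        using scal ord by (intro divide_right_mono) auto
      finally show ?thesis by simp
    qed
    then have "(\<psi> d / ((d - a) * (d - b)) - \<psi> c / ((c - a) * (c - b))) / (d - c) \<le> 0"
      using ord by (intro divide_nonpos_pos) auto
    moreover have "B * \<eta> / ((b - a) * (c - a) * (d - a)) \<le> \<psi> a / ((b - a) * (c - a) * (d - a))"
      using \<open>B * \<eta> \<le> \<psi> a\<close> ord by (intro divide_right_mono) auto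
    ultimately show ?thesis by linarith
  qed
  finally show ?thesis .
qed

text \<open>The mirror image under \<open>x \<mapsto> -x\<close>.  It is needed when the two leftmost nodes may be arbitrarily
close, so that only the last gap can contain an interval of given length.\<close>

lemma divdiff3_le_right:
  fixes \<phi> g :: "real \<Rightarrow> real"
  assumes der: "\<And>x. (\<phi> has_real_derivative g x) (at x)" and conc: "concave_on UNIV g"
    and ord: "a < b" "b < c" "c < d"
    and x: "c \<le> x - h" "x + h \<le> d - \<eta>" "0 < \<eta>" "0 \<le> h"
    and B: "B \<le> 2 * g x - g (x - h) - g (x + h)" "0 \<le> B"
  shows "divdiff3 \<phi> a b c d \<le> - (B * \<eta> / ((d - c) * (d - b) * (d - a)))"
proof -
  have "divdiff3 (\<lambda>x. - \<phi> (- x)) (- d) (- c) (- b) (- a)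
      \<le> - (B * \<eta> / ((- c - - d) * (- b - - d) * (- a - - d)))"
  proof (rule divdiff3_le_left[where g = "\<lambda>x. g (- x)" and x = "- x" and h = h])
    show "((\<lambda>x. - \<phi> (- x)) has_real_derivative g (- y)) (at y)" for y
      by (rule derivative_eq_intros DERIV_chain2[OF der] refl | simp)+
    show "concave_on UNIV (\<lambda>x. g (- x))"
      unfolding concave_on_iff
    proof (intro conjI ballI allI impI)
      fix x y u v :: real assume uv: "0 \<le> u" "0 \<le> v" "u + v = 1"
      have "u * g (- x) + v * g (- y) \<le> g (u *\<^sub>R (- x) + v *\<^sub>R (- y))"
        using conc uv unfolding concave_on_iff by blast
      also have "u *\<^sub>R (- x) + v *\<^sub>R (- y) = - (u *\<^sub>R x + v *\<^sub>R y)" by simp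
      finally show "u * g (- x) + v * g (- y) \<le> g (- (u *\<^sub>R x + v *\<^sub>R y))" .
    qed simp
  qed (use assms in \<open>auto simp: algebra_simps\<close>)
  then show ?thesis by (simp add: divdiff3_reflect algebra_simps)
qed

section \<open>Primitives on the real line\<close>

text \<open>The interval integral is signed, which gives one function on the whole line with derivative \<open>h\<close>
everywhere.\<close>

definition primitive :: "(real \<Rightarrow> real) \<Rightarrow> real \<Rightarrow> real" where
  "primitive h t = (LBINT s=ereal 0..ereal t. h s)"

lemma primitive_0 [simp]: "primitive h 0 = 0"
  by (simp add: primitive_def)

lemma primitive_deriv:
  assumes h: "continuous_on UNIV h"
  shows "(primitive h has_real_derivative h t) (at t)"
proof -
  let ?a = "- \<bar>t\<bar> - 1" and ?b = "\<bar>t\<bar> + 1"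
  have "((\<lambda>u. LBINT y=ereal 0..ereal u. h y) has_vector_derivative h t) (at t within {?a..?b})"
    by (rule interval_integral_FTC2) (auto intro: continuous_on_subset[OF h])
  moreover have "at t within {?a..?b} = at t" by (rule at_within_interior) auto
  ultimately show ?thesis
    unfolding primitive_def has_real_derivative_iff_has_vector_derivative by simp
qed

lemma primitive_unique:
  assumes h: "continuous_on UNIV h" and H: "\<And>t. (H has_real_derivative h t) (at t)"
  shows "primitive h t = H t - H 0"
proof -
  have "((\<lambda>t. primitive h t - H t) has_real_derivative 0) (at s)" for s
    using DERIV_diff[OF primitive_deriv[OF h] H, of s] by simp
  then have "primitive h t - H t = primitive h 0 - H 0" by (intro DERIV_isconst_all) auto
  then show ?thesis by simp
qed

lemma primitive_add:
  assumes "continuous_on UNIV g" "continuous_on UNIV h"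
  shows "primitive (\<lambda>s. g s + h s) t = primitive g t + primitive h t"
  using primitive_unique[of "\<lambda>s. g s + h s" "\<lambda>t. primitive g t + primitive h t" t] assms
  by (auto intro!: continuous_intros DERIV_add primitive_deriv)

lemma primitive_cmult:
  assumes "continuous_on UNIV h"
  shows "primitive (\<lambda>s. c * h s) t = c * primitive h t"
proof -
  have "((\<lambda>t. c * primitive h t) has_real_derivative c * h s) (at s)" for s
    by (rule DERIV_cmult[OF primitive_deriv[OF assms]])
  moreover have "continuous_on UNIV (\<lambda>s. c * h s)" by (intro continuous_intros assms)
  ultimately show ?thesis using primitive_unique[of "\<lambda>s. c * h s" "\<lambda>t. c * primitive h t" t] by simp
qed

lemma primitive_const: "primitive (\<lambda>_. c) t = c * t"
  using primitive_unique[of "\<lambda>_. c" "\<lambda>t. c * t" t]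
  by (auto intro!: continuous_intros derivative_eq_intros)

lemma primitive_shift:
  assumes h: "continuous_on UNIV h"
  shows "primitive (\<lambda>s. h (s + a)) t = primitive h (t + a) - primitive h a"
proof -
  have "((\<lambda>t. primitive h (t + a)) has_real_derivative h (t + a)) (at t)" for t
    using primitive_deriv[OF h, of "t + a"] by (simp add: DERIV_shift)
  moreover have "continuous_on UNIV (\<lambda>s. h (s + a))"
    by (intro continuous_on_compose2[OF h] continuous_intros) auto
  ultimately show ?thesis using primitive_unique[of "\<lambda>s. h (s + a)" "\<lambda>t. primitive h (t + a)" t] by simp
qed

lemma primitive_mono:
  assumes g: "continuous_on UNIV g" and h: "continuous_on UNIV h" and "\<And>s. g s \<le> h s" "s \<le> t"
  shows "primitive g t - primitive g s \<le> primitive h t - primitive h s"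
proof -
  have "primitive h s - primitive g s \<le> primitive h t - primitive g t"
  proof (rule DERIV_nonneg_imp_nondecreasing[of s t "\<lambda>t. primitive h t - primitive g t"])
    fix u
    show "\<exists>y. ((\<lambda>t. primitive h t - primitive g t) has_real_derivative y) (at u) \<and> 0 \<le> y"
      using DERIV_diff[OF primitive_deriv[OF h] primitive_deriv[OF g], of u] assms(3)[of u] by auto
  qed (rule assms)
  then show ?thesis by simp
qed

lemma primitive_bound:
  assumes h: "continuous_on UNIV h" and "\<And>s. \<bar>h s\<bar> \<le> B"
  shows "\<bar>primitive h t - primitive h s\<bar> \<le> B * \<bar>t - s\<bar>"
proof -
  have *: "\<bar>primitive h t - primitive h s\<bar> \<le> B * (t - s)" if "s \<le> t" for s t
  proof -
    have "- B \<le> h u" "h u \<le> B" for u using assms(2)[of u] by auto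
    then show ?thesis
      using primitive_mono[OF h continuous_on_const _ that, of B] primitive_mono[OF continuous_on_const h _ that, of "-B"]
      by (auto simp: primitive_const algebra_simps abs_le_iff)
  qed
  show ?thesis using *[of s t] *[of t s] by (cases "s \<le> t") (auto simp: abs_minus_commute)
qed

section \<open>Positive functionals on continuous functions are measures\<close>

text \<open>A continuous function that is positive exactly on \<open>U\<close> (for open \<open>U\<close>).  The case distinction is
needed because the distance to the empty set is zero by convention.\<close>

definition depth :: "'w::metric_space set \<Rightarrow> 'w \<Rightarrow> real" where
  "depth U x = (if U = UNIV then 1 else infdist x (- U))"

lemma depth_continuous: "continuous_on UNIV (depth U)"
  unfolding depth_def by (cases "U = UNIV") (auto intro!: continuous_intros)

lemma depth_nonneg: "0 \<le> depth U x" by (simp add: depth_def infdist_nonneg)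

lemma depth_outside: "x \<notin> U \<Longrightarrow> depth U x = 0" by (auto simp: depth_def)

lemma depth_pos: "open U \<Longrightarrow> x \<in> U \<Longrightarrow> 0 < depth U x"
  unfolding depth_def by (auto intro!: infdist_pos_not_in_closed)

locale positive_functional =
  fixes \<Phi> :: "('w::metric_space \<Rightarrow> real) \<Rightarrow> real"
  assumes compact_space: "compact (UNIV :: 'w set)"
    and add: "continuous_on UNIV g \<Longrightarrow> continuous_on UNIV h \<Longrightarrow> \<Phi> (\<lambda>x. g x + h x) = \<Phi> g + \<Phi> h"
    and scale: "continuous_on UNIV g \<Longrightarrow> \<Phi> (\<lambda>x. c * g x) = c * \<Phi> g"
    and nonneg: "continuous_on UNIV g \<Longrightarrow> (\<And>x. 0 \<le> g x) \<Longrightarrow> 0 \<le> \<Phi> g"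
    and one: "\<Phi> (\<lambda>_. 1) = 1"
begin

lemma diff: "continuous_on UNIV g \<Longrightarrow> continuous_on UNIV h \<Longrightarrow> \<Phi> (\<lambda>x. g x - h x) = \<Phi> g - \<Phi> h"
  using add[of g "\<lambda>x. (-1) * h x"] scale[of h "-1"]
  by (simp add: continuous_on_minus)

lemma mono:
  assumes "continuous_on UNIV g" "continuous_on UNIV h" "\<And>x. g x \<le> h x"
  shows "\<Phi> g \<le> \<Phi> h"
  using nonneg[of "\<lambda>x. h x - g x"] diff[of h g] assms by (auto intro: continuous_intros)

lemma const: "\<Phi> (\<lambda>_. c) = c"
  using scale[of "\<lambda>_. 1" c] one by (simp add: continuous_on_const)

lemma sum: "(\<And>i. i \<in> I \<Longrightarrow> continuous_on UNIV (g i)) \<Longrightarrow> finite I \<Longrightarrow> \<Phi> (\<lambda>x. \<Sum>i\<in>I. g i x) = (\<Sum>i\<in>I. \<Phi> (g i))"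
proof (induction I rule: infinite_finite_induct)
  case (insert i I)
  then show ?case using add[of "g i" "\<lambda>x. \<Sum>i\<in>I. g i x"] by (simp add: continuous_on_sum)
qed (auto simp: const)

text \<open>The construction of the measure follows the proof of the Riesz representation theorem: \<open>content\<close> is the value of
an open set, \<open>outer\<close> the outer measure that it generates.\<close>

definition below :: "'w set \<Rightarrow> ('w \<Rightarrow> real) set" where
  "below U = {g. continuous_on UNIV g \<and> (\<forall>x. 0 \<le> g x \<and> g x \<le> indicator U x)}"

definition content :: "'w set \<Rightarrow> ennreal" where
  "content U = (SUP g\<in>below U. ennreal (\<Phi> g))"

definition outer :: "'w set \<Rightarrow> ennreal" where
  "outer A = (INF U\<in>{U. open U \<and> A \<subseteq> U}. content U)"

lemma belowD:
  assumes "g \<in> below U"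
  shows "continuous_on UNIV g" "0 \<le> g x" "g x \<le> 1" "x \<notin> U \<Longrightarrow> g x = 0" "0 \<le> \<Phi> g"
proof -
  have *: "0 \<le> g x" "g x \<le> indicator U x" for x using assms by (auto simp: below_def)
  show "continuous_on UNIV g" using assms by (auto simp: below_def)
  show "0 \<le> g x" by (rule *)
  show "g x \<le> 1" using *(2)[of x] by (cases "x \<in> U") auto
  show "x \<notin> U \<Longrightarrow> g x = 0" using *[of x] by auto
  show "0 \<le> \<Phi> g" by (rule nonneg) (use assms in \<open>auto simp: below_def\<close>)
qed

lemma belowI:
  assumes "continuous_on UNIV g" "\<And>x. 0 \<le> g x" "\<And>x. g x \<le> 1" "\<And>x. x \<notin> U \<Longrightarrow> g x = 0"
  shows "g \<in> below U"
  using assms unfolding below_def indicator_def by auto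

lemma zero_below: "(\<lambda>_. 0) \<in> below U"
  by (rule belowI) (auto intro: continuous_on_const)

lemma le_content: "g \<in> below U \<Longrightarrow> ennreal (\<Phi> g) \<le> content U"
  unfolding content_def by (rule SUP_upper)

lemma content_mono: "U \<subseteq> V \<Longrightarrow> content U \<le> content V"
  unfolding content_def by (rule SUP_subset_mono) (auto intro!: belowI dest: belowD)

lemma content_UNIV: "content UNIV = 1"
proof (rule antisym)
  show "content UNIV \<le> 1"
    unfolding content_def
  proof (rule SUP_least)
    fix g :: "'w \<Rightarrow> real" assume "g \<in> below UNIV"
    then have "\<Phi> g \<le> 1" using mono[of g "\<lambda>_. 1"] belowD[of g] by (simp add: const continuous_on_const)
    then show "ennreal (\<Phi> g) \<le> 1" by (simp add: ennreal_le_1)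
  qed
  have "(\<lambda>_. 1) \<in> below UNIV" by (auto simp: below_def intro: continuous_on_const)
  from le_content[OF this] show "1 \<le> content UNIV" by (simp add: const)
qed

lemma outer_open: "open U \<Longrightarrow> outer U = content U"
  unfolding outer_def by (rule antisym) (auto intro: INF_lower INF_greatest content_mono)

lemma outer_mono: "A \<subseteq> B \<Longrightarrow> outer A \<le> outer B"
  unfolding outer_def by (rule INF_superset_mono) auto

lemma outer_le_content: "open U \<Longrightarrow> A \<subseteq> U \<Longrightarrow> outer A \<le> content U"
  unfolding outer_def by (rule INF_lower) auto

lemma content_empty: "content {} = 0"
proof -
  have "below {} = {\<lambda>_. 0}" using zero_below by (auto simp: belowD(4))
  then show ?thesis by (simp add: content_def const)
qed

lemma outer_empty: "outer {} = 0" using outer_open[of "{}"] content_empty by simp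

text \<open>A function below the union is, up to a small constant, a sum of functions below
finitely many of the sets: by compactness, finitely many of them cover the set where the function is not small.\<close>

lemma content_subadditive:
  fixes U :: "nat \<Rightarrow> 'w set"
  assumes U: "\<And>i. open (U i)"
  shows "content (\<Union>i. U i) \<le> (\<Sum>i. content (U i))"
  unfolding content_def[of "\<Union>i. U i"]
proof (rule SUP_least, rule ennreal_le_epsilon)
  fix g e assume g: "g \<in> below (\<Union>i. U i)" and e: "0 < (e::real)"
  note gD = belowD[OF g]
  let ?K = "{x. e \<le> g x}"
  have "closed ?K" using gD(1) by (intro closed_Collect_le continuous_on_const)
  then have K: "compact ?K"
    using closed_Int_compact[OF _ compact_space, of ?K] by simp
  have "?K \<subseteq> (\<Union>i. U i)"
  proof
    fix x assume "x \<in> ?K"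
    then have "g x \<noteq> 0" using e by auto
    then show "x \<in> (\<Union>i. U i)" using gD(4)[of x] by blast
  qed
  then obtain I where I: "finite I" "?K \<subseteq> (\<Union>i\<in>I. U i)"
    using compactE_image[OF K, of UNIV U] U by metis
  obtain N where N: "I \<subseteq> {..<N::nat}" using finite_nat_iff_bounded I(1) by blast
  define S where "S = (\<lambda>n x. \<Sum>j<n. depth (U j) x)"
  have Sc: "continuous_on UNIV (S n)" for n unfolding S_def by (intro continuous_on_sum depth_continuous)
  have Spos: "0 < S N x" if xK: "x \<in> ?K" for x
  proof -
    obtain i where "i \<in> I" "x \<in> U i" using I(2) xK by blast
    then have "0 < depth (U i) x" "i \<in> {..<N}" using depth_pos[OF U] N by auto
    then show ?thesis unfolding S_def
      by (intro sum_pos2[of _ i]) (auto simp: depth_nonneg)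
  qed
  obtain s where s: "0 < s" "\<And>x. x \<in> ?K \<Longrightarrow> s \<le> S N x"
  proof (cases "?K = {}")
    case True then show ?thesis using that[of 1] by auto
  next
    case False
    from continuous_attains_inf[OF K this continuous_on_subset[OF Sc[of N]]]
    obtain z where "z \<in> ?K" "\<And>x. x \<in> ?K \<Longrightarrow> S N z \<le> S N x" by auto
    then show ?thesis using that[of "S N z"] Spos by auto
  qed
  \<comment> \<open>The increments of \<open>min g (S\<^sub>n / s)\<close> vanish off \<open>U\<^sub>n\<close>, because \<open>depth (U\<^sub>n)\<close> does, and they
    telescope to \<open>g\<close> on the set where \<open>g \<ge> e\<close>.\<close>
  define k where "k = (\<lambda>i x. min (g x) (S (Suc i) x / s) - min (g x) (S i x / s))"
  have Smono: "S i x \<le> S (Suc i) x" for i x by (simp add: S_def depth_nonneg)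
  have S0: "0 \<le> S i x" for i x by (simp add: S_def depth_nonneg sum_nonneg)
  have kc: "continuous_on UNIV (k i)" for i
    unfolding k_def using s by (intro continuous_intros Sc gD) auto
  have kb: "k i \<in> below (U i)" for i
  proof (rule belowI[OF kc])
    fix x
    have "S i x / s \<le> S (Suc i) x / s" using Smono s by (intro divide_right_mono) auto
    then show "0 \<le> k i x" unfolding k_def by linarith
    have "0 \<le> S i x / s" using S0 s by simp
    then show "k i x \<le> 1" using gD(2,3)[of x] unfolding k_def by linarith
    show "k i x = 0" if "x \<notin> U i" using that by (simp add: k_def S_def depth_outside)
  qed
  have tele: "(\<Sum>i<n. k i x) = min (g x) (S n x / s)" for n x
  proof (induction n)
    case 0 then show ?case using gD(2)[of x] by (simp add: S_def)
  next
    case (Suc n) then show ?case by (simp add: k_def)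
  qed
  have "g x \<le> (\<Sum>i<N. k i x) + e" for x
  proof (cases "x \<in> ?K")
    case True
    then have "1 \<le> S N x / s" using s by simp
    then show ?thesis unfolding tele using gD(3)[of x] e by linarith
  next
    case False
    moreover have "0 \<le> S N x / s" using S0 s by simp
    ultimately show ?thesis unfolding tele using gD(2)[of x] e by auto
  qed
  then have "\<Phi> g \<le> \<Phi> (\<lambda>x. (\<Sum>i<N. k i x) + e)"
    by (intro mono gD continuous_intros kc) auto
  also have "\<dots> = (\<Sum>i<N. \<Phi> (k i)) + e"
    using add[of "\<lambda>x. \<Sum>i<N. k i x" "\<lambda>_. e"] sum[of "{..<N}" k] kc const[of e]
    by (simp add: continuous_on_sum continuous_on_const)
  finally have "ennreal (\<Phi> g) \<le> ennreal ((\<Sum>i<N. \<Phi> (k i)) + e)" by (rule ennreal_leI)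
  also have "\<dots> = (\<Sum>i<N. ennreal (\<Phi> (k i))) + ennreal e"
  proof -
    have "0 \<le> (\<Sum>i<N. \<Phi> (k i))" by (intro sum_nonneg belowD(5)[OF kb])
    moreover have "(\<Sum>i<N. ennreal (\<Phi> (k i))) = ennreal (\<Sum>i<N. \<Phi> (k i))"
      by (intro sum_ennreal belowD(5)[OF kb])
    ultimately show ?thesis using e by simp
  qed
  also have "\<dots> \<le> (\<Sum>i. content (U i)) + ennreal e"
  proof (rule add_right_mono)
    have "(\<Sum>i<N. ennreal (\<Phi> (k i))) \<le> (\<Sum>i<N. content (U i))"
      by (intro sum_mono le_content kb)
    also have "\<dots> \<le> (\<Sum>i. content (U i))" by (rule sum_le_suminf) auto
    finally show "(\<Sum>i<N. ennreal (\<Phi> (k i))) \<le> (\<Sum>i. content (U i))" .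
  qed
  finally show "ennreal (\<Phi> g) \<le> (\<Sum>i. content (U i)) + ennreal e" .
qed

lemma outer_approx:
  assumes "0 < (e::real)"
  shows "\<exists>U. open U \<and> A \<subseteq> U \<and> content U \<le> outer A + ennreal e"
proof -
  have "outer A \<le> outer UNIV" by (rule outer_mono) simp
  then have fin: "outer A < top"
    using outer_open[of UNIV] content_UNIV by (simp add: order_le_less_trans[OF _ ennreal_one_less_top])
  then have "outer A < outer A + ennreal e" using assms
    by (cases "outer A") (auto simp flip: ennreal_plus intro!: ennreal_lessI)
  then show ?thesis unfolding outer_def INF_less_iff by (auto intro: less_imp_le)
qed

lemma outer_measure_space_outer: "outer_measure_space (Pow UNIV) outer"
  unfolding outer_measure_space_def
proof (intro conjI)
  show "positive (Pow UNIV) outer" by (simp add: positive_def outer_empty)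
  show "increasing (Pow UNIV) outer" by (simp add: increasing_def outer_mono)
  show "countably_subadditive (Pow UNIV) outer"
    unfolding countably_subadditive_def
  proof safe
    fix A :: "nat \<Rightarrow> 'w set"
    show "outer (\<Union>i. A i) \<le> (\<Sum>i. outer (A i))"
    proof (rule ennreal_le_epsilon)
      fix e :: real assume e: "0 < e"
      have "(\<lambda>n. e * (1/2)^Suc n) sums (e * 1)" by (intro sums_mult power_half_series)
      then have geo: "(\<Sum>n. ennreal (e * (1/2)^Suc n)) = ennreal e"
        by (intro suminf_ennreal_eq) (use e in simp_all)
      have "\<forall>n. \<exists>U. open U \<and> A n \<subseteq> U \<and> content U \<le> outer (A n) + ennreal (e * (1/2)^Suc n)"
      proof
        fix n show "\<exists>U. open U \<and> A n \<subseteq> U \<and> content U \<le> outer (A n) + ennreal (e * (1/2)^Suc n)"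
          by (rule outer_approx) (use e in simp)
      qed
      then obtain U where U: "\<And>n. open (U n)" "\<And>n. A n \<subseteq> U n"
          "\<And>n. content (U n) \<le> outer (A n) + ennreal (e * (1/2)^Suc n)"
        unfolding choice_iff by blast
      have "outer (\<Union>i. A i) \<le> content (\<Union>i. U i)"
        by (rule outer_le_content) (use U in auto)
      also have "\<dots> \<le> (\<Sum>i. content (U i))" by (rule content_subadditive[OF U(1)])
      also have "\<dots> \<le> (\<Sum>n. outer (A n) + ennreal (e * (1/2)^Suc n))"
        by (rule suminf_le) (use U in auto)
      also have "\<dots> = (\<Sum>n. outer (A n)) + (\<Sum>n. ennreal (e * (1/2)^Suc n))"
        by (rule suminf_add[symmetric]) auto
      also have "\<dots> = (\<Sum>n. outer (A n)) + ennreal e" by (simp only: geo)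
      finally show "outer (\<Union>i. A i) \<le> (\<Sum>i. outer (A i)) + ennreal e" .
    qed
  qed
qed

text \<open>The nontrivial inequality of the Caratheodory condition.  For \<open>V \<supseteq> A\<close>, a nearly optimal function
\<open>g\<close> for \<open>V \<inter> U\<close>, lowered by a small constant, vanishes on the open set \<open>W \<supseteq> A - U\<close> of points of \<open>V\<close> where \<open>g\<close> is small.  So it can be added to
a nearly optimal function for \<open>W\<close> without leaving \<open>below V\<close>.\<close>

lemma open_in_lambda_system:
  assumes U: "open U"
  shows "U \<in> lambda_system UNIV (Pow UNIV) outer"
proof -
  have "outer (A \<inter> U) + outer (A - U) \<le> outer A" for A
    unfolding outer_def[of A]
  proof (rule INF_greatest, rule ennreal_le_epsilon)
    fix V and e :: real assume V: "V \<in> {V. open V \<and> A \<subseteq> V}" and e: "0 < e"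
    have finc: "content X < top" for X
      using content_mono[of X UNIV] content_UNIV by (simp add: order_le_less_trans[OF _ ennreal_one_less_top])
    have approx: "\<exists>g\<in>below X. content X \<le> ennreal (\<Phi> g) + ennreal (e / 3)" for X
    proof (cases "content X = 0")
      case True then show ?thesis using zero_below by auto
    next
      case False
      then have "content X - ennreal (e/3) < content X"
        using e finc[of X] by (intro ennreal_between) (auto simp: zero_less_iff_neq_zero)
      then obtain g where "g \<in> below X" "content X - ennreal (e/3) < ennreal (\<Phi> g)"
        unfolding content_def[of X] less_SUP_iff by auto
      then show ?thesis by (auto simp: ennreal_minus_le_iff add.commute intro!: bexI[of _ g] dest: less_imp_le)
    qed
    obtain g where g: "g \<in> below (V \<inter> U)" "content (V \<inter> U) \<le> ennreal (\<Phi> g) + ennreal (e/3)"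
      using approx by blast
    note gD = belowD[OF g(1)]
    define W where "W = V \<inter> {x. g x < e/3}"
    have W: "open W" using V gD(1) unfolding W_def by (intro open_Int open_Collect_less continuous_on_const) auto
    obtain h where h: "h \<in> below W" "content W \<le> ennreal (\<Phi> h) + ennreal (e/3)"
      using approx by blast
    note hD = belowD[OF h(1)]
    define k where "k = (\<lambda>x. max (g x - e/3) 0)"
    have kc: "continuous_on UNIV k" unfolding k_def by (intro continuous_intros gD)
    have "(\<lambda>x. k x + h x) \<in> below V"
    proof (rule belowI)
      show "continuous_on UNIV (\<lambda>x. k x + h x)" by (intro continuous_intros kc hD)
      fix x
      show "0 \<le> k x + h x" using hD(2)[of x] by (simp add: k_def)
      show "k x + h x \<le> 1"
      proof (cases "x \<in> W")
        case True then show ?thesis using hD(3)[of x] by (simp add: k_def W_def)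
      next
        case False then show ?thesis using hD(4)[of x] gD(3)[of x] e by (simp add: k_def)
      qed
      show "k x + h x = 0" if "x \<notin> V"
        using that hD(4)[of x] gD(4)[of x] e by (simp add: k_def W_def)
    qed
    then have "ennreal (\<Phi> (\<lambda>x. k x + h x)) \<le> content V" by (rule le_content)
    then have kh: "ennreal (\<Phi> k + \<Phi> h) \<le> content V" by (simp add: add kc hD(1))
    have "\<Phi> g \<le> \<Phi> (\<lambda>x. k x + e/3)"
      by (rule mono) (auto intro!: continuous_intros gD kc simp: k_def)
    then have gk: "\<Phi> g \<le> \<Phi> k + e/3" by (simp add: add kc const continuous_on_const)
    have k0: "0 \<le> \<Phi> k" by (rule nonneg[OF kc]) (simp add: k_def)
    have "outer (A \<inter> U) + outer (A - U) \<le> content (V \<inter> U) + content W"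
    proof (intro add_mono outer_le_content)
      show "A - U \<subseteq> W" using V e gD(4) by (auto simp: W_def)
    qed (use U V W in auto)
    also have "\<dots> \<le> (ennreal (\<Phi> g) + ennreal (e/3)) + (ennreal (\<Phi> h) + ennreal (e/3))"
      by (intro add_mono g h)
    also have "\<dots> = ennreal ((\<Phi> g + e/3) + (\<Phi> h + e/3))"
      using gD(5) hD(5) e by (simp flip: ennreal_plus)
    also have "\<dots> \<le> ennreal ((\<Phi> k + \<Phi> h) + e)"
      using gk by (intro ennreal_leI) simp
    also have "\<dots> = ennreal (\<Phi> k + \<Phi> h) + ennreal e" using k0 hD(5) e by simp
    also have "\<dots> \<le> content V + ennreal e" using kh by (intro add_mono) auto
    finally show "outer (A \<inter> U) + outer (A - U) \<le> content V + ennreal e" .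
  qed
  moreover have "outer A \<le> outer (A \<inter> U) + outer (A - U)" for A
  proof -
    interpret algebra UNIV "Pow (UNIV :: 'w set)" by (rule algebra_Pow)
    have "outer ((A \<inter> U) \<union> (A - U)) \<le> outer (A \<inter> U) + outer (A - U)"
    proof -
      have "subadditive (Pow UNIV) outer"
        using outer_measure_space_outer unfolding outer_measure_space_def
        by (intro countably_subadditive_subadditive) auto
      then show ?thesis by (rule subadditiveD) auto
    qed
    then show ?thesis by (simp add: Int_Diff_Un)
  qed
  ultimately show ?thesis
    unfolding lambda_system_def by (auto simp: Int_commute Diff_eq intro!: antisym)
qed

text \<open>The functional is bounded by the integral by a layer-cake argument, and then equality follows by
applying the bound to \<open>-g\<close>.\<close>

theorem riesz_representation:
  "\<exists>M. prob_space M \<and> sets M = sets borel \<and> (\<forall>g. continuous_on UNIV g \<longrightarrow> integral\<^sup>L M g = \<Phi> g)"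
proof -
  have ms: "measure_space UNIV (lambda_system UNIV (Pow UNIV) outer) outer"
    using sigma_algebra.caratheodory_lemma[OF sigma_algebra_Pow outer_measure_space_outer] .
  then interpret L: sigma_algebra UNIV "lambda_system UNIV (Pow UNIV) outer"
    by (simp add: measure_space_def)
  have sub: "sets borel \<subseteq> lambda_system UNIV (Pow UNIV) outer"
  proof -
    have "{S :: 'w set. open S} \<subseteq> lambda_system UNIV (Pow UNIV) outer"
      by (intro subsetI open_in_lambda_system) simp
    from L.sigma_sets_subset[OF this] show ?thesis by (simp add: sets_borel)
  qed
  define M where "M = measure_of UNIV (sets (borel :: 'w measure)) outer"
  have sa: "sigma_algebra UNIV (sets (borel :: 'w measure))"
    using sets.sigma_algebra_axioms[of "borel :: 'w measure"] unfolding space_borel .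
  have pos: "positive (sets borel) outer" by (simp add: positive_def outer_empty)
  have cadd: "countably_additive (sets borel) outer"
    unfolding countably_additive_def
  proof (intro allI impI)
    fix A :: "nat \<Rightarrow> 'w set"
    assume A: "range A \<subseteq> sets borel" "disjoint_family A" "(\<Union>i. A i) \<in> sets borel"
    have "countably_additive (lambda_system UNIV (Pow UNIV) outer) outer"
      using ms by (simp add: measure_space_def)
    then show "(\<Sum>i. outer (A i)) = outer (\<Union>i. A i)"
      unfolding countably_additive_def using A sub by (meson order.trans subsetD)
  qed
  have sets_M [measurable_cong]: "sets M = sets borel"
    unfolding M_def by (rule sigma_algebra.sets_measure_of_eq[OF sa])
  have space_M: "space M = UNIV" using sets_eq_imp_space_eq[OF sets_M] by simp
  have emeasure_M: "emeasure M A = outer A" if "A \<in> sets borel" for A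
    unfolding M_def by (rule emeasure_measure_of_sigma[OF sa pos cadd that])
  have prob: "prob_space M"
    by (rule prob_spaceI) (simp add: space_M emeasure_M outer_open content_UNIV)
  then interpret prob_space M .
  have meas: "g \<in> borel_measurable M" if "continuous_on UNIV g" for g :: "'w \<Rightarrow> real"
    using borel_measurable_continuous_onI[OF that] by (simp add: measurable_cong_sets[OF sets_M refl])
  have bdd: "\<exists>B. \<forall>x. \<bar>g x\<bar> \<le> B" if "continuous_on UNIV g" for g :: "'w \<Rightarrow> real"
    using compact_imp_bounded[OF compact_continuous_image[OF that compact_space]]
    by (auto simp: bounded_iff)
  have int: "integrable M g" if "continuous_on UNIV g" for g :: "'w \<Rightarrow> real"
  proof -
    obtain B where "\<forall>x. \<bar>g x\<bar> \<le> B" using bdd[OF \<open>continuous_on UNIV g\<close>] by blast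
    then show ?thesis by (intro integrable_const_bound[where B = B] meas \<open>continuous_on UNIV g\<close>) auto
  qed
  have unit: "\<Phi> g \<le> integral\<^sup>L M g" if g: "continuous_on UNIV g" "\<And>x. 0 \<le> g x" "\<And>x. g x \<le> 1" for g
  proof (rule field_le_epsilon)
    fix e :: real assume "0 < e"
    obtain n where n: "1 / e < real n" using reals_Archimedean2 by blast
    then have n0: "0 < real n" using \<open>0 < e\<close> by (meson divide_pos_pos less_trans zero_less_one)
    \<comment> \<open>The layers of \<open>n g\<close> between consecutive integers; each is dominated by the indicator function of
      the set where \<open>n g\<close> exceeds the lower integer.\<close>
    define h where "h = (\<lambda>k x. max 0 (min 1 (real n * g x - real k)))"
    have hc: "continuous_on UNIV (h k)" for k unfolding h_def by (intro continuous_intros g)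
    define E where "E = (\<lambda>k. {x. real k < real n * g x})"
    have Eo: "open (E k)" for k
      unfolding E_def by (intro open_Collect_less continuous_intros g)
    have indE: "integrable M (indicator (E k) :: 'w \<Rightarrow> real)" for k
      using Eo[of k] by (intro integrable_real_indicator) (auto simp: sets_M emeasure_eq_measure)
    have hE: "h k \<in> below (E k)" for k
      by (rule belowI[OF hc]) (auto simp: h_def E_def)
    have hs: "(\<Sum>k<m. h k x) = min (real n * g x) (real m)" for m x
    proof (induction m)
      case 0 then show ?case using g(2)[of x] by simp
    next
      case (Suc m) then show ?case by (simp add: h_def)
    qed
    have "(\<Sum>k<n. h k x) = real n * g x" for x
      unfolding hs using g(3)[of x] n0 by (simp add: min_def mult_le_cancel_left2)
    then have "real n * \<Phi> g = (\<Sum>k<n. \<Phi> (h k))"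
      using sum[of "{..<n}" h] hc scale[OF g(1), of "real n"] by simp
    also have "\<dots> \<le> (\<Sum>k<n. measure M (E k))"
    proof (rule sum_mono)
      fix k
      have "ennreal (\<Phi> (h k)) \<le> emeasure M (E k)"
        using le_content[OF hE] Eo by (simp add: emeasure_M outer_open)
      then show "\<Phi> (h k) \<le> measure M (E k)" by (simp add: emeasure_eq_measure)
    qed
    also have "\<dots> = (\<Sum>k<n. integral\<^sup>L M (indicator (E k)))" using Eo by (simp add: sets_M)
    also have "\<dots> = (\<integral>x. (\<Sum>k<n. indicator (E k) x) \<partial>M)"
      by (rule Bochner_Integration.integral_sum[symmetric]) (rule indE)
    also have "\<dots> \<le> (\<integral>x. real n * g x + 1 \<partial>M)"
    proof (rule integral_mono)
      show "integrable M (\<lambda>x. \<Sum>k<n. indicator (E k) x :: real)"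
        by (rule Bochner_Integration.integrable_sum) (rule indE)
      show "integrable M (\<lambda>x. real n * g x + 1)" using int[OF g(1)] by simp
      fix x
      have "(\<Sum>k<m. indicator (E k) x) \<le> min (real m) (real n * g x + 1)" for m
      proof (induction m)
        case 0 then show ?case using g(2)[of x] by simp
      next
        case (Suc m) then show ?case by (cases "x \<in> E m") (simp_all add: E_def)
      qed
      from this[of n] show "(\<Sum>k<n. indicator (E k) x) \<le> real n * g x + 1" by simp
    qed
    also have "\<dots> = real n * integral\<^sup>L M g + 1" using int[OF g(1)] by (simp add: prob_space)
    finally have "real n * (\<Phi> g - integral\<^sup>L M g) \<le> 1" by (simp add: algebra_simps)
    then have "\<Phi> g - integral\<^sup>L M g \<le> 1 / real n" using n0 by (simp add: field_simps)
    also have "1 / real n < e" using n n0 \<open>0 < e\<close> by (simp add: field_simps)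
    finally show "\<Phi> g \<le> integral\<^sup>L M g + e" by simp
  qed
  have le: "\<Phi> g \<le> integral\<^sup>L M g" if g: "continuous_on UNIV g" for g
  proof -
    obtain B where B: "\<And>x. \<bar>g x\<bar> \<le> B" using bdd[OF g] by blast
    then have B0: "0 \<le> B" by (meson abs_ge_zero order_trans)
    define c where "c = 1 / (2 * B + 1)"
    have c: "0 < c" "c * (2 * B) \<le> 1" using B0 by (auto simp: c_def field_simps)
    have "\<Phi> (\<lambda>x. c * (g x + B)) \<le> integral\<^sup>L M (\<lambda>x. c * (g x + B))"
    proof (rule unit)
      show "continuous_on UNIV (\<lambda>x. c * (g x + B))" by (intro continuous_intros g)
      fix x
      have "\<bar>g x\<bar> \<le> B" by (rule B)
      then show "0 \<le> c * (g x + B)" using c by simp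
      have "c * (g x + B) \<le> c * (2 * B)" using c \<open>\<bar>g x\<bar> \<le> B\<close> by (intro mult_left_mono) auto
      then show "c * (g x + B) \<le> 1" using c(2) by (rule order.trans)
    qed
    moreover have "\<Phi> (\<lambda>x. c * (g x + B)) = c * (\<Phi> g + B)"
      using scale[of "\<lambda>x. g x + B" c] add[OF g, of "\<lambda>_. B"] g
      by (simp add: const continuous_on_add continuous_on_const)
    moreover have "integral\<^sup>L M (\<lambda>x. c * (g x + B)) = c * (integral\<^sup>L M g + B)"
      using int[OF g] by (simp add: prob_space)
    ultimately show ?thesis using c by simp
  qed
  have "integral\<^sup>L M g = \<Phi> g" if g: "continuous_on UNIV g" for g
  proof (rule antisym)
    have "\<Phi> (\<lambda>x. (-1) * g x) \<le> integral\<^sup>L M (\<lambda>x. (-1) * g x)"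
      by (rule le) (intro continuous_intros g)
    then show "integral\<^sup>L M g \<le> \<Phi> g" using scale[OF g, of "-1"] by simp
  qed (rule le[OF g])
  then show ?thesis using prob sets_M by blast
qed

end

section \<open>Invariant states and their extreme points\<close>

lemma continuous_integrable:
  fixes g :: "'w::metric_space \<Rightarrow> real"
  assumes "compact (UNIV :: 'w set)" "prob_space M" and s: "sets M = sets borel" and g: "continuous_on UNIV g"
  shows "integrable M g"
proof -
  interpret prob_space M by fact
  obtain B where B: "\<And>x. \<bar>g x\<bar> \<le> B"
    using compact_imp_bounded[OF compact_continuous_image[OF g assms(1)]] by (auto simp: bounded_iff)
  have "g \<in> borel_measurable M"
    using borel_measurable_continuous_onI[OF g] by (simp add: measurable_cong_sets[OF s refl])
  then show ?thesis by (intro integrable_const_bound[where B = B]) (auto simp: B)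
qed

text \<open>The indicator function of an open set is a pointwise limit of continuous functions with values in \<open>[0, 1]\<close>.\<close>

lemma prob_measure_eqI_continuous:
  fixes M N :: "'w::metric_space measure"
  assumes "prob_space M" "prob_space N" "sets M = sets borel" "sets N = sets borel"
    and eq: "\<And>g :: 'w \<Rightarrow> real. continuous_on UNIV g \<Longrightarrow> integral\<^sup>L M g = integral\<^sup>L N g"
  shows "M = N"
proof -
  have lim: "(\<lambda>n. integral\<^sup>L L (\<lambda>x. min 1 (real n * depth U x))) \<longlonglongrightarrow> measure L U"
    if L: "prob_space L" "sets L = sets borel" and U: "open U" for L and U :: "'w set"
  proof -
    interpret L: prob_space L by fact
    have U_L: "U \<in> sets L" using U L(2) by simp
    have cont: "continuous_on UNIV (\<lambda>x. min 1 (real n * depth U x))" for n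
      by (intro continuous_intros depth_continuous)
    have meas: "(\<lambda>x. min 1 (real n * depth U x)) \<in> borel_measurable L" for n
      using borel_measurable_continuous_onI[OF cont] by (simp add: measurable_cong_sets[OF L(2) refl])
    have "(\<lambda>n. integral\<^sup>L L (\<lambda>x. min 1 (real n * depth U x))) \<longlonglongrightarrow> integral\<^sup>L L (indicator U :: 'w \<Rightarrow> real)"
    proof (rule integral_dominated_convergence[where w = "\<lambda>_. 1"])
      show "AE x in L. (\<lambda>n. min 1 (real n * depth U x)) \<longlonglongrightarrow> indicator U x"
      proof (rule AE_I2)
        fix x
        show "(\<lambda>n. min 1 (real n * depth U x)) \<longlonglongrightarrow> indicator U x"
        proof (cases "x \<in> U")
          case False then show ?thesis by (simp add: depth_outside)
        next
          case True
          then have d: "0 < depth U x" by (rule depth_pos[OF U])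
          obtain N where N: "1 / depth U x < real N" using reals_Archimedean2 by blast
          have "min 1 (real n * depth U x) = 1" if "N \<le> n" for n
          proof -
            have "1 / depth U x < real n" using N that by linarith
            then show ?thesis using d by (simp add: field_simps)
          qed
          then have "eventually (\<lambda>n. min 1 (real n * depth U x) = 1) sequentially"
            unfolding eventually_sequentially by blast
          then show ?thesis using True by (simp add: tendsto_eventually)
        qed
      qed
      show "AE x in L. norm (min 1 (real n * depth U x)) \<le> 1" for n
      proof (rule AE_I2)
        fix x
        have "0 \<le> real n * depth U x" by (simp add: depth_nonneg)
        then show "norm (min 1 (real n * depth U x)) \<le> 1" unfolding real_norm_def by linarith
      qed
    qed (use U_L meas in simp_all)
    then show ?thesis using U_L by simp
  qed
  interpret M: prob_space M by fact
  interpret N: prob_space N by fact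
  have opens: "measure M U = measure N U" if "open U" for U
  proof -
    have "integral\<^sup>L M (\<lambda>x. min 1 (real n * depth U x)) = integral\<^sup>L N (\<lambda>x. min 1 (real n * depth U x))" for n
      by (rule eq) (intro continuous_intros depth_continuous)
    then show ?thesis using LIMSEQ_unique lim[OF assms(1,3) that] lim[OF assms(2,4) that] by simp
  qed
  show ?thesis
  proof (rule measure_eqI_generator_eq[where E = "{S. open S}" and \<Omega> = UNIV and A = "\<lambda>_. UNIV"])
    show "Int_stable {S :: 'w set. open S}" by (auto simp: Int_stable_def)
    show "emeasure M X = emeasure N X" if "X \<in> {S. open S}" for X
      using opens that by (simp add: M.emeasure_eq_measure N.emeasure_eq_measure)
    show "sets M = sigma_sets UNIV {S. open S}" "sets N = sigma_sets UNIV {S. open S}"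
      using assms(3,4) by (simp_all add: sets_borel)
  qed (auto simp: M.emeasure_eq_measure)
qed

lemma flow_continuous:
  assumes "continuous_flow \<sigma>"
  shows "continuous_on UNIV (\<sigma> t)" "continuous_on UNIV (\<lambda>t. \<sigma> t \<omega>)"
proof -
  have c: "continuous_on UNIV (\<lambda>(t, \<omega>). \<sigma> t \<omega>)" using assms by (simp add: continuous_flow_def)
  show "continuous_on UNIV (\<sigma> t)"
    using continuous_on_compose2[OF c continuous_on_Pair[OF continuous_on_const continuous_on_id], of t] by simp
  show "continuous_on UNIV (\<lambda>t. \<sigma> t \<omega>)"
    using continuous_on_compose2[OF c continuous_on_Pair[OF continuous_on_id continuous_on_const], of \<omega>] by simp
qed

lemma flow_simps:
  assumes "continuous_flow \<sigma>"
  shows "\<sigma> 0 \<omega> = \<omega>" "\<sigma> s (\<sigma> t \<omega>) = \<sigma> (s + t) \<omega>"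
  using assms by (auto simp: continuous_flow_def)

lemma flow_image_eq_vimage:
  assumes "continuous_flow \<sigma>"
  shows "\<sigma> t ` A = \<sigma> (- t) -` A"
proof -
  note f = flow_simps[OF assms]
  have inv: "\<sigma> (- t) (\<sigma> t x) = x" "\<sigma> t (\<sigma> (- t) x) = x" for x by (simp_all add: f)
  show ?thesis
  proof
    show "\<sigma> t ` A \<subseteq> \<sigma> (- t) -` A" by (auto simp: inv)
    show "\<sigma> (- t) -` A \<subseteq> \<sigma> t ` A"
    proof
      fix x assume "x \<in> \<sigma> (- t) -` A"
      then show "x \<in> \<sigma> t ` A" using inv(2)[of x] by (intro image_eqI[of _ _ "\<sigma> (- t) x"]) auto
    qed
  qed
qed

text \<open>The value at discontinuous functions is normalized to zero.  Thereby functionals that agree on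
continuous functions are equal, and the set is compact in the product topology.\<close>

definition invariant_states ::
  "(real \<Rightarrow> 'w \<Rightarrow> 'w) \<Rightarrow> (('w::metric_space \<Rightarrow> real) \<Rightarrow> real) set" where
  "invariant_states \<sigma> = {\<Phi>. positive_functional \<Phi> \<and> (\<forall>g. \<not> continuous_on UNIV g \<longrightarrow> \<Phi> g = 0) \<and>
     (\<forall>g t. continuous_on UNIV g \<longrightarrow> \<Phi> (\<lambda>x. g (\<sigma> t x)) = \<Phi> g)}"

lemma coordinate_continuous: "continuous_on UNIV (\<lambda>\<Phi> :: 'a \<Rightarrow> real. \<Phi> g)"
  by simp

lemma closed_Collect_imp_eq:
  fixes F G :: "('a \<Rightarrow> real) \<Rightarrow> real"
  assumes "continuous_on UNIV F" "continuous_on UNIV G"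
  shows "closed {\<Phi>. P \<longrightarrow> F \<Phi> = G \<Phi>}"
  using closed_Collect_eq[OF assms] by (cases P) simp_all

lemma closed_Collect_imp_le:
  fixes F G :: "('a \<Rightarrow> real) \<Rightarrow> real"
  assumes "continuous_on UNIV F" "continuous_on UNIV G"
  shows "closed {\<Phi>. P \<longrightarrow> F \<Phi> \<le> G \<Phi>}"
  using closed_Collect_le[OF assms] by (cases P) simp_all

lemma closed_positive_functionals:
  "closed {\<Phi> :: ('w::metric_space \<Rightarrow> real) \<Rightarrow> real. positive_functional \<Phi> \<and> (\<forall>g. \<not> continuous_on UNIV g \<longrightarrow> \<Phi> g = 0)}"
proof -
  note cc = coordinate_continuous[where 'a = "'w \<Rightarrow> real"]
  have 1: "closed {\<Phi> :: ('w \<Rightarrow> real) \<Rightarrow> real. \<not> continuous_on UNIV g \<longrightarrow> \<Phi> g = 0}" for g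
    by (rule closed_Collect_imp_eq[OF cc continuous_on_const])
  have 2: "closed {\<Phi> :: ('w \<Rightarrow> real) \<Rightarrow> real. continuous_on UNIV g \<longrightarrow> continuous_on UNIV h \<longrightarrow>
      \<Phi> (\<lambda>x. g x + h x) = \<Phi> g + \<Phi> h}" for g h
    using closed_Collect_imp_eq[OF cc continuous_on_add[OF cc cc], of "continuous_on UNIV g \<and> continuous_on UNIV h"]
    by (simp only: imp_conjL)
  have 3: "closed {\<Phi> :: ('w \<Rightarrow> real) \<Rightarrow> real. continuous_on UNIV g \<longrightarrow> \<Phi> (\<lambda>x. c * g x) = c * \<Phi> g}" for g c
    by (rule closed_Collect_imp_eq[OF cc continuous_on_mult_left[OF cc]])
  have 4: "closed {\<Phi> :: ('w \<Rightarrow> real) \<Rightarrow> real. continuous_on UNIV g \<longrightarrow> (\<forall>x. 0 \<le> g x) \<longrightarrow> 0 \<le> \<Phi> g}" for g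
    using closed_Collect_imp_le[OF continuous_on_const cc, of "continuous_on UNIV g \<and> (\<forall>x. 0 \<le> g x)"]
    by (simp only: imp_conjL)
  have 5: "closed {\<Phi> :: ('w \<Rightarrow> real) \<Rightarrow> real. \<Phi> (\<lambda>_. 1) = 1}"
    by (rule closed_Collect_eq[OF cc continuous_on_const])
  have "closed ({\<Phi> :: ('w \<Rightarrow> real) \<Rightarrow> real. compact (UNIV :: 'w set)} \<inter>
    ({\<Phi>. \<forall>g. \<not> continuous_on UNIV g \<longrightarrow> \<Phi> g = 0} \<inter>
    ({\<Phi>. \<forall>g h. continuous_on UNIV g \<longrightarrow> continuous_on UNIV h \<longrightarrow> \<Phi> (\<lambda>x. g x + h x) = \<Phi> g + \<Phi> h} \<inter>
    ({\<Phi>. \<forall>g c. continuous_on UNIV g \<longrightarrow> \<Phi> (\<lambda>x. c * g x) = c * \<Phi> g} \<inter>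
    ({\<Phi>. \<forall>g. continuous_on UNIV g \<longrightarrow> (\<forall>x. 0 \<le> g x) \<longrightarrow> 0 \<le> \<Phi> g} \<inter> {\<Phi>. \<Phi> (\<lambda>_. 1) = 1})))))"
    by (intro closed_Int closed_Collect_all closed_Collect_const 1 2 3 4 5)
  also have "\<dots> = {\<Phi>. positive_functional \<Phi> \<and> (\<forall>g. \<not> continuous_on UNIV g \<longrightarrow> \<Phi> g = 0)}"
    by (rule set_eqI, unfold positive_functional_def Int_iff mem_Collect_eq, intro iffI conjI; elim conjE; assumption)
  finally show ?thesis .
qed

lemma positive_functional_abs_le:
  assumes "positive_functional \<Phi>" "continuous_on UNIV g" "\<And>x. \<bar>g x\<bar> \<le> B"
  shows "\<bar>\<Phi> g\<bar> \<le> B"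
proof -
  interpret positive_functional \<Phi> by fact
  have *: "- B \<le> g x" "g x \<le> B" for x using assms(3)[of x] by auto
  have "\<Phi> (\<lambda>_. - B) \<le> \<Phi> g" "\<Phi> g \<le> \<Phi> (\<lambda>_. B)"
    using * by (auto intro!: mono assms continuous_on_const)
  then show ?thesis by (simp add: const abs_le_iff)
qed

text \<open>The functionals lie in a product of compact intervals, since a normalized positive functional is
bounded by the supremum norm; this is Tychonoff's theorem.\<close>

lemma compact_positive_functionals:
  assumes "compact (UNIV :: 'w::metric_space set)"
  shows "compact {\<Phi> :: ('w \<Rightarrow> real) \<Rightarrow> real. positive_functional \<Phi> \<and> (\<forall>g. \<not> continuous_on UNIV g \<longrightarrow> \<Phi> g = 0)}"
    (is "compact ?P")
proof -
  define S :: "('w \<Rightarrow> real) \<Rightarrow> real set" where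
    "S g = (if continuous_on UNIV g then {- (SUP x. \<bar>g x\<bar>)..(SUP x. \<bar>g x\<bar>)} else {0})" for g
  have "compact (S g)" for g by (simp add: S_def)
  then have "compactin (product_topology (\<lambda>_. euclidean) UNIV) (PiE UNIV S)"
    unfolding compactin_PiE by simp
  then have box: "compact (PiE UNIV S)" by (simp add: euclidean_product_topology)
  have sub: "?P \<subseteq> PiE UNIV S"
  proof
    fix \<Phi> assume P: "\<Phi> \<in> ?P"
    have "\<Phi> g \<in> S g" for g
    proof (cases "continuous_on UNIV g")
      case True
      have "bounded (range g)"
        by (rule compact_imp_bounded[OF compact_continuous_image[OF True assms]])
      then have "bdd_above (range (\<lambda>x. \<bar>g x\<bar>))"
        unfolding bounded_iff bdd_above_def by auto
      then have b: "\<bar>g x\<bar> \<le> (SUP x. \<bar>g x\<bar>)" for x by (rule cSUP_upper[OF UNIV_I])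
      have "positive_functional \<Phi>" using CollectD[OF P] by (rule conjunct1)
      from this True b have "\<bar>\<Phi> g\<bar> \<le> (SUP x. \<bar>g x\<bar>)" by (rule positive_functional_abs_le)
      then show ?thesis using True unfolding S_def abs_le_iff by (simp add: minus_le_iff)
    next
      case False
      have "\<Phi> g = 0" using CollectD[OF P, THEN conjunct2] False by (elim allE impE)
      then show ?thesis using False by (simp add: S_def)
    qed
    then show "\<Phi> \<in> PiE UNIV S" by (intro PiE_I) simp_all
  qed
  have "compact (PiE UNIV S \<inter> ?P)" by (rule compact_Int_closed[OF box closed_positive_functionals])
  then show ?thesis by (rule back_subst[where P = compact]) (rule inf.absorb2[OF sub])
qed

lemma closed_invariant_states:
  fixes \<sigma> :: "real \<Rightarrow> 'w::metric_space \<Rightarrow> 'w"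
  shows "closed (invariant_states \<sigma>)"
proof -
  have "closed {\<Phi> :: ('w \<Rightarrow> real) \<Rightarrow> real. \<forall>g t. continuous_on UNIV g \<longrightarrow> \<Phi> (\<lambda>x. g (\<sigma> t x)) = \<Phi> g}"
    by (rule closed_Collect_all, rule closed_Collect_all, rule closed_Collect_imp_eq; rule coordinate_continuous)
  from closed_Int[OF closed_positive_functionals this]
  show ?thesis
    by (rule back_subst[where P = closed])
      (rule set_eqI, unfold invariant_states_def mem_Collect_eq Int_iff conj_assoc, rule refl)
qed

text \<open>A cluster point of the averages along orbit segments of length \<open>n + 1\<close> has the required properties, since each of them is a closed condition which the averages
satisfy up to an error of order \<open>1 / n\<close>.  A shift in time changes the integral over a segment only by the contributions of its two ends.\<close>

lemma invariant_state_below_average: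
  fixes \<sigma> :: "real \<Rightarrow> 'w::metric_space \<Rightarrow> 'w" and g\<^sub>0 :: "'w \<Rightarrow> real"
  assumes comp: "compact (UNIV :: 'w set)" and flow: "continuous_flow \<sigma>" and g\<^sub>0: "continuous_on UNIV g\<^sub>0"
    and avg: "\<And>n :: nat. \<exists>\<omega>. primitive (\<lambda>t. g\<^sub>0 (\<sigma> t \<omega>)) (real n) \<le> 1"
  shows "\<exists>\<Phi>\<in>invariant_states \<sigma>. \<Phi> g\<^sub>0 \<le> 0"
proof -
  have "\<forall>n. \<exists>\<omega>. primitive (\<lambda>t. g\<^sub>0 (\<sigma> t \<omega>)) (real (Suc n)) \<le> 1" using avg by blast
  then obtain w where w: "\<And>n. primitive (\<lambda>t. g\<^sub>0 (\<sigma> t (w n))) (real (Suc n)) \<le> 1"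
    unfolding choice_iff by blast
  define \<Psi> where "\<Psi> = (\<lambda>n (g :: 'w \<Rightarrow> real).
    if continuous_on UNIV g then primitive (\<lambda>t. g (\<sigma> t (w n))) (real (Suc n)) / real (Suc n) else 0)"
  note fc = flow_continuous[OF flow]
  have gc: "continuous_on UNIV (\<lambda>t. g (\<sigma> t \<omega>))" if "continuous_on UNIV g" for g :: "'w \<Rightarrow> real" and \<omega>
    by (rule continuous_on_compose2[OF that fc(2)]) auto
  let ?P = "{\<Phi> :: ('w \<Rightarrow> real) \<Rightarrow> real. positive_functional \<Phi> \<and> (\<forall>g. \<not> continuous_on UNIV g \<longrightarrow> \<Phi> g = 0)}"
  have "positive_functional (\<Psi> n)" for n
  proof
    fix g h :: "'w \<Rightarrow> real" and c :: real
    assume g: "continuous_on UNIV g"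
    show "\<Psi> n (\<lambda>x. c * g x) = c * \<Psi> n g"
      using g by (simp add: \<Psi>_def continuous_on_mult_left primitive_cmult[OF gc[OF g]])
    show "0 \<le> \<Psi> n g" if "\<And>x. 0 \<le> g x"
      using primitive_mono[OF continuous_on_const[of UNIV 0] gc[OF g, of "w n"], where s = 0 and t = "real (Suc n)"] that g
      by (simp add: \<Psi>_def primitive_const)
    assume h: "continuous_on UNIV h"
    show "\<Psi> n (\<lambda>x. g x + h x) = \<Psi> n g + \<Psi> n h"
      using g h by (simp add: \<Psi>_def continuous_on_add primitive_add[OF gc[OF g] gc[OF h]] add_divide_distrib)
  qed (auto simp: comp \<Psi>_def primitive_const continuous_on_const)
  then have \<Psi>P: "\<Psi> n \<in> ?P" for n by (simp add: \<Psi>_def)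
  have "\<exists>\<Phi>\<in>?P. nhds \<Phi> \<sqinter> filtermap \<Psi> sequentially \<noteq> bot"
    using compact_positive_functionals[OF comp] \<Psi>P unfolding compact_filter
    by (auto simp: filtermap_bot_iff eventually_filtermap)
  then obtain \<Phi> where \<Phi>: "\<Phi> \<in> ?P" and nb: "nhds \<Phi> \<sqinter> filtermap \<Psi> sequentially \<noteq> bot" by blast
  \<comment> \<open>Closed conditions that eventually hold for the averages hold for the cluster point.\<close>
  have key: "\<Phi> \<in> S" if S: "closed S" "eventually (\<lambda>n. \<Psi> n \<in> S) sequentially" for S
  proof (rule ccontr)
    assume "\<Phi> \<notin> S"
    then have "eventually (\<lambda>x. x \<in> - S) (nhds \<Phi>)" using S(1) by (intro eventually_nhds_in_open) auto
    moreover have "eventually (\<lambda>x. x \<in> S) (filtermap \<Psi> sequentially)" using S(2) by (simp add: eventually_filtermap)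
    ultimately have "eventually (\<lambda>x. False) (nhds \<Phi> \<sqinter> filtermap \<Psi> sequentially)"
      unfolding eventually_inf by (metis ComplD)
    then show False using nb by (simp add: trivial_limit_def)
  qed
  have large: "eventually (\<lambda>n. c / real (Suc n) \<le> e) sequentially" if "0 < e" for c e :: real
  proof -
    have "(\<lambda>n. c * inverse (real (Suc n))) \<longlonglongrightarrow> c * 0"
      by (intro tendsto_mult tendsto_const LIMSEQ_inverse_real_of_nat)
    then have "eventually (\<lambda>n. c * inverse (real (Suc n)) < e) sequentially"
      using that by (intro order_tendstoD(2)[of _ "c * 0"]) auto
    then show ?thesis by eventually_elim (simp add: divide_inverse)
  qed
  have inv: "\<Phi> (\<lambda>x. g (\<sigma> s x)) = \<Phi> g" if g: "continuous_on UNIV g" for g s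
  proof -
    obtain B where B: "\<And>x. \<bar>g x\<bar> \<le> B"
      using compact_imp_bounded[OF compact_continuous_image[OF g comp]] by (auto simp: bounded_iff)
    have gs: "continuous_on UNIV (\<lambda>x. g (\<sigma> s x))" by (rule continuous_on_compose2[OF g fc(1)]) auto
    have est: "\<bar>\<Psi> n (\<lambda>x. g (\<sigma> s x)) - \<Psi> n g\<bar> \<le> (2 * B * \<bar>s\<bar>) / real (Suc n)" for n
    proof -
      let ?h = "\<lambda>t. g (\<sigma> t (w n))" and ?N = "real (Suc n)"
      have "\<bar>primitive ?h (?N + s) - primitive ?h ?N\<bar> \<le> B * \<bar>?N + s - ?N\<bar>"
        by (rule primitive_bound[OF gc[OF g]]) (rule B)
      moreover have "\<bar>primitive ?h s - primitive ?h 0\<bar> \<le> B * \<bar>s - 0\<bar>"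
        by (rule primitive_bound[OF gc[OF g]]) (rule B)
      moreover have "primitive (\<lambda>t. g (\<sigma> s (\<sigma> t (w n)))) ?N = primitive ?h (?N + s) - primitive ?h s"
        using primitive_shift[OF gc[OF g, of "w n"], of s ?N] by (simp add: flow_simps[OF flow] add.commute)
      ultimately have "\<bar>primitive (\<lambda>t. g (\<sigma> s (\<sigma> t (w n)))) ?N - primitive ?h ?N\<bar> \<le> 2 * B * \<bar>s\<bar>"
        by (simp add: abs_le_iff)
      moreover have "\<Psi> n (\<lambda>x. g (\<sigma> s x)) - \<Psi> n g = (primitive (\<lambda>t. g (\<sigma> s (\<sigma> t (w n)))) ?N - primitive ?h ?N) / ?N"
        unfolding \<Psi>_def diff_divide_distrib using g gs by simp
      ultimately show ?thesis by (simp only: abs_divide abs_of_nat divide_right_mono of_nat_0_le_iff)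
    qed
    have "\<bar>\<Phi> (\<lambda>x. g (\<sigma> s x)) - \<Phi> g\<bar> \<le> 0 + e" if "0 < e" for e
    proof -
      have "\<Phi> \<in> {\<Phi>. \<bar>\<Phi> (\<lambda>x. g (\<sigma> s x)) - \<Phi> g\<bar> \<le> e}"
      proof (rule key)
        show "closed {\<Phi> :: ('w \<Rightarrow> real) \<Rightarrow> real. \<bar>\<Phi> (\<lambda>x. g (\<sigma> s x)) - \<Phi> g\<bar> \<le> e}"
          by (intro closed_Collect_le coordinate_continuous continuous_intros)
        show "eventually (\<lambda>n. \<Psi> n \<in> {\<Phi>. \<bar>\<Phi> (\<lambda>x. g (\<sigma> s x)) - \<Phi> g\<bar> \<le> e}) sequentially"
          using large[OF that, of "2 * B * \<bar>s\<bar>"] by eventually_elim (use est order.trans in blast)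
      qed
      then show ?thesis by simp
    qed
    then have "\<bar>\<Phi> (\<lambda>x. g (\<sigma> s x)) - \<Phi> g\<bar> \<le> 0" by (rule field_le_epsilon)
    then show ?thesis by simp
  qed
  have "\<Phi> g\<^sub>0 \<le> 0 + e" if "0 < e" for e
  proof -
    have "\<Phi> \<in> {\<Phi>. \<Phi> g\<^sub>0 \<le> e}"
    proof (rule key)
      show "closed {\<Phi> :: ('w \<Rightarrow> real) \<Rightarrow> real. \<Phi> g\<^sub>0 \<le> e}"
        by (intro closed_Collect_le coordinate_continuous continuous_intros)
      show "eventually (\<lambda>n. \<Psi> n \<in> {\<Phi>. \<Phi> g\<^sub>0 \<le> e}) sequentially"
        using large[OF that, of 1]
      proof eventually_elim
        case (elim n)
        have "\<Psi> n g\<^sub>0 \<le> 1 / real (Suc n)"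
          unfolding \<Psi>_def using w[of n] g\<^sub>0 by (simp add: divide_right_mono)
        then show ?case using elim by simp
      qed
    qed
    then show ?thesis by simp
  qed
  then have "\<Phi> g\<^sub>0 \<le> 0" by (rule field_le_epsilon)
  then show ?thesis using \<Phi> inv by (auto simp: invariant_states_def)
qed

lemma compact_invariant_states:
  fixes \<sigma> :: "real \<Rightarrow> 'w::metric_space \<Rightarrow> 'w"
  assumes "compact (UNIV :: 'w set)"
  shows "compact (invariant_states \<sigma>)"
proof -
  let ?P = "{\<Phi> :: ('w \<Rightarrow> real) \<Rightarrow> real. positive_functional \<Phi> \<and> (\<forall>g. \<not> continuous_on UNIV g \<longrightarrow> \<Phi> g = 0)}"
  have sub: "invariant_states \<sigma> \<subseteq> ?P"
    by (rule subsetI, unfold invariant_states_def mem_Collect_eq, elim conjE, intro conjI)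
  have "compact (?P \<inter> invariant_states \<sigma>)"
    by (rule compact_Int_closed[OF compact_positive_functionals[OF assms] closed_invariant_states])
  then show ?thesis by (rule back_subst[where P = compact]) (rule inf.absorb2[OF sub])
qed

lemma compact_chain_Inter_nonempty:
  fixes \<C> :: "'a::topological_space set set"
  assumes "\<C> \<noteq> {}" and c: "compact P" "\<And>F. F \<in> \<C> \<Longrightarrow> closed F \<and> F \<noteq> {} \<and> F \<subseteq> P"
    and chain: "\<And>F G. F \<in> \<C> \<Longrightarrow> G \<in> \<C> \<Longrightarrow> F \<subseteq> G \<or> G \<subseteq> F"
  shows "\<Inter>\<C> \<noteq> {}"
proof -
  have "P \<inter> \<Inter>\<C> \<noteq> {}"
  proof (rule compact_imp_fip[OF c(1)])
    fix \<D> assume D: "finite \<D>" "\<D> \<subseteq> \<C>"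
    show "P \<inter> \<Inter>\<D> \<noteq> {}"
    proof (cases "\<D> = {}")
      case True then show ?thesis using assms(1) c(2) by auto
    next
      case False
      have "\<Inter>\<D> \<in> \<C>" using D(1) False D(2)
      proof (induction rule: finite_ne_induct)
        case (insert F \<D>)
        then have "F \<in> \<C>" "\<Inter>\<D> \<in> \<C>" by auto
        then show ?case using chain[of F "\<Inter>\<D>"] by (auto simp: inf.absorb1 inf.absorb2)
      qed simp
      then show ?thesis using c(2)[of "\<Inter>\<D>"] by auto
    qed
  qed (use c(2) in blast)
  then show ?thesis by blast
qed

text \<open>A minimal closed face of \<open>P\<close> inside the set of minimizers of \<open>g\<^sub>0\<close> exists by Zorn's lemma and
compactness.  It is a singleton: for every \<open>g\<close>, the minimizers of \<open>g\<close> in a face form a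
face again, hence by minimality every coordinate is constant on it.\<close>

lemma exists_extreme_state:
  fixes P :: "('a \<Rightarrow> real) set"
  assumes P: "compact P" "closed P" "P \<noteq> {}"
  shows "\<exists>\<Phi>\<in>P. (\<forall>\<Psi>\<in>P. \<Phi> g\<^sub>0 \<le> \<Psi> g\<^sub>0) \<and>
    (\<forall>\<Psi>\<in>P. \<forall>\<Psi>'\<in>P. \<forall>c. 0 < c \<longrightarrow> c < 1 \<longrightarrow> (\<forall>g. \<Phi> g = c * \<Psi> g + (1 - c) * \<Psi>' g) \<longrightarrow> \<Psi> = \<Phi>)"
proof -
  define face where "face = (\<lambda>F. closed F \<and> F \<noteq> {} \<and> F \<subseteq> P \<and>
    (\<forall>\<Phi>\<in>F. \<forall>\<Psi>\<in>P. \<forall>\<Psi>'\<in>P. \<forall>c. 0 < c \<longrightarrow> c < 1 \<longrightarrow> (\<forall>g. \<Phi> g = c * \<Psi> g + (1 - c) * \<Psi>' g) \<longrightarrow> \<Psi> \<in> F \<and> \<Psi>' \<in> F))"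
  define argmin where "argmin = (\<lambda>(F :: ('a \<Rightarrow> real) set) (g :: 'a). {\<Phi>\<in>F. \<forall>\<Psi>\<in>F. \<Phi> g \<le> (\<Psi> g :: real)})"
  have face_argmin: "face (argmin F g)" if F: "face F" for F g
  proof -
    have "closed F" "F \<subseteq> P" using F unfolding face_def by blast+
    then have "compact F" using compact_Int_closed[OF P(1), of F] by (simp add: inf.absorb2)
    moreover have "continuous_on F (\<lambda>\<Phi>. \<Phi> g)" by (rule continuous_on_subset[OF coordinate_continuous]) simp
    ultimately obtain \<Phi>\<^sub>0 where m: "\<Phi>\<^sub>0 \<in> F" "\<And>\<Psi>. \<Psi> \<in> F \<Longrightarrow> \<Phi>\<^sub>0 g \<le> \<Psi> g"
      using continuous_attains_inf[of F "\<lambda>\<Phi>. \<Phi> g"] F unfolding face_def by blast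
    have eq: "argmin F g = F \<inter> {\<Phi>. \<Phi> g \<le> \<Phi>\<^sub>0 g}"
      using m by (auto simp: argmin_def intro: order.trans)
    show ?thesis unfolding face_def
    proof (intro conjI ballI allI impI)
      show "closed (argmin F g)" unfolding eq using F
        unfolding face_def by (intro closed_Int closed_Collect_le coordinate_continuous continuous_on_const) blast
      show "argmin F g \<noteq> {}" unfolding eq using m(1) by auto
      show "argmin F g \<subseteq> P" unfolding eq using F unfolding face_def by blast
      fix \<Phi> \<Psi> \<Psi>' c
      assume *: "\<Phi> \<in> argmin F g" "\<Psi> \<in> P" "\<Psi>' \<in> P" "0 < c" "c < 1" "\<forall>g. \<Phi> g = c * \<Psi> g + (1 - c) * \<Psi>' g"
      then have "\<Phi> \<in> F" unfolding eq by blast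
      then have in_F: "\<Psi> \<in> F" "\<Psi>' \<in> F" using F *(2-6) unfolding face_def by blast+
      have ge: "\<Phi>\<^sub>0 g \<le> \<Psi> g" "\<Phi>\<^sub>0 g \<le> \<Psi>' g" using m in_F by auto
      have "\<Phi> g \<le> \<Phi>\<^sub>0 g" using *(1) unfolding eq by blast
      then have le: "c * \<Psi> g + (1 - c) * \<Psi>' g \<le> \<Phi>\<^sub>0 g" using *(6) by metis
      have "c * \<Phi>\<^sub>0 g \<le> c * \<Psi> g" "(1 - c) * \<Phi>\<^sub>0 g \<le> (1 - c) * \<Psi>' g" using ge *(4,5) by (auto intro!: mult_left_mono)
      then have "c * \<Psi> g \<le> c * \<Phi>\<^sub>0 g" "(1 - c) * \<Psi>' g \<le> (1 - c) * \<Phi>\<^sub>0 g" using le by (auto simp: algebra_simps)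
      then have "\<Psi> g \<le> \<Phi>\<^sub>0 g" "\<Psi>' g \<le> \<Phi>\<^sub>0 g" using *(4,5) by auto
      then show "\<Psi> \<in> argmin F g" "\<Psi>' \<in> argmin F g" unfolding eq using in_F by simp_all
    qed
  qed
  have "face P" unfolding face_def using P by blast
  then have start: "face (argmin P g\<^sub>0)" by (rule face_argmin)
  \<comment> \<open>The set of complements turns the search for a minimal face into one for a maximal element.\<close>
  define \<A> where "\<A> = uminus ` {F. face F \<and> F \<subseteq> argmin P g\<^sub>0}"
  have "\<exists>M\<in>\<A>. \<forall>X\<in>\<A>. M \<subseteq> X \<longrightarrow> X = M"
  proof (rule subset_Zorn_nonempty)
    show "\<A> \<noteq> {}" using start by (auto simp: \<A>_def)
    fix \<C> assume C: "\<C> \<noteq> {}" "subset.chain \<A> \<C>"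
    define \<D> where "\<D> = uminus ` \<C>"
    have D: "face F" "F \<subseteq> argmin P g\<^sub>0" if "F \<in> \<D>" for F
      using that C(2) by (auto simp: \<D>_def \<A>_def subset_chain_def subset_iff)
    have "\<Inter>\<D> \<noteq> {}"
    proof (rule compact_chain_Inter_nonempty[OF _ P(1)])
      show "\<D> \<noteq> {}" using C by (auto simp: \<D>_def)
      show "closed F \<and> F \<noteq> {} \<and> F \<subseteq> P" if "F \<in> \<D>" for F using D(1)[OF that] unfolding face_def by blast
      show "F \<subseteq> G \<or> G \<subseteq> F" if "F \<in> \<D>" "G \<in> \<D>" for F G
        using that C(2) by (auto simp: \<D>_def subset_chain_def)
    qed
    have "face (\<Inter>\<D>)"
      unfolding face_def
    proof (intro conjI ballI allI impI)
      show "closed (\<Inter>\<D>)" using D(1) unfolding face_def by (intro closed_Inter) blast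
      show "\<Inter>\<D> \<noteq> {}" by fact
      show "\<Inter>\<D> \<subseteq> P"
      proof -
        obtain F where "F \<in> \<D>" using C(1) by (auto simp: \<D>_def)
        moreover have "F \<subseteq> P" using D(1)[OF \<open>F \<in> \<D>\<close>] unfolding face_def by blast
        ultimately show ?thesis by blast
      qed
      fix \<Phi> \<Psi> \<Psi>' c
      assume *: "\<Phi> \<in> \<Inter>\<D>" "\<Psi> \<in> P" "\<Psi>' \<in> P" "0 < c" "c < 1" "\<forall>g. \<Phi> g = c * \<Psi> g + (1 - c) * \<Psi>' g"
      have "\<Psi> \<in> F \<and> \<Psi>' \<in> F" if "F \<in> \<D>" for F
      proof -
        have "\<Phi> \<in> F" using *(1) that by blast
        then show ?thesis using D(1)[OF that] *(2-6) unfolding face_def by blast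
      qed
      then show "\<Psi> \<in> \<Inter>\<D>" "\<Psi>' \<in> \<Inter>\<D>" by auto
    qed
    moreover have "\<Inter>\<D> \<subseteq> argmin P g\<^sub>0" using D(2) C(1) by (auto simp: \<D>_def)
    moreover have "\<Union>\<C> = - \<Inter>\<D>" by (auto simp: \<D>_def)
    ultimately show "\<Union>\<C> \<in> \<A>" unfolding \<A>_def by blast
  qed
  then obtain F where F: "face F" "F \<subseteq> argmin P g\<^sub>0" and minimal: "\<And>G. face G \<Longrightarrow> G \<subseteq> F \<Longrightarrow> G = F"
  proof -
    assume hyp: "\<And>F. face F \<Longrightarrow> F \<subseteq> argmin P g\<^sub>0 \<Longrightarrow> (\<And>G. face G \<Longrightarrow> G \<subseteq> F \<Longrightarrow> G = F) \<Longrightarrow> thesis"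
    assume "\<exists>M\<in>\<A>. \<forall>X\<in>\<A>. M \<subseteq> X \<longrightarrow> X = M"
    then obtain F where F: "face F" "F \<subseteq> argmin P g\<^sub>0" and m: "\<forall>X\<in>\<A>. - F \<subseteq> X \<longrightarrow> X = - F"
      by (auto simp: \<A>_def)
    show thesis
    proof (rule hyp[OF F])
      fix G assume G: "face G" "G \<subseteq> F"
      then have "- G \<in> \<A>" using F by (auto simp: \<A>_def)
      then show "G = F" using m G(2) by auto
    qed
  qed
  obtain \<Phi> where \<Phi>: "\<Phi> \<in> F" using F(1) unfolding face_def by blast
  have single: "\<Psi> = \<Phi>" if "\<Psi> \<in> F" for \<Psi>
  proof
    fix g
    have "argmin F g = F" by (rule minimal[OF face_argmin[OF F(1)]]) (auto simp: argmin_def)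
    then show "\<Psi> g = \<Phi> g" using that \<Phi> by (auto simp: argmin_def intro: antisym)
  qed
  show ?thesis
  proof (intro bexI[of _ \<Phi>] conjI ballI allI impI)
    show "\<Phi> \<in> P" using \<Phi> F(1) unfolding face_def by blast
    show "\<Phi> g\<^sub>0 \<le> \<Psi> g\<^sub>0" if "\<Psi> \<in> P" for \<Psi> using \<Phi> F(2) that by (auto simp: argmin_def)
    fix \<Psi> \<Psi>' c
    assume *: "\<Psi> \<in> P" "\<Psi>' \<in> P" "0 < c" "c < 1" "\<forall>g. \<Phi> g = c * \<Psi> g + (1 - c) * \<Psi>' g"
    then have "\<Psi> \<in> F" using F(1) \<Phi> unfolding face_def by blast
    then show "\<Psi> = \<Phi>" by (rule single)
  qed
qed

section \<open>Ergodic measures\<close>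

definition state_of :: "'w::metric_space measure \<Rightarrow> ('w \<Rightarrow> real) \<Rightarrow> real" where
  "state_of M g = (if continuous_on UNIV g then integral\<^sup>L M g else 0)"

lemma state_of_invariant:
  fixes \<sigma> :: "real \<Rightarrow> 'w::metric_space \<Rightarrow> 'w"
  assumes comp: "compact (UNIV :: 'w set)" and flow: "continuous_flow \<sigma>"
    and M: "prob_space M" "sets M = sets borel" and inv: "\<And>t. distr M borel (\<sigma> t) = M"
  shows "state_of M \<in> invariant_states \<sigma>"
proof -
  interpret prob_space M by fact
  note int = continuous_integrable[OF comp M]
  have pf: "positive_functional (state_of M)"
  proof
    fix g h :: "'w \<Rightarrow> real" and c :: real
    assume g: "continuous_on UNIV g"
    show "state_of M (\<lambda>x. c * g x) = c * state_of M g"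
      using g continuous_on_mult_left[OF g, of c] by (simp add: state_of_def)
    show "0 \<le> state_of M g" if "\<And>x. 0 \<le> g x"
      using g that by (simp add: state_of_def)
    assume h: "continuous_on UNIV h"
    show "state_of M (\<lambda>x. g x + h x) = state_of M g + state_of M h"
      using g h continuous_on_add[OF g h] int[OF g] int[OF h] by (simp add: state_of_def)
  next
    show "state_of M (\<lambda>_. 1) = 1"
      using continuous_on_const[of UNIV "1 :: real"] by (simp add: state_of_def prob_space)
  qed (rule comp)
  have "state_of M (\<lambda>x. g (\<sigma> t x)) = state_of M g" if g: "continuous_on UNIV g" for g t
  proof -
    have gs: "continuous_on UNIV (\<lambda>x. g (\<sigma> t x))"
      by (rule continuous_on_compose2[OF g flow_continuous(1)[OF flow]]) simp
    have "\<sigma> t \<in> measurable M borel"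
      using borel_measurable_continuous_onI[OF flow_continuous(1)[OF flow, of t]]
      by (simp add: measurable_cong_sets[OF M(2) refl])
    then have "integral\<^sup>L (distr M borel (\<sigma> t)) g = integral\<^sup>L M (\<lambda>x. g (\<sigma> t x))"
      using borel_measurable_continuous_onI[OF g] by (rule integral_distr)
    then show ?thesis using g gs by (simp add: state_of_def inv)
  qed
  moreover have "\<forall>g. \<not> continuous_on UNIV g \<longrightarrow> state_of M g = 0" by (simp add: state_of_def)
  ultimately show ?thesis using pf unfolding invariant_states_def by blast
qed

lemma uniform_measure_invariant:
  assumes M: "prob_space M" "sets M = sets borel" and flow: "continuous_flow \<sigma>"
    and inv: "\<And>t. distr M borel (\<sigma> t) = M"
    and A: "A \<in> sets borel" "\<And>t. \<sigma> t ` A = A"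
  shows "distr (uniform_measure M A) borel (\<sigma> t) = uniform_measure M A"
proof -
  interpret prob_space M by fact
  have meas: "\<sigma> t \<in> measurable borel borel"
    by (rule borel_measurable_continuous_onI[OF flow_continuous(1)[OF flow]])
  have measM: "\<sigma> t \<in> measurable M borel"
    using meas by (simp add: measurable_cong_sets[OF M(2) refl])
  have space: "space M = UNIV" using sets_eq_imp_space_eq[OF M(2)] by simp
  have A': "\<sigma> t -` A = A" using flow_image_eq_vimage[OF flow, of "- t" A] A(2)[of "- t"] by simp
  show ?thesis
  proof (rule measure_eqI)
    show "sets (distr (uniform_measure M A) borel (\<sigma> t)) = sets (uniform_measure M A)" using M by simp
    fix B assume "B \<in> sets (distr (uniform_measure M A) borel (\<sigma> t))"
    then have B: "B \<in> sets borel" by simp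
    have vB: "\<sigma> t -` B \<in> sets borel" using measurable_sets[OF meas B] by simp
    have "emeasure M (A \<inter> \<sigma> t -` B) = emeasure M (\<sigma> t -` (A \<inter> B) \<inter> space M)"
      using A' space by (intro arg_cong[where f = "emeasure M"]) auto
    also have "\<dots> = emeasure (distr M borel (\<sigma> t)) (A \<inter> B)"
      using measM A B by (intro emeasure_distr[symmetric]) auto
    also have "\<dots> = emeasure M (A \<inter> B)" by (simp only: inv)
    finally have eq: "emeasure M (A \<inter> \<sigma> t -` B) = emeasure M (A \<inter> B)" .
    have "emeasure (distr (uniform_measure M A) borel (\<sigma> t)) B = emeasure (uniform_measure M A) (\<sigma> t -` B)"
      using measM B by (subst emeasure_distr) (auto simp: space measurable_cong_sets[OF sets_uniform_measure refl])
    also have "\<dots> = emeasure M (A \<inter> \<sigma> t -` B) / emeasure M A"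
      using A vB M by (intro emeasure_uniform_measure) auto
    also have "\<dots> = emeasure M (A \<inter> B) / emeasure M A" by (simp only: eq)
    also have "\<dots> = emeasure (uniform_measure M A) B"
      using A B M by (intro emeasure_uniform_measure[symmetric]) auto
    finally show "emeasure (distr (uniform_measure M A) borel (\<sigma> t)) B = emeasure (uniform_measure M A) B" .
  qed
qed

lemma integral_uniform_measure:
  fixes g :: "'w::metric_space \<Rightarrow> real"
  assumes M: "prob_space M" "sets M = sets borel" and A: "A \<in> sets borel" "measure M A \<noteq> 0"
    and g: "g \<in> borel_measurable borel"
  shows "measure M A * integral\<^sup>L (uniform_measure M A) g = integral\<^sup>L M (\<lambda>x. indicator A x * g x)"
proof -
  interpret prob_space M by fact
  have gM: "g \<in> borel_measurable M" using g by (simp add: measurable_cong_sets[OF M(2) refl])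
  have AM: "A \<in> sets M" using A M by simp
  have "uniform_measure M A = density M (\<lambda>x. ennreal (indicator A x / measure M A))"
    unfolding uniform_measure_def
    using A by (intro arg_cong[where f = "density M"] ext)
      (auto simp: indicator_def emeasure_eq_measure divide_ennreal zero_less_measure_iff simp flip: ennreal_1)
  then have "integral\<^sup>L (uniform_measure M A) g = integral\<^sup>L M (\<lambda>x. (indicator A x / measure M A) * g x)"
    using gM AM by (simp add: integral_density)
  also have "\<dots> = integral\<^sup>L M (\<lambda>x. (indicator A x * g x) / measure M A)" by simp
  also have "\<dots> = integral\<^sup>L M (\<lambda>x. indicator A x * g x) / measure M A" by (rule integral_divide_zero)
  finally show ?thesis using A by simp
qed

text \<open>An extreme invariant functional is represented by an ergodic measure.  For an invariant set \<open>A\<close> of measure \<open>p\<close>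
strictly between 0 and 1, the two measures conditioned on \<open>A\<close> and on its complement are invariant, and their convex combination with weights
\<open>p\<close> and \<open>1 - p\<close> is the measure itself; by extremality, conditioning on \<open>A\<close> does not change it, which is
absurd.\<close>

theorem exists_ergodic_measure_below_average:
  fixes \<sigma> :: "real \<Rightarrow> 'w::metric_space \<Rightarrow> 'w" and g\<^sub>0 :: "'w \<Rightarrow> real"
  assumes comp: "compact (UNIV :: 'w set)" and flow: "continuous_flow \<sigma>" and g\<^sub>0: "continuous_on UNIV g\<^sub>0"
    and avg: "\<And>n :: nat. \<exists>\<omega>. primitive (\<lambda>t. g\<^sub>0 (\<sigma> t \<omega>)) (real n) \<le> 1"
  shows "\<exists>M\<in>ergodic_measures \<sigma>. integral\<^sup>L M g\<^sub>0 \<le> 0"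
proof -
  let ?P = "invariant_states \<sigma>"
  obtain \<Phi>\<^sub>0 where \<Phi>\<^sub>0: "\<Phi>\<^sub>0 \<in> ?P" "\<Phi>\<^sub>0 g\<^sub>0 \<le> 0"
    using invariant_state_below_average[OF assms] by blast
  then have "?P \<noteq> {}" by blast
  from exists_extreme_state[OF compact_invariant_states[OF comp] closed_invariant_states this, of g\<^sub>0]
  obtain \<Phi> where \<Phi>: "\<Phi> \<in> ?P" and least: "\<forall>\<Psi>\<in>?P. \<Phi> g\<^sub>0 \<le> \<Psi> g\<^sub>0"
    and extreme: "\<forall>\<Psi>\<in>?P. \<forall>\<Psi>'\<in>?P. \<forall>c. 0 < c \<longrightarrow> c < 1 \<longrightarrow> (\<forall>g. \<Phi> g = c * \<Psi> g + (1 - c) * \<Psi>' g) \<longrightarrow> \<Psi> = \<Phi>"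
    by (elim bexE conjE)
  have pf: "positive_functional \<Phi>" and zero: "\<And>g. \<not> continuous_on UNIV g \<Longrightarrow> \<Phi> g = 0"
    and inv: "\<And>g t. continuous_on UNIV g \<Longrightarrow> \<Phi> (\<lambda>x. g (\<sigma> t x)) = \<Phi> g"
  proof -
    note * = CollectD[OF \<Phi>[unfolded invariant_states_def]]
    show "positive_functional \<Phi>" by (rule conjunct1[OF *])
    show "\<Phi> g = 0" if "\<not> continuous_on UNIV g" for g
      using conjunct1[OF conjunct2[OF *]] that by (elim allE impE)
    show "\<Phi> (\<lambda>x. g (\<sigma> t x)) = \<Phi> g" if "continuous_on UNIV g" for g t
      using conjunct2[OF conjunct2[OF *], rule_format, OF that] .
  qed
  obtain M where M: "prob_space M" "sets M = sets borel"
    and rep: "\<And>g. continuous_on UNIV g \<Longrightarrow> integral\<^sup>L M g = \<Phi> g"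
    using positive_functional.riesz_representation[OF pf] by blast
  interpret prob_space M by fact
  have meas: "\<sigma> t \<in> measurable M borel" for t
    using borel_measurable_continuous_onI[OF flow_continuous(1)[OF flow, of t]]
    by (simp add: measurable_cong_sets[OF M(2) refl])
  have space: "space M = UNIV" using sets_eq_imp_space_eq[OF M(2)] by simp
  have distr: "distr M borel (\<sigma> t) = M" for t
  proof (rule prob_measure_eqI_continuous)
    show "prob_space (distr M borel (\<sigma> t))" by (rule prob_space_distr[OF meas])
    fix g :: "'w \<Rightarrow> real" assume g: "continuous_on UNIV g"
    have gs: "continuous_on UNIV (\<lambda>x. g (\<sigma> t x))"
      by (rule continuous_on_compose2[OF g flow_continuous(1)[OF flow]]) simp
    have "integral\<^sup>L (distr M borel (\<sigma> t)) g = integral\<^sup>L M (\<lambda>x. g (\<sigma> t x))"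
      using meas borel_measurable_continuous_onI[OF g] by (rule integral_distr)
    also have "\<dots> = \<Phi> (\<lambda>x. g (\<sigma> t x))" by (rule rep[OF gs])
    also have "\<dots> = integral\<^sup>L M g" unfolding inv[OF g] rep[OF g] ..
    finally show "integral\<^sup>L (distr M borel (\<sigma> t)) g = integral\<^sup>L M g" .
  qed (use M in simp_all)
  have "measure M (\<sigma> t ` A) = measure M A" if A: "A \<in> sets borel" for t A
  proof -
    have "measure (distr M borel (\<sigma> (- t))) A = measure M (\<sigma> (- t) -` A \<inter> space M)"
      using meas A by (rule measure_distr)
    then show ?thesis unfolding distr by (simp add: flow_image_eq_vimage[OF flow] space)
  qed
  moreover have "measure M A = 0 \<or> measure M A = 1" if A: "A \<in> sets borel" "\<And>t. \<sigma> t ` A = A" for A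
  proof (rule ccontr)
    assume "\<not> (measure M A = 0 \<or> measure M A = 1)"
    then have p: "0 < measure M A" "measure M A < 1"
      using prob_le_1[of A] measure_nonneg[of M A] by linarith+
    have A': "- A \<in> sets borel" "\<sigma> t ` (- A) = - A" for t
    proof -
      show "- A \<in> sets borel" using A(1) by auto
      show "\<sigma> t ` (- A) = - A"
        using A(2)[of t] unfolding flow_image_eq_vimage[OF flow] by (simp add: vimage_Compl)
    qed
    have pc: "measure M (- A) = 1 - measure M A"
      using prob_compl[of A] A(1) M(2) by (simp add: space Compl_eq_Diff_UNIV)
    let ?N = "uniform_measure M A" and ?N' = "uniform_measure M (- A)"
    have N: "prob_space ?N" "sets ?N = sets borel" "prob_space ?N'" "sets ?N' = sets borel"
      using p pc M(2) by (simp_all add: prob_space_uniform_measure emeasure_eq_measure)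
    have state_N: "state_of ?N = \<Phi>"
    proof (rule extreme[rule_format])
      show "state_of ?N \<in> ?P"
        by (rule state_of_invariant[OF comp flow N(1,2)]) (rule uniform_measure_invariant[OF M flow distr A])
      show "state_of ?N' \<in> ?P"
        by (rule state_of_invariant[OF comp flow N(3,4)]) (rule uniform_measure_invariant[OF M flow distr A'])
      show "0 < measure M A" "measure M A < 1" by (rule p)+
      fix g :: "'w \<Rightarrow> real"
      show "\<Phi> g = measure M A * state_of ?N g + (1 - measure M A) * state_of ?N' g"
      proof (cases "continuous_on UNIV g")
        case False then show ?thesis by (simp add: state_of_def zero)
      next
        case True
        have gm: "g \<in> borel_measurable borel" by (rule borel_measurable_continuous_onI[OF True])
        note gi = continuous_integrable[OF comp M True]
        have split: "indicator A x * g x + indicator (- A) x * g x = g x" for x by (simp add: indicator_def)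
        have i: "integrable M (\<lambda>x. indicator B x * g x)" if "B \<in> sets borel" for B
          using integrable_mult_indicator[of B M g] gi that M(2) by simp
        have "measure M A * integral\<^sup>L ?N g + measure M (- A) * integral\<^sup>L ?N' g
            = integral\<^sup>L M (\<lambda>x. indicator A x * g x) + integral\<^sup>L M (\<lambda>x. indicator (- A) x * g x)"
          using integral_uniform_measure[OF M A(1) _ gm] integral_uniform_measure[OF M A'(1) _ gm] p pc by simp
        also have "\<dots> = integral\<^sup>L M (\<lambda>x. indicator A x * g x + indicator (- A) x * g x)"
          by (rule Bochner_Integration.integral_add[symmetric]) (rule i[OF A(1)], rule i[OF A'(1)])
        also have "\<dots> = integral\<^sup>L M g" unfolding split ..
        finally show ?thesis using True rep[OF True] by (simp add: state_of_def pc)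
      qed
    qed
    have "integral\<^sup>L ?N g = integral\<^sup>L M g" if "continuous_on UNIV g" for g :: "'w \<Rightarrow> real"
      using fun_cong[OF state_N, of g] rep[OF that] that by (simp add: state_of_def)
    then have "?N = M" by (rule prob_measure_eqI_continuous[OF N(1) M(1) N(2) M(2)])
    moreover have "emeasure ?N A = 1"
      using p by (intro emeasure_uniform_measure_1) (simp_all add: emeasure_eq_measure)
    ultimately have "emeasure M A = 1" by simp
    then show False using p(2) by (simp add: emeasure_eq_measure)
  qed
  ultimately have "M \<in> ergodic_measures \<sigma>" unfolding ergodic_measures_def using M by simp
  moreover have "integral\<^sup>L M g\<^sub>0 \<le> 0"
    unfolding rep[OF g\<^sub>0] using bspec[OF least \<Phi>\<^sub>0(1)] \<Phi>\<^sub>0(2) by (rule order.trans)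
  ultimately show ?thesis by blast
qed

section \<open>Lipschitz equations on the line\<close>

text \<open>A comparison with the primitive \<open>c exp (k \<bar>s\<bar>)\<close> of the bound, in both directions of time.\<close>

lemma exp_growth_bound:
  fixes D :: "real \<Rightarrow> real"
  assumes D: "\<And>s. (D has_real_derivative D' s) (at s)" and D0: "D 0 = 0"
    and D': "\<And>s. \<bar>D' s\<bar> \<le> c * k * exp (k * \<bar>s\<bar>)" and c: "0 \<le> c"
  shows "\<bar>D t\<bar> \<le> c * exp (k * \<bar>t\<bar>)"
proof -
  have *: "E t \<le> c * exp (k * t)"
    if E: "\<And>s. (E has_real_derivative E' s) (at s)" "E 0 = 0" "\<And>s. \<bar>E' s\<bar> \<le> c * k * exp (k * \<bar>s\<bar>)" "0 \<le> t"
    for E E' :: "real \<Rightarrow> real" and t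
  proof -
    have "c * exp (k * 0) - E 0 \<le> c * exp (k * t) - E t"
    proof (rule DERIV_nonneg_imp_nondecreasing[OF that(4)])
      fix s assume s: "0 \<le> s" "s \<le> t"
      have "((\<lambda>s. c * exp (k * s) - E s) has_real_derivative c * (exp (k * s) * k) - E' s) (at s)"
        by (auto intro!: derivative_eq_intros E(1))
      moreover have "0 \<le> c * (exp (k * s) * k) - E' s" using E(3)[of s] s by (simp add: abs_le_iff ac_simps)
      ultimately show "\<exists>y. ((\<lambda>s. c * exp (k * s) - E s) has_real_derivative y) (at s) \<and> 0 \<le> y" by blast
    qed
    then show ?thesis using E(2) c by simp
  qed
  have refl: "((\<lambda>s. D (- s)) has_real_derivative - D' (- s)) (at s)" for s
    using D[of "- s"] unfolding DERIV_mirror .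
  have neg: "((\<lambda>s. - D s) has_real_derivative - D' s) (at s)" for s
    by (rule DERIV_minus[OF D])
  have reflneg: "((\<lambda>s. - D (- s)) has_real_derivative D' (- s)) (at s)" for s
    using DERIV_minus[OF refl, of s] by simp
  show ?thesis
  proof (cases "0 \<le> t")
    case True
    then show ?thesis using *[OF D D0 D' True] *[OF neg _ _ True] D0 D' by (simp add: abs_le_iff)
  next
    case False
    then have "0 \<le> - t" by simp
    have "\<bar>- D' (- s)\<bar> \<le> c * k * exp (k * \<bar>s\<bar>)" for s using D'[of "- s"] by simp
    then show ?thesis
      using *[OF refl _ _ \<open>0 \<le> - t\<close>] *[OF reflneg _ _ \<open>0 \<le> - t\<close>] D0 False by (simp add: abs_le_iff)
  qed
qed

text \<open>The Picard operator is a contraction on all of the line at once for the supremum norm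
with weight \<open>exp (- k \<bar>t\<bar>)\<close>, if \<open>k\<close> is at least twice the Lipschitz constant.  The unknown of the fixed point problem is the weighted
function \<open>z = y / w\<close>, which is bounded because \<open>y\<close> grows at most linearly.\<close>

lemma global_solution_exists:
  fixes G :: "real \<Rightarrow> real \<Rightarrow> real"
  assumes cont: "continuous_on UNIV (\<lambda>(t, x). G t x)"
    and bound: "\<And>t x. \<bar>G t x\<bar> \<le> N" and lip: "\<And>t x y. \<bar>G t x - G t y\<bar> \<le> L * \<bar>x - y\<bar>"
  shows "\<exists>y. y 0 = x\<^sub>0 \<and> (\<forall>t. (y has_real_derivative G t (y t)) (at t))"
proof -
  define k where "k = 2 * max L 1"
  have k: "0 < k" "2 * L \<le> k" by (auto simp: k_def)
  define w where "w t = exp (k * \<bar>t\<bar>)" for t :: real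
  have w: "0 < w t" "1 \<le> w t" for t using k by (auto simp: w_def)
  have wc: "continuous_on UNIV w" unfolding w_def by (intro continuous_intros)
  have Gc: "continuous_on UNIV (\<lambda>s. G s (h s))" if "continuous_on UNIV h" for h
    using continuous_on_compose2[OF cont continuous_on_Pair[OF continuous_on_id that]] by simp
  define g where "g z s = G s (w s * apply_bcontfun z s)" for z :: "real \<Rightarrow>\<^sub>C real" and s
  have gc: "continuous_on UNIV (g z)" for z
    unfolding g_def by (intro Gc continuous_intros wc) (rule continuous_on_apply_bcontfun)
  define p where "p z t = (x\<^sub>0 + primitive (g z) t) / w t" for z t
  have N: "0 \<le> N" using bound[of 0 0] by simp
  have pb: "p z \<in> bcontfun" for z
  proof (rule bcontfun_normI)
    have "continuous_on UNIV (primitive (g z))"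
      using DERIV_isCont[OF primitive_deriv[OF gc]] by (intro continuous_at_imp_continuous_on ballI)
    moreover have "\<forall>t\<in>UNIV. w t \<noteq> 0" using w(1) by (metis less_irrefl)
    ultimately show "continuous_on UNIV (p z)" unfolding p_def
      by (intro continuous_on_divide continuous_on_add continuous_on_const wc)
    fix t
    have "\<bar>primitive (g z) t - primitive (g z) 0\<bar> \<le> N * \<bar>t - 0\<bar>"
      by (rule primitive_bound[OF gc]) (simp add: g_def bound)
    then have "\<bar>x\<^sub>0 + primitive (g z) t\<bar> \<le> \<bar>x\<^sub>0\<bar> + N * \<bar>t\<bar>" by simp
    moreover have "N * \<bar>t\<bar> \<le> (N / k) * w t"
    proof -
      have "k * \<bar>t\<bar> \<le> w t" unfolding w_def using exp_ge_add_one_self[of "k * \<bar>t\<bar>"] by linarith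
      then have "(N / k) * (k * \<bar>t\<bar>) \<le> (N / k) * w t" using N k by (intro mult_left_mono) auto
      then show ?thesis using k by simp
    qed
    moreover have "\<bar>x\<^sub>0\<bar> \<le> \<bar>x\<^sub>0\<bar> * w t" using w(2)[of t] by (simp add: mult_le_cancel_left1)
    ultimately have "\<bar>x\<^sub>0 + primitive (g z) t\<bar> \<le> (\<bar>x\<^sub>0\<bar> + N / k) * w t" by (simp add: distrib_right)
    then show "norm (p z t) \<le> \<bar>x\<^sub>0\<bar> + N / k" using w(1)[of t] by (simp add: p_def abs_divide divide_le_eq)
  qed
  define T where "T z = Bcontfun (p z)" for z
  have T: "apply_bcontfun (T z) = p z" for z unfolding T_def by (rule Bcontfun_inverse[OF pb])
  have contr: "dist (T y) (T z) \<le> 1 / 2 * dist y z" for y z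
  proof (rule dist_bound)
    fix t
    have "\<bar>primitive (g y) t - primitive (g z) t\<bar> \<le> (dist y z / 2) * exp (k * \<bar>t\<bar>)"
    proof (rule exp_growth_bound)
      show "((\<lambda>t. primitive (g y) t - primitive (g z) t) has_real_derivative g y s - g z s) (at s)" for s
        by (intro DERIV_diff primitive_deriv gc)
      fix s
      have "\<bar>g y s - g z s\<bar> \<le> L * \<bar>w s * y s - w s * z s\<bar>" unfolding g_def by (rule lip)
      also have "\<dots> \<le> (k / 2) * \<bar>w s * y s - w s * z s\<bar>" using k by (intro mult_right_mono) auto
      also have "\<dots> = (k / 2) * (w s * dist (y s) (z s))"
        using w(1)[of s] by (simp add: dist_real_def abs_mult flip: right_diff_distrib)
      also have "\<dots> \<le> (k / 2) * (w s * dist y z)"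
        using k w(1)[of s] by (intro mult_left_mono dist_bounded) auto
      finally show "\<bar>g y s - g z s\<bar> \<le> dist y z / 2 * k * exp (k * \<bar>s\<bar>)" by (simp add: w_def ac_simps)
    qed simp_all
    then have "\<bar>primitive (g y) t - primitive (g z) t\<bar> \<le> (1 / 2 * dist y z) * w t" by (simp add: w_def)
    moreover have "dist (T y t) (T z t) = \<bar>primitive (g y) t - primitive (g z) t\<bar> / w t"
      using w(1)[of t] by (simp add: T p_def dist_real_def abs_divide flip: diff_divide_distrib)
    ultimately show "dist (T y t) (T z t) \<le> 1 / 2 * dist y z" using w(1)[of t] by (simp add: divide_le_eq)
  qed
  have "\<exists>!z. T z = z" by (rule banach_fix_type[of "1/2"]) (use contr in auto)
  then obtain z where z: "T z = z" by blast
  define y where "y t = w t * apply_bcontfun z t" for t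
  have y: "y t = x\<^sub>0 + primitive (g z) t" for t
    using w(1)[of t] fun_cong[OF T[of z], of t] by (simp add: y_def z p_def)
  have "(y has_real_derivative G t (y t)) (at t)" for t
  proof -
    have "((\<lambda>t. x\<^sub>0 + primitive (g z) t) has_real_derivative g z t) (at t)"
      by (rule derivative_eq_intros primitive_deriv gc refl | simp)+
    moreover have "g z t = G t (y t)" by (simp add: g_def y_def)
    moreover have "(\<lambda>t. x\<^sub>0 + primitive (g z) t) = y" using y by auto
    ultimately show ?thesis by simp
  qed
  moreover have "y 0 = x\<^sub>0" by (simp add: y)
  ultimately show ?thesis by blast
qed

text \<open>The square of the difference, times \<open>exp (- 2 L s)\<close>, does not increase; times \<open>exp (2 L s)\<close>, it does not decrease.  This
gives uniqueness forward and backward in time.\<close>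

lemma lipschitz_solutions_agree:
  fixes x y :: "real \<Rightarrow> real"
  assumes I: "is_interval I" "t\<^sub>0 \<in> I" "t \<in> I"
    and x: "\<And>s. s \<in> I \<Longrightarrow> (x has_real_derivative X s) (at s)"
    and y: "\<And>s. s \<in> I \<Longrightarrow> (y has_real_derivative Y s) (at s)"
    and lip: "\<And>s. s \<in> I \<Longrightarrow> \<bar>X s - Y s\<bar> \<le> L * \<bar>x s - y s\<bar>"
    and eq: "x t\<^sub>0 = y t\<^sub>0"
  shows "x t = y t"
proof -
  have zz: "((x s - y s) * (X s - Y s)) \<le> L * (x s - y s)\<^sup>2" "- L * (x s - y s)\<^sup>2 \<le> (x s - y s) * (X s - Y s)"
    if "s \<in> I" for s
  proof -
    have "\<bar>(x s - y s) * (X s - Y s)\<bar> \<le> \<bar>x s - y s\<bar> * (L * \<bar>x s - y s\<bar>)"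
      unfolding abs_mult using lip[OF that] by (intro mult_left_mono) auto
    also have "\<dots> = L * (x s - y s)\<^sup>2" by (simp add: power2_eq_square)
    finally show "((x s - y s) * (X s - Y s)) \<le> L * (x s - y s)\<^sup>2" "- L * (x s - y s)\<^sup>2 \<le> (x s - y s) * (X s - Y s)"
      by (auto simp: abs_le_iff)
  qed
  have D: "((\<lambda>s. (x s - y s)\<^sup>2 * exp (c * s)) has_real_derivative
      (2 * ((x s - y s) * (X s - Y s)) + c * (x s - y s)\<^sup>2) * exp (c * s)) (at s)" if "s \<in> I" for s c
    by (rule derivative_eq_intros x[OF that] y[OF that] refl | simp add: algebra_simps)+
  have "(x t - y t)\<^sup>2 \<le> 0"
  proof (cases "t\<^sub>0 \<le> t")
    case True
    have "(x t - y t)\<^sup>2 * exp (- 2 * L * t) \<le> (x t\<^sub>0 - y t\<^sub>0)\<^sup>2 * exp (- 2 * L * t\<^sub>0)"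
    proof (rule DERIV_nonpos_imp_nonincreasing[OF True, where f = "\<lambda>s. (x s - y s)\<^sup>2 * exp (- 2 * L * s)"])
      fix s assume "t\<^sub>0 \<le> s" "s \<le> t"
      then have s: "s \<in> I" using I by (meson mem_is_interval_1_I)
      show "\<exists>d. ((\<lambda>s. (x s - y s)\<^sup>2 * exp (- 2 * L * s)) has_real_derivative d) (at s) \<and> d \<le> 0"
        using D[OF s, of "- 2 * L"] zz(1)[OF s] by (intro exI conjI) (assumption, intro mult_nonpos_nonneg, auto)
    qed
    then show ?thesis using eq by (simp add: mult_le_0_iff)
  next
    case False
    then have "t \<le> t\<^sub>0" by simp
    have "(x t - y t)\<^sup>2 * exp (2 * L * t) \<le> (x t\<^sub>0 - y t\<^sub>0)\<^sup>2 * exp (2 * L * t\<^sub>0)"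
    proof (rule DERIV_nonneg_imp_nondecreasing[OF \<open>t \<le> t\<^sub>0\<close>, where f = "\<lambda>s. (x s - y s)\<^sup>2 * exp (2 * L * s)"])
      fix s assume "t \<le> s" "s \<le> t\<^sub>0"
      then have s: "s \<in> I" using I by (meson mem_is_interval_1_I)
      show "\<exists>d. ((\<lambda>s. (x s - y s)\<^sup>2 * exp (2 * L * s)) has_real_derivative d) (at s) \<and> 0 \<le> d"
        using D[OF s, of "2 * L"] zz(2)[OF s] by (intro exI conjI) (assumption, intro mult_nonneg_nonneg, auto)
    qed
    then show ?thesis using eq by (simp add: mult_le_0_iff)
  qed
  then show ?thesis by simp
qed

section \<open>Trajectories of the skew product\<close>

locale skew_system =
  fixes \<sigma> :: "real \<Rightarrow> 'w::metric_space \<Rightarrow> 'w" and f :: "'w \<Rightarrow> real \<Rightarrow> real"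
  assumes compact_base: "compact (UNIV :: 'w set)" and flow: "continuous_flow \<sigma>" and C01: "C01 f"
begin

definition trajectory :: "'w \<Rightarrow> (real \<Rightarrow> real) \<Rightarrow> bool" where
  "trajectory \<omega> x \<longleftrightarrow> (\<forall>t. (x has_real_derivative f (\<sigma> t \<omega>) (x t)) (at t))"

lemma f_deriv: "(f \<omega> has_real_derivative partial_x f \<omega> x) (at x)"
  using C01 unfolding C01_def by (simp add: field_differentiable_derivI)

lemma f_continuous: "continuous_on UNIV (\<lambda>(\<omega>, x). f \<omega> x)"
  and f_x_continuous: "continuous_on UNIV (\<lambda>(\<omega>, x). partial_x f \<omega> x)"
  using C01 unfolding C01_def by blast+

lemma bounded_on_strip:
  assumes "continuous_on UNIV (\<lambda>(\<omega>, x). h \<omega> x)"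
  shows "\<exists>N. \<forall>\<omega> :: 'w. \<forall>x\<in>{a..b :: real}. \<bar>h \<omega> x :: real\<bar> \<le> N"
proof -
  have "compact ((\<lambda>(\<omega>, x). h \<omega> x) ` (UNIV \<times> {a..b}))"
    by (intro compact_continuous_image continuous_on_subset[OF assms] compact_Times compact_base) auto
  then have "bounded ((\<lambda>(\<omega>, x). h \<omega> x) ` (UNIV \<times> {a..b}))" by (rule compact_imp_bounded)
  then show ?thesis unfolding bounded_iff by auto
qed

lemma lipschitz_on_strip:
  "\<exists>L\<ge>0. \<forall>\<omega>. \<forall>x\<in>{a..b}. \<forall>y\<in>{a..b}. \<bar>f \<omega> x - f \<omega> y\<bar> \<le> L * \<bar>x - y\<bar>"
proof -
  obtain L where L: "\<And>\<omega> x. x \<in> {a..b} \<Longrightarrow> \<bar>partial_x f \<omega> x\<bar> \<le> L"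
    using bounded_on_strip[OF f_x_continuous] by blast
  have "\<bar>f \<omega> x - f \<omega> y\<bar> \<le> \<bar>L\<bar> * \<bar>x - y\<bar>" if "x \<in> {a..b}" "y \<in> {a..b}" for \<omega> x y
  proof -
    have "norm (f \<omega> x - f \<omega> y) \<le> \<bar>L\<bar> * norm (x - y)"
    proof (rule field_differentiable_bound[where S = "{a..b}" and f' = "partial_x f \<omega>"])
      show "(f \<omega> has_field_derivative partial_x f \<omega> z) (at z within {a..b})" for z
        using f_deriv by (rule has_field_derivative_at_within)
      show "norm (partial_x f \<omega> z) \<le> \<bar>L\<bar>" if "z \<in> {a..b}" for z
        using L[OF that, of \<omega>] by simp
    qed (use that in simp_all)
    then show ?thesis by simp
  qed
  then show ?thesis by (intro exI[of _ "\<bar>L\<bar>"]) simp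
qed

lemma solutions_agree:
  assumes I: "is_interval I" "t\<^sub>0 \<in> I" "t \<in> I"
    and x: "\<And>s. s \<in> I \<Longrightarrow> (x has_real_derivative f (\<sigma> s \<omega>) (x s)) (at s)"
    and y: "\<And>s. s \<in> I \<Longrightarrow> (y has_real_derivative f (\<sigma> s \<omega>) (y s)) (at s)"
    and eq: "x t\<^sub>0 = y t\<^sub>0"
  shows "x t = y t"
proof -
  define S where "S = {min t\<^sub>0 t..max t\<^sub>0 t}"
  have SI: "s \<in> I" if "s \<in> S" for s
  proof (cases "t\<^sub>0 \<le> t")
    case True
    then have "t\<^sub>0 \<le> s" "s \<le> t" using that by (auto simp: S_def)
    then show ?thesis by (rule mem_is_interval_1_I[OF I])
  next
    case False
    then have "t \<le> s" "s \<le> t\<^sub>0" using that by (auto simp: S_def)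
    then show ?thesis by (rule mem_is_interval_1_I[OF I(1,3,2)])
  qed
  have bdd: "\<exists>B. \<forall>s\<in>S. \<bar>z s\<bar> \<le> B" if "\<And>s. s \<in> I \<Longrightarrow> (z has_real_derivative z' s) (at s)" for z z' :: "real \<Rightarrow> real"
  proof -
    have "continuous_on S z" 
      by (intro continuous_at_imp_continuous_on ballI DERIV_isCont[OF that] SI)
    then have "compact (z ` S)" by (rule compact_continuous_image) (simp add: S_def)
    then have "bounded (z ` S)" by (rule compact_imp_bounded)
    then show ?thesis unfolding bounded_iff by simp
  qed
  obtain B where B: "\<And>s. s \<in> S \<Longrightarrow> \<bar>x s\<bar> \<le> B" using bdd[OF x] by blast
  obtain B' where B': "\<And>s. s \<in> S \<Longrightarrow> \<bar>y s\<bar> \<le> B'" using bdd[OF y] by blast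
  define R where "R = max B B'"
  obtain L where L: "\<And>\<omega> x y. x \<in> {-R..R} \<Longrightarrow> y \<in> {-R..R} \<Longrightarrow> \<bar>f \<omega> x - f \<omega> y\<bar> \<le> L * \<bar>x - y\<bar>"
    using lipschitz_on_strip[of "-R" R] by blast
  show ?thesis
  proof (rule lipschitz_solutions_agree[where x = x and y = y and t = t and I = S and t\<^sub>0 = t\<^sub>0 and L = L])
    show "is_interval S" "t\<^sub>0 \<in> S" "t \<in> S" by (auto simp: S_def is_interval_cc)
    fix s assume s: "s \<in> S"
    show "(x has_real_derivative f (\<sigma> s \<omega>) (x s)) (at s)" by (rule x[OF SI[OF s]])
    show "(y has_real_derivative f (\<sigma> s \<omega>) (y s)) (at s)" by (rule y[OF SI[OF s]])
    have "x s \<in> {-R..R}" "y s \<in> {-R..R}" using B[OF s] B'[OF s] unfolding R_def by auto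
    then show "\<bar>f (\<sigma> s \<omega>) (x s) - f (\<sigma> s \<omega>) (y s)\<bar> \<le> L * \<bar>x s - y s\<bar>" by (rule L)
  qed (rule eq)
qed

lemma sol_eqI:
  assumes "solution_on \<sigma> f \<omega> x\<^sub>0 I y" "t \<in> I"
  shows "sol \<sigma> f t \<omega> x\<^sub>0 = y t" "t \<in> sol_dom \<sigma> f \<omega> x\<^sub>0"
proof -
  show "t \<in> sol_dom \<sigma> f \<omega> x\<^sub>0" unfolding sol_dom_def using assms by blast
  have "y' t = y t" if s: "solution_on \<sigma> f \<omega> x\<^sub>0 I' y'" "t \<in> I'" for I' y'
  proof (rule solutions_agree[where x = y' and y = y and t = t and I = "I \<inter> I'" and t\<^sub>0 = 0 and \<omega> = \<omega>])
    show "is_interval (I \<inter> I')" using assms s unfolding solution_on_def by (intro is_interval_Int) auto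
  qed (use assms s in \<open>auto simp: solution_on_def\<close>)
  then show "sol \<sigma> f t \<omega> x\<^sub>0 = y t" unfolding sol_def using assms by (intro the_equality) blast+
qed

lemma trajectory_sol:
  assumes "trajectory \<omega> x"
  shows "sol \<sigma> f t \<omega> (x 0) = x t" "t \<in> sol_dom \<sigma> f \<omega> (x 0)"
proof -
  have "solution_on \<sigma> f \<omega> (x 0) UNIV x" using assms unfolding trajectory_def solution_on_def by simp
  from sol_eqI[OF this UNIV_I] show "sol \<sigma> f t \<omega> (x 0) = x t" "t \<in> sol_dom \<sigma> f \<omega> (x 0)" .
qed

lemma sol_trajectory:
  assumes "\<And>t. t \<in> sol_dom \<sigma> f \<omega> x\<^sub>0"
  shows "trajectory \<omega> (\<lambda>t. sol \<sigma> f t \<omega> x\<^sub>0)" "sol \<sigma> f 0 \<omega> x\<^sub>0 = x\<^sub>0"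
proof -
  have sol: "\<exists>I y. solution_on \<sigma> f \<omega> x\<^sub>0 I y \<and> t \<in> I" for t using assms[of t] unfolding sol_dom_def by blast
  show "sol \<sigma> f 0 \<omega> x\<^sub>0 = x\<^sub>0" using sol[of 0] sol_eqI(1) unfolding solution_on_def by metis
  show "trajectory \<omega> (\<lambda>t. sol \<sigma> f t \<omega> x\<^sub>0)"
    unfolding trajectory_def
  proof
    fix t
    obtain I y where y: "solution_on \<sigma> f \<omega> x\<^sub>0 I y" "t \<in> I" using sol by blast
    have "(y has_real_derivative f (\<sigma> t \<omega>) (y t)) (at t)" and "open I" using y unfolding solution_on_def by auto
    then show "((\<lambda>t. sol \<sigma> f t \<omega> x\<^sub>0) has_real_derivative f (\<sigma> t \<omega>) (sol \<sigma> f t \<omega> x\<^sub>0)) (at t)"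
      unfolding sol_eqI(1)[OF y]
      by (rule has_field_derivative_transform_within_open[OF _ _ y(2)]) (simp add: sol_eqI(1)[OF y(1)])
  qed
qed

lemma trajectory_unique:
  assumes "trajectory \<omega> x" "trajectory \<omega> y" "x s = y s"
  shows "x t = y t"
  by (rule solutions_agree[where x = x and y = y and t = t and I = UNIV and t\<^sub>0 = s and \<omega> = \<omega>])
    (use assms in \<open>auto simp: trajectory_def\<close>)

lemma trajectory_continuous: "trajectory \<omega> x \<Longrightarrow> continuous_on S x"
  unfolding trajectory_def by (intro continuous_at_imp_continuous_on ballI DERIV_isCont) blast

lemma trajectory_shift:
  assumes "trajectory \<omega> x"
  shows "trajectory (\<sigma> s \<omega>) (\<lambda>t. x (t + s))"
  unfolding trajectory_def
proof
  fix t
  have "(x has_real_derivative f (\<sigma> (t + s) \<omega>) (x (t + s))) (at (t + s))" using assms by (simp add: trajectory_def)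
  then show "((\<lambda>t. x (t + s)) has_real_derivative f (\<sigma> t (\<sigma> s \<omega>)) (x (t + s))) (at t)"
    by (simp add: DERIV_shift flow_simps[OF flow])
qed

text \<open>By the intermediate value theorem, continuous functions that never meet keep their order.\<close>

lemma continuous_order:
  fixes x y :: "real \<Rightarrow> real"
  assumes "continuous_on UNIV x" "continuous_on UNIV y" "\<And>t. x t \<noteq> y t" "x s < y s"
  shows "x t < y t"
proof (rule ccontr)
  assume "\<not> x t < y t"
  then have "0 \<le> x t - y t" by simp
  have c: "continuous_on S (\<lambda>t. x t - y t)" for S
    by (intro continuous_intros continuous_on_subset[OF assms(1)] continuous_on_subset[OF assms(2)]) auto
  have "\<exists>u. x u - y u = 0"
  proof (cases "s \<le> t")
    case True
    then show ?thesis using IVT'[of "\<lambda>t. x t - y t" s 0 t] c assms(4) \<open>0 \<le> x t - y t\<close> by auto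
  next
    case False
    then show ?thesis using IVT2'[of "\<lambda>t. x t - y t" s 0 t] c assms(4) \<open>0 \<le> x t - y t\<close> by auto
  qed
  then show False using assms(3) by auto
qed

lemma trajectory_order:
  assumes "trajectory \<omega> x" "trajectory \<omega> y" "x s < y s"
  shows "x t < y t"
proof (rule continuous_order[where x = x and y = y and s = s])
  show "continuous_on UNIV x" "continuous_on UNIV y" by (rule trajectory_continuous[OF assms(1)], rule trajectory_continuous[OF assms(2)])
  show "x u \<noteq> y u" for u using trajectory_unique[OF assms(1,2), where s = u and t = s] assms(3) by auto
qed (rule assms(3))

lemma invariant_trajectory:
  assumes "skew_invariant \<sigma> f K" "(\<omega>, x\<^sub>0) \<in> K"
  obtains x where "trajectory \<omega> x" "x 0 = x\<^sub>0" "\<And>t. (\<sigma> t \<omega>, x t) \<in> K"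
proof -
  have "t \<in> sol_dom \<sigma> f \<omega> x\<^sub>0 \<and> (\<sigma> t \<omega>, sol \<sigma> f t \<omega> x\<^sub>0) \<in> K" for t
    using assms unfolding skew_invariant_def skewproduct_def by auto
  then show thesis using sol_trajectory[of \<omega> x\<^sub>0] that by blast
qed

text \<open>Solutions of the equation whose right-hand side is frozen outside the strip \<open>[a, b]\<close>.  These are
global, and as long as they stay in the strip they solve the original equation; this is how solutions
that start near an invariant set are shown to exist for all relevant times.\<close>

definition clamped :: "real \<Rightarrow> real \<Rightarrow> 'w \<Rightarrow> (real \<Rightarrow> real) \<Rightarrow> bool" where
  "clamped a b \<omega> x \<longleftrightarrow> (\<forall>t. (x has_real_derivative f (\<sigma> t \<omega>) (max a (min b (x t)))) (at t))"

lemma clamped_exists: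
  assumes "a \<le> b"
  shows "\<exists>y. y 0 = x\<^sub>0 \<and> clamped a b \<omega> y"
  unfolding clamped_def
proof -
  have in_ab: "max a (min b x) \<in> {a..b}" for x using assms by auto
  obtain N where N: "\<And>\<omega> x. x \<in> {a..b} \<Longrightarrow> \<bar>f \<omega> x\<bar> \<le> N" using bounded_on_strip[OF f_continuous] by blast
  obtain L where L: "0 \<le> L" "\<And>\<omega> x y. x \<in> {a..b} \<Longrightarrow> y \<in> {a..b} \<Longrightarrow> \<bar>f \<omega> x - f \<omega> y\<bar> \<le> L * \<bar>x - y\<bar>"
    using lipschitz_on_strip[of a b] by blast
  show "\<exists>y. y 0 = x\<^sub>0 \<and> (\<forall>t. (y has_real_derivative f (\<sigma> t \<omega>) (max a (min b (y t)))) (at t))"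
  proof (rule global_solution_exists[where G = "\<lambda>t x. f (\<sigma> t \<omega>) (max a (min b x))"])
    have "continuous_on UNIV (\<lambda>p :: real \<times> real. (\<sigma> (fst p) \<omega>, max a (min b (snd p))))"
      by (intro continuous_on_Pair continuous_on_compose2[OF flow_continuous(2)[OF flow]] continuous_intros) auto
    from continuous_on_compose2[OF f_continuous this]
    show "continuous_on UNIV (\<lambda>(t, x). f (\<sigma> t \<omega>) (max a (min b x)))" by (simp add: case_prod_beta)
    show "\<bar>f (\<sigma> t \<omega>) (max a (min b x))\<bar> \<le> N" for t x by (rule N[OF in_ab])
    fix t x y
    have "\<bar>f (\<sigma> t \<omega>) (max a (min b x)) - f (\<sigma> t \<omega>) (max a (min b y))\<bar> \<le> L * \<bar>max a (min b x) - max a (min b y)\<bar>"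
      by (rule L(2)[OF in_ab in_ab])
    also have "\<dots> \<le> L * \<bar>x - y\<bar>" using L(1) by (intro mult_left_mono) auto
    finally show "\<bar>f (\<sigma> t \<omega>) (max a (min b x)) - f (\<sigma> t \<omega>) (max a (min b y))\<bar> \<le> L * \<bar>x - y\<bar>" .
  qed
qed

lemma clamped_unique:
  assumes "a \<le> b" "clamped a b \<omega> x" "clamped a b \<omega> y" "x s = y s"
  shows "x t = y t"
proof -
  have in_ab: "max a (min b x) \<in> {a..b}" for x using assms(1) by auto
  obtain L where L: "0 \<le> L" "\<And>\<omega> x y. x \<in> {a..b} \<Longrightarrow> y \<in> {a..b} \<Longrightarrow> \<bar>f \<omega> x - f \<omega> y\<bar> \<le> L * \<bar>x - y\<bar>"
    using lipschitz_on_strip[of a b] by blast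
  show ?thesis
  proof (rule lipschitz_solutions_agree[where x = x and y = y and t = t and I = UNIV and t\<^sub>0 = s and L = L])
    fix u
    show "(x has_real_derivative f (\<sigma> u \<omega>) (max a (min b (x u)))) (at u)"
      "(y has_real_derivative f (\<sigma> u \<omega>) (max a (min b (y u)))) (at u)"
      using assms by (auto simp: clamped_def)
    have "\<bar>f (\<sigma> u \<omega>) (max a (min b (x u))) - f (\<sigma> u \<omega>) (max a (min b (y u)))\<bar>
        \<le> L * \<bar>max a (min b (x u)) - max a (min b (y u))\<bar>"
      by (rule L(2)[OF in_ab in_ab])
    also have "\<dots> \<le> L * \<bar>x u - y u\<bar>" using L(1) by (intro mult_left_mono) auto
    finally show "\<bar>f (\<sigma> u \<omega>) (max a (min b (x u))) - f (\<sigma> u \<omega>) (max a (min b (y u)))\<bar> \<le> L * \<bar>x u - y u\<bar>" .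
  qed (use assms in auto)
qed

lemma clamped_order:
  assumes "a \<le> b" "clamped a b \<omega> x" "clamped a b \<omega> y" "x s < y s"
  shows "x t < y t"
proof (rule continuous_order[where x = x and y = y and s = s])
  show "continuous_on UNIV x" "continuous_on UNIV y"
    using assms(2,3) unfolding clamped_def by (intro continuous_at_imp_continuous_on ballI DERIV_isCont; blast)+
  show "x u \<noteq> y u" for u using clamped_unique[OF assms(1-3), where s = u and t = s] assms(4) by auto
qed (rule assms(4))

lemma trajectory_clamped:
  assumes "trajectory \<omega> x" "\<And>t. x t \<in> {a..b}"
  shows "clamped a b \<omega> x"
  unfolding clamped_def
proof
  fix t
  have "max a (min b (x t)) = x t" using assms(2)[of t] by auto
  then show "(x has_real_derivative f (\<sigma> t \<omega>) (max a (min b (x t)))) (at t)"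
    using assms(1) by (simp add: trajectory_def)
qed

text \<open>The interval of definition is the connected component, containing 0, of the open set of times at which \<open>y\<close> is inside the strip.\<close>

lemma clamped_sol:
  assumes "clamped a b \<omega> y" and "\<And>s. s \<in> {min 0 t..max 0 t} \<Longrightarrow> a < y s \<and> y s < b"
  shows "sol \<sigma> f t \<omega> (y 0) = y t \<and> t \<in> sol_dom \<sigma> f \<omega> (y 0)"
proof -
  have c: "continuous_on UNIV y"
    using assms(1) unfolding clamped_def by (intro continuous_at_imp_continuous_on ballI DERIV_isCont) blast
  define U where "U = {s. a < y s} \<inter> {s. y s < b}"
  have U: "open U" unfolding U_def
    by (intro open_Int open_Collect_less c continuous_on_const)
  define I where "I = connected_component_set U 0"
  have zero: "0 \<in> U" unfolding U_def using assms(2)[of 0] by simp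
  have "t \<in> I"
    unfolding I_def mem_Collect_eq connected_component_def
    by (intro exI[of _ "{min 0 t..max 0 t}"]) (use assms(2) in \<open>auto simp: U_def\<close>)
  moreover have "solution_on \<sigma> f \<omega> (y 0) I y"
    unfolding solution_on_def
  proof (intro conjI ballI)
    show "open I" unfolding I_def by (rule open_connected_component[OF U])
    show "is_interval I" unfolding I_def by (simp add: is_interval_connected_1)
    show "0 \<in> I" unfolding I_def using zero by (simp add: connected_component_refl)
    fix s assume "s \<in> I"
    then have "s \<in> U" unfolding I_def using connected_component_subset by blast
    then have "max a (min b (y s)) = y s" by (auto simp: U_def)
    then show "(y has_real_derivative f (\<sigma> s \<omega>) (y s)) (at s)" using assms(1) unfolding clamped_def by metis
  qed simp
  ultimately show ?thesis using sol_eqI by blast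
qed

end

section \<open>Cross ratio and curvature\<close>

lemma cross_ratio_deriv:
  fixes x\<^sub>1 x\<^sub>2 x\<^sub>3 x\<^sub>4 \<phi> :: "real \<Rightarrow> real"
  assumes d: "(x\<^sub>1 has_real_derivative \<phi> (x\<^sub>1 t)) (at t)" "(x\<^sub>2 has_real_derivative \<phi> (x\<^sub>2 t)) (at t)"
    "(x\<^sub>3 has_real_derivative \<phi> (x\<^sub>3 t)) (at t)" "(x\<^sub>4 has_real_derivative \<phi> (x\<^sub>4 t)) (at t)"
    and dist: "distinct [x\<^sub>1 t, x\<^sub>2 t, x\<^sub>3 t, x\<^sub>4 t]"
  shows "((\<lambda>t. (x\<^sub>2 t - x\<^sub>1 t) * (x\<^sub>4 t - x\<^sub>3 t) / ((x\<^sub>3 t - x\<^sub>1 t) * (x\<^sub>4 t - x\<^sub>2 t))) has_real_derivative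
    (x\<^sub>3 t - x\<^sub>2 t) * (x\<^sub>4 t - x\<^sub>1 t) * divdiff3 \<phi> (x\<^sub>1 t) (x\<^sub>2 t) (x\<^sub>3 t) (x\<^sub>4 t) *
    ((x\<^sub>2 t - x\<^sub>1 t) * (x\<^sub>4 t - x\<^sub>3 t) / ((x\<^sub>3 t - x\<^sub>1 t) * (x\<^sub>4 t - x\<^sub>2 t)))) (at t)"
proof -
  have log: "((\<lambda>t. P t * Q t / (R t * S t)) has_real_derivative
      (P' / P t + Q' / Q t - R' / R t - S' / S t) * (P t * Q t / (R t * S t))) (at t)"
    if "(P has_real_derivative P') (at t)" "(Q has_real_derivative Q') (at t)"
      "(R has_real_derivative R') (at t)" "(S has_real_derivative S') (at t)"
      and nz: "P t \<noteq> 0" "Q t \<noteq> 0" "R t \<noteq> 0" "S t \<noteq> 0" for P Q R S :: "real \<Rightarrow> real" and P' Q' R' S'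
  proof -
    have "((\<lambda>t. P t * Q t / (R t * S t)) has_real_derivative
      ((P' * Q t + Q' * P t) * (R t * S t) - P t * Q t * (R' * S t + S' * R t)) / ((R t * S t) * (R t * S t))) (at t)"
      by (rule DERIV_divide[OF DERIV_mult[OF that(1,2)] DERIV_mult[OF that(3,4)]]) (use nz in simp)
    moreover have "((P' * Q t + Q' * P t) * (R t * S t) - P t * Q t * (R' * S t + S' * R t)) / ((R t * S t) * (R t * S t))
        = (P' / P t + Q' / Q t - R' / R t - S' / S t) * (P t * Q t / (R t * S t))"
      using nz by (simp add: divide_simps) (simp add: algebra_simps)
    ultimately show ?thesis by simp
  qed
  show ?thesis
    unfolding divdiff3_slopes[OF dist, symmetric]
    by (rule log) (use dist in \<open>auto intro!: DERIV_diff d\<close>)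
qed

text \<open>Uniform continuity of \<open>h\<close> on the compact product makes the infima of nearby functions close.\<close>

lemma continuous_INF_compact:
  fixes h :: "'w::metric_space \<Rightarrow> 'a::metric_space \<Rightarrow> real"
  assumes comp: "compact (UNIV :: 'w set)" and S: "compact S" "S \<noteq> {}"
    and h: "continuous_on (UNIV \<times> S) (\<lambda>(\<omega>, x). h \<omega> x)"
  shows "continuous_on UNIV (\<lambda>\<omega>. INF x\<in>S. h \<omega> x)" "bdd_below (h \<omega> ` S)"
proof -
  have K: "compact ((UNIV :: 'w set) \<times> S)" by (rule compact_Times[OF comp S(1)])
  have bdd: "bdd_below (h \<omega> ` S)" for \<omega>
  proof -
    have "continuous_on S (\<lambda>x. (\<lambda>(\<omega>, x). h \<omega> x) (\<omega>, x))"
      by (rule continuous_on_compose2[OF h]) (auto intro!: continuous_intros)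
    then have "compact (h \<omega> ` S)" using S(1) by (intro compact_continuous_image) auto
    then show ?thesis by (intro bounded_imp_bdd_below compact_imp_bounded)
  qed
  then show "bdd_below (h \<omega> ` S)" .
  have unif: "uniformly_continuous_on (UNIV \<times> S) (\<lambda>(\<omega>, x). h \<omega> x)"
    by (rule compact_uniformly_continuous[OF h K])
  show "continuous_on UNIV (\<lambda>\<omega>. INF x\<in>S. h \<omega> x)"
    unfolding continuous_on_iff
  proof (intro ballI allI impI)
    fix \<omega> :: 'w and e :: real assume e: "0 < e"
    then have "0 < e / 2" by simp
    from unif[unfolded uniformly_continuous_on_def, rule_format, OF this] obtain \<delta> where \<delta>: "0 < \<delta>"
      and close: "\<And>p q. p \<in> UNIV \<times> S \<Longrightarrow> q \<in> UNIV \<times> S \<Longrightarrow> dist q p < \<delta> \<Longrightarrow>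
        dist ((\<lambda>(\<omega>, x). h \<omega> x) q) ((\<lambda>(\<omega>, x). h \<omega> x) p) < e / 2"
      by blast
    have le: "(INF x\<in>S. h \<omega>\<^sub>1 x) \<le> (INF x\<in>S. h \<omega>\<^sub>2 x) + e / 2" if d: "dist \<omega>\<^sub>1 \<omega>\<^sub>2 < \<delta>" for \<omega>\<^sub>1 \<omega>\<^sub>2
    proof -
      have "(INF x\<in>S. h \<omega>\<^sub>1 x) - e / 2 \<le> (INF x\<in>S. h \<omega>\<^sub>2 x)"
      proof (rule cINF_greatest[OF S(2)])
        fix x assume x: "x \<in> S"
        have "(INF x\<in>S. h \<omega>\<^sub>1 x) \<le> h \<omega>\<^sub>1 x" by (rule cINF_lower[OF bdd x])
        moreover have "dist (h \<omega>\<^sub>1 x) (h \<omega>\<^sub>2 x) < e / 2"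
          using close[of "(\<omega>\<^sub>2, x)" "(\<omega>\<^sub>1, x)"] x d by (simp add: dist_Pair_Pair)
        ultimately show "(INF x\<in>S. h \<omega>\<^sub>1 x) - e / 2 \<le> h \<omega>\<^sub>2 x"
          unfolding dist_real_def by linarith
      qed
      then show ?thesis by simp
    qed
    show "\<exists>d>0. \<forall>\<omega>'\<in>UNIV. dist \<omega>' \<omega> < d \<longrightarrow> dist (INF x\<in>S. h \<omega>' x) (INF x\<in>S. h \<omega> x) < e"
    proof (intro exI[of _ \<delta>] conjI ballI impI \<delta>)
      fix \<omega>' assume d: "dist \<omega>' \<omega> < \<delta>"
      have "(INF x\<in>S. h \<omega>' x) \<le> (INF x\<in>S. h \<omega> x) + e / 2" by (rule le[OF d])
      moreover have "(INF x\<in>S. h \<omega> x) \<le> (INF x\<in>S. h \<omega>' x) + e / 2" by (rule le) (use d in \<open>simp add: dist_commute\<close>)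
      ultimately show "dist (INF x\<in>S. h \<omega>' x) (INF x\<in>S. h \<omega> x) < e" using e by (simp add: dist_real_def abs_less_iff)
    qed
  qed
qed

context skew_system
begin

lemma ergodic_measure_nonneg_null:
  fixes g :: "'w \<Rightarrow> real"
  assumes M: "M \<in> ergodic_measures \<sigma>" and g: "continuous_on UNIV g" "\<And>\<omega>. 0 \<le> g \<omega>" and "integral\<^sup>L M g \<le> 0"
  shows "measure M {\<omega>. 0 < g \<omega>} = 0"
proof -
  have M': "prob_space M" "sets M = sets borel" using M by (auto simp: ergodic_measures_def)
  interpret prob_space M by (rule M')
  have int: "integrable M g" by (rule continuous_integrable[OF compact_base M' g(1)])
  have "integral\<^sup>L M g = 0" using assms(4) g(2) by (intro antisym integral_nonneg) auto
  then have "AE \<omega> in M. g \<omega> = 0"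
    using integral_nonneg_eq_0_iff_AE[OF int] g(2) by simp
  then have ae: "AE \<omega> in M. \<not> 0 < g \<omega>" by eventually_elim simp
  have "{\<omega>. 0 < g \<omega>} \<in> sets M"
    using open_Collect_less[OF continuous_on_const g(1), of 0] M'(2) by simp
  then have "emeasure M {\<omega>. 0 < g \<omega>} = 0"
    using ae sets_eq_imp_space_eq[OF M'(2)] AE_iff_measurable[of "{\<omega>. 0 < g \<omega>}" M "\<lambda>\<omega>. \<not> 0 < g \<omega>"] by simp
  then show ?thesis by (simp add: measure_def)
qed

text \<open>If for every \<open>n\<close> the integral of \<open>g\<close> over \<open>[0, n]\<close> along some orbit were at most 1, there
would be an ergodic measure for which \<open>g\<close> vanishes almost everywhere.  So every time window of some fixed length \<open>n\<close>
contributes more than 1, and the rate is \<open>1 / n\<close>; the loss of 1 is due to an incomplete window.\<close>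

lemma average_growth:
  fixes g :: "'w \<Rightarrow> real"
  assumes g: "continuous_on UNIV g" "\<And>\<omega>. 0 \<le> g \<omega>"
    and pos: "\<And>M. M \<in> ergodic_measures \<sigma> \<Longrightarrow> 0 < measure M {\<omega>. 0 < g \<omega>}"
  shows "\<exists>\<gamma>>0. \<forall>\<omega> s t. s \<le> t \<longrightarrow>
    \<gamma> * (t - s) - 1 \<le> primitive (\<lambda>u. g (\<sigma> u \<omega>)) t - primitive (\<lambda>u. g (\<sigma> u \<omega>)) s"
proof -
  have gc: "continuous_on UNIV (\<lambda>u. g (\<sigma> u \<omega>))" for \<omega>
    by (rule continuous_on_compose2[OF g(1) flow_continuous(2)[OF flow]]) simp
  define G where "G \<omega> = primitive (\<lambda>u. g (\<sigma> u \<omega>))" for \<omega>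
  have "\<exists>n :: nat. \<forall>\<omega>. 1 < G \<omega> (real n)"
  proof (rule ccontr)
    assume "\<not> ?thesis"
    then have "\<And>n :: nat. \<exists>\<omega>. primitive (\<lambda>t. g (\<sigma> t \<omega>)) (real n) \<le> 1" unfolding G_def by (meson not_le)
    from exists_ergodic_measure_below_average[OF compact_base flow g(1) this]
    obtain M where M: "M \<in> ergodic_measures \<sigma>" "integral\<^sup>L M g \<le> 0" by blast
    have "measure M {\<omega>. 0 < g \<omega>} = 0" by (rule ergodic_measure_nonneg_null[OF M(1) g M(2)])
    then show False using pos[OF M(1)] by simp
  qed
  then obtain n :: nat where n: "\<And>\<omega>. 1 < G \<omega> (real n)" by blast
  have n0: "0 < real n" using n by (cases "n = 0") (auto simp: G_def)
  have mono: "G \<omega> s \<le> G \<omega> t" if "s \<le> t" for \<omega> s t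
    using primitive_mono[OF continuous_on_const[of UNIV 0] gc _ that, of \<omega>] g(2) by (simp add: G_def primitive_const)
  have step: "G \<omega> s + 1 \<le> G \<omega> (s + real n)" for \<omega> s
  proof -
    have "G (\<sigma> s \<omega>) (real n) = G \<omega> (real n + s) - G \<omega> s"
      using primitive_shift[OF gc[of \<omega>], of s "real n"] unfolding G_def by (simp add: flow_simps[OF flow])
    then show ?thesis using n[of "\<sigma> s \<omega>"] by (simp add: add.commute)
  qed
  have steps: "G \<omega> s + real k \<le> G \<omega> (s + real k * real n)" for \<omega> s k
  proof (induction k)
    case (Suc k)
    then show ?case using step[of \<omega> "s + real k * real n"] by (simp add: algebra_simps)
  qed simp
  have "1 / real n * (t - s) - 1 \<le> G \<omega> t - G \<omega> s" if "s \<le> t" for \<omega> s t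
  proof -
    define k where "k = nat \<lfloor>(t - s) / real n\<rfloor>"
    have k: "real k \<le> (t - s) / real n" "(t - s) / real n < real k + 1"
      using that n0 unfolding k_def by (simp_all add: floor_less_iff flip: of_int_add) linarith?
    have "s + real k * real n \<le> t" using k(1) n0 by (simp add: field_simps)
    then have "G \<omega> (s + real k * real n) \<le> G \<omega> t" by (rule mono)
    then have "real k \<le> G \<omega> t - G \<omega> s" using steps[of \<omega> s k] by simp
    then show ?thesis using k(2) by simp
  qed
  then show ?thesis using n0 unfolding G_def by (intro exI[of _ "1 / real n"]) auto
qed

text \<open>The minimum in \<open>b_fun\<close> without its positive factor.\<close>

definition curvature :: "real \<Rightarrow> real \<Rightarrow> real \<Rightarrow> 'w \<Rightarrow> real" where
  "curvature a b \<epsilon> \<omega> = (INF x\<in>{a + \<epsilon> / 2..b - \<epsilon> / 2}.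
     2 * partial_x f \<omega> x - partial_x f \<omega> (x - \<epsilon> / 2) - partial_x f \<omega> (x + \<epsilon> / 2))"

lemma b_fun_pos_iff:
  assumes "0 < \<epsilon>" "\<epsilon> \<le> b - a"
  shows "0 < b_fun f {a..b} \<epsilon> \<omega> \<longleftrightarrow> 0 < curvature a b \<epsilon> \<omega>"
proof -
  have "shrink {a..b} \<epsilon> = {a + \<epsilon> / 2..b - \<epsilon> / 2}" using assms by (auto simp: shrink_def)
  moreover have "interval_length {a..b} = b - a" using assms by (simp add: interval_length_def)
  ultimately have "b_fun f {a..b} \<epsilon> \<omega> = \<epsilon> / (4 * (b - a)\<^sup>2) * curvature a b \<epsilon> \<omega>"
    by (simp add: b_fun_def curvature_def)
  moreover have "0 < \<epsilon> / (4 * (b - a)\<^sup>2)" using assms by simp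
  ultimately show ?thesis by (simp only: zero_less_mult_iff) auto
qed

lemma curvature_props:
  assumes "DC f" "0 < \<epsilon>" "\<epsilon> \<le> b - a"
  shows "continuous_on UNIV (curvature a b \<epsilon>)" "0 \<le> curvature a b \<epsilon> \<omega>"
    and "a + \<epsilon> / 2 \<le> x \<Longrightarrow> x \<le> b - \<epsilon> / 2 \<Longrightarrow>
      curvature a b \<epsilon> \<omega> \<le> 2 * partial_x f \<omega> x - partial_x f \<omega> (x - \<epsilon> / 2) - partial_x f \<omega> (x + \<epsilon> / 2)"
proof -
  let ?S = "{a + \<epsilon> / 2..b - \<epsilon> / 2}"
  let ?h = "\<lambda>\<omega> x. 2 * partial_x f \<omega> x - partial_x f \<omega> (x - \<epsilon> / 2) - partial_x f \<omega> (x + \<epsilon> / 2)"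
  have S: "compact ?S" "?S \<noteq> {}" using assms by auto
  have sh: "continuous_on (UNIV \<times> ?S) (\<lambda>p. partial_x f (fst p) (snd p + c))" for c
  proof -
    have "continuous_on (UNIV \<times> ?S) (\<lambda>p. (\<lambda>(\<omega>, x). partial_x f \<omega> x) (fst p, snd p + c))"
      by (rule continuous_on_compose2[OF f_x_continuous]) (auto intro!: continuous_intros)
    then show ?thesis by simp
  qed
  have hc: "continuous_on (UNIV \<times> ?S) (\<lambda>(\<omega>, x). ?h \<omega> x)"
    using continuous_on_diff[OF continuous_on_diff[OF continuous_on_mult_left[OF sh[of 0], of 2] sh[of "- (\<epsilon> / 2)"]] sh[of "\<epsilon> / 2"]]
    by (simp add: case_prod_beta)
  show "continuous_on UNIV (curvature a b \<epsilon>)"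
    unfolding curvature_def[abs_def] by (rule continuous_INF_compact(1)[OF compact_base S hc])
  show "0 \<le> curvature a b \<epsilon> \<omega>"
    unfolding curvature_def
  proof (rule cINF_greatest[OF S(2)])
    fix x
    have conc: "concave_on UNIV (partial_x f \<omega>)" using assms(1) by (simp add: DC_def)
    have "(1 - 1/2) * partial_x f \<omega> (x - \<epsilon> / 2) + 1/2 * partial_x f \<omega> (x + \<epsilon> / 2)
        \<le> partial_x f \<omega> ((1 - 1/2) *\<^sub>R (x - \<epsilon> / 2) + (1/2) *\<^sub>R (x + \<epsilon> / 2))"
      by (rule concave_onD[OF conc]) auto
    also have "(1 - 1/2) *\<^sub>R (x - \<epsilon> / 2) + (1/2) *\<^sub>R (x + \<epsilon> / 2) = x" by (simp add: field_simps)
    finally show "0 \<le> ?h \<omega> x" by simp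
  qed
  show "curvature a b \<epsilon> \<omega> \<le> ?h \<omega> x" if "a + \<epsilon> / 2 \<le> x" "x \<le> b - \<epsilon> / 2"
    unfolding curvature_def
    by (rule cINF_lower[OF continuous_INF_compact(2)[OF compact_base S hc]]) (use that in simp)
qed

text \<open>Only the part of the nodes that carries the second difference needs to lie in \<open>[A, B]\<close>.  This matters for
perturbed solutions, which may leave the interval.  With \<open>\<eta> = \<epsilon>\<close>, a gap of length \<open>2 \<epsilon>\<close> has room
for a second difference with step \<open>\<epsilon> / 2\<close>.\<close>

lemma divdiff3_le_curvature:
  assumes DC: "DC f" and \<epsilon>: "0 < \<epsilon>" "\<epsilon> \<le> B - A"
    and ord: "a < b" "b < c" "c < d" and D: "d - a \<le> D"
    and gap: "A \<le> a \<and> a + 2 * \<epsilon> \<le> b \<and> a + 2 * \<epsilon> \<le> B \<or> d \<le> B \<and> c + 2 * \<epsilon> \<le> d \<and> A + 2 * \<epsilon> \<le> d"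
  shows "divdiff3 (f \<omega>) a b c d \<le> - (\<epsilon> / D ^ 3 * curvature A B \<epsilon> \<omega>)"
proof -
  let ?k = "curvature A B \<epsilon> \<omega>"
  note cp = curvature_props[OF DC \<epsilon>]
  have conc: "concave_on UNIV (partial_x f \<omega>)" using DC by (simp add: DC_def)
  have bound: "\<epsilon> / D ^ 3 * ?k \<le> ?k * \<epsilon> / (u * v * w)"
    if "0 < u" "0 < v" "0 < w" "u \<le> D" "v \<le> D" "w \<le> D" for u v w
  proof -
    have "u * v * w \<le> D * D * D" using that by (intro mult_mono) auto
    then have "?k * \<epsilon> / (D * D * D) \<le> ?k * \<epsilon> / (u * v * w)"
      using that cp(2) \<epsilon> by (intro divide_left_mono mult_pos_pos mult_nonneg_nonneg) auto
    then show ?thesis by (simp add: power3_eq_cube ac_simps)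
  qed
  from gap show ?thesis
  proof
    assume g: "A \<le> a \<and> a + 2 * \<epsilon> \<le> b \<and> a + 2 * \<epsilon> \<le> B"
    have "divdiff3 (f \<omega>) a b c d \<le> - (?k * \<epsilon> / ((b - a) * (c - a) * (d - a)))"
      by (rule divdiff3_le_left[OF f_deriv conc ord, where x = "a + 3 * \<epsilon> / 2" and h = "\<epsilon> / 2"])
        (use g \<epsilon> cp(2) cp(3)[of "a + 3 * \<epsilon> / 2" \<omega>] in simp_all)
    moreover have "\<epsilon> / D ^ 3 * ?k \<le> ?k * \<epsilon> / ((b - a) * (c - a) * (d - a))"
      by (rule bound) (use ord D in auto)
    ultimately show ?thesis by linarith
  next
    assume g: "d \<le> B \<and> c + 2 * \<epsilon> \<le> d \<and> A + 2 * \<epsilon> \<le> d"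
    have "divdiff3 (f \<omega>) a b c d \<le> - (?k * \<epsilon> / ((d - c) * (d - b) * (d - a)))"
      by (rule divdiff3_le_right[OF f_deriv conc ord, where x = "d - 3 * \<epsilon> / 2" and h = "\<epsilon> / 2"])
        (use g \<epsilon> cp(2) cp(3)[of "d - 3 * \<epsilon> / 2" \<omega>] in simp_all)
    moreover have "\<epsilon> / D ^ 3 * ?k \<le> ?k * \<epsilon> / ((d - c) * (d - b) * (d - a))"
      by (rule bound) (use ord D in auto)
    ultimately show ?thesis by linarith
  qed
qed

end

section \<open>At most three disjoint invariant sets\<close>

context skew_system
begin

definition lower_equilibrium :: "('w \<times> real) set \<Rightarrow> 'w \<Rightarrow> real" where
  "lower_equilibrium K \<omega> = Inf {x. (\<omega>, x) \<in> K}"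

text \<open>The lower boundary is measurable since its sublevel sets are projections of compact
sets.  It follows trajectories since these preserve the order of points in a fiber, forward and backward.\<close>

lemma lower_equilibrium_props:
  assumes K: "compact_invariant_onto \<sigma> f K"
  shows "(\<omega>, lower_equilibrium K \<omega>) \<in> K" "(\<omega>, x) \<in> K \<Longrightarrow> lower_equilibrium K \<omega> \<le> x"
    and "lower_equilibrium K \<in> borel_measurable borel"
    and "trajectory \<omega> (\<lambda>t. lower_equilibrium K (\<sigma> t \<omega>))"
proof -
  have comp: "compact K" and inv: "skew_invariant \<sigma> f K" and onto: "fst ` K = UNIV"
    using K by (auto simp: compact_invariant_onto_def)
  have fiber: "compact {x. (\<omega>, x) \<in> K}" for \<omega>
  proof -
    have "{x. (\<omega>, x) \<in> K} = snd ` (K \<inter> {\<omega>} \<times> UNIV)" by force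
    moreover have "compact (snd ` (K \<inter> {\<omega>} \<times> UNIV))"
      by (intro compact_continuous_image continuous_on_snd continuous_on_id compact_Int_closed comp closed_Times) auto
    ultimately show ?thesis by simp
  qed
  have ne: "{x. (\<omega>, x) \<in> K} \<noteq> {}" for \<omega>
  proof -
    obtain p where "p \<in> K" "fst p = \<omega>" using onto by (metis UNIV_I imageE)
    then have "snd p \<in> {x. (\<omega>, x) \<in> K}" by auto
    then show ?thesis by blast
  qed
  have bdd: "bdd_below {x. (\<omega>, x) \<in> K}" for \<omega>
    using fiber by (intro bounded_imp_bdd_below compact_imp_bounded)
  have mem: "(\<omega>, lower_equilibrium K \<omega>) \<in> K" for \<omega>
    using closed_contains_Inf[OF ne bdd compact_imp_closed[OF fiber]] by (simp add: lower_equilibrium_def)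
  have le: "lower_equilibrium K \<omega> \<le> x" if "(\<omega>, x) \<in> K" for \<omega> x
    unfolding lower_equilibrium_def by (rule cInf_lower[OF _ bdd]) (use that in simp)
  show "(\<omega>, lower_equilibrium K \<omega>) \<in> K" by (rule mem)
  show "(\<omega>, x) \<in> K \<Longrightarrow> lower_equilibrium K \<omega> \<le> x" by (rule le)
  show "lower_equilibrium K \<in> borel_measurable borel"
  proof (rule borel_measurableI_le)
    fix c
    have "{\<omega>. lower_equilibrium K \<omega> \<le> c} = fst ` (K \<inter> UNIV \<times> {..c})"
    proof (intro equalityI subsetI)
      fix \<omega> assume "\<omega> \<in> {\<omega>. lower_equilibrium K \<omega> \<le> c}"
      then have "(\<omega>, lower_equilibrium K \<omega>) \<in> K \<inter> UNIV \<times> {..c}" using mem by auto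
      then show "\<omega> \<in> fst ` (K \<inter> UNIV \<times> {..c})" by (metis fst_conv imageI)
    next
      fix \<omega> assume "\<omega> \<in> fst ` (K \<inter> UNIV \<times> {..c})"
      then obtain x where "(\<omega>, x) \<in> K" "x \<le> c" by auto
      then show "\<omega> \<in> {\<omega>. lower_equilibrium K \<omega> \<le> c}" using le[of \<omega> x] by simp
    qed
    moreover have "compact (fst ` (K \<inter> UNIV \<times> {..c}))"
      by (intro compact_continuous_image continuous_on_fst continuous_on_id compact_Int_closed comp closed_Times) auto
    ultimately have "closed {\<omega>. lower_equilibrium K \<omega> \<le> c}" by (simp add: compact_imp_closed)
    then show "{\<omega> \<in> space borel. lower_equilibrium K \<omega> \<le> c} \<in> sets borel" by simp
  qed
  obtain x where x: "trajectory \<omega> x" "x 0 = lower_equilibrium K \<omega>" "\<And>t. (\<sigma> t \<omega>, x t) \<in> K"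
    by (rule invariant_trajectory[OF inv mem]) blast
  have "lower_equilibrium K (\<sigma> t \<omega>) = x t" for t
  proof (rule ccontr)
    let ?l = "lower_equilibrium K (\<sigma> t \<omega>)"
    assume "?l \<noteq> x t"
    then have lt: "?l < x t" using le[OF x(3)] by (simp add: less_le)
    obtain y where y: "trajectory (\<sigma> t \<omega>) y" "y 0 = ?l" "\<And>s. (\<sigma> s (\<sigma> t \<omega>), y s) \<in> K"
      by (rule invariant_trajectory[OF inv mem]) blast
    have "y (- t) < x (- t + t)"
      by (rule trajectory_order[OF y(1) trajectory_shift[OF x(1), of t], of 0]) (use lt y(2) in simp)
    moreover have "(\<omega>, y (- t)) \<in> K" using y(3)[of "- t"] by (simp add: flow_simps[OF flow])
    ultimately show False using le[of \<omega> "y (- t)"] x(2) by simp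
  qed
  then have "(\<lambda>t. lower_equilibrium K (\<sigma> t \<omega>)) = x" by (rule ext)
  then show "trajectory \<omega> (\<lambda>t. lower_equilibrium K (\<sigma> t \<omega>))" using x(1) by simp
qed

text \<open>On the invariant set \<open>E\<close> where the four functions have the prescribed order, the cross ratio \<open>X\<close>
takes values in \<open>[0, 1]\<close> and decreases along orbits, strictly at points of positive curvature.
Since \<open>X\<close> and \<open>X \<circ> \<sigma>\<^sub>1\<close> have the same integral, they agree almost everywhere.\<close>

lemma four_equilibria_null:
  assumes DC: "DC f" and \<epsilon>: "0 < \<epsilon>" "\<epsilon> \<le> B - A" and M: "M \<in> ergodic_measures \<sigma>"
    and tr: "\<And>\<omega>. trajectory \<omega> (\<lambda>t. a (\<sigma> t \<omega>))" "\<And>\<omega>. trajectory \<omega> (\<lambda>t. b (\<sigma> t \<omega>))"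
      "\<And>\<omega>. trajectory \<omega> (\<lambda>t. c (\<sigma> t \<omega>))" "\<And>\<omega>. trajectory \<omega> (\<lambda>t. d (\<sigma> t \<omega>))"
    and meas: "a \<in> borel_measurable borel" "b \<in> borel_measurable borel"
      "c \<in> borel_measurable borel" "d \<in> borel_measurable borel"
    and range: "\<And>\<omega>. A \<le> a \<omega>" "\<And>\<omega>. b \<omega> \<le> B"
    and gap: "\<And>\<omega>. a \<omega> < b \<omega> \<Longrightarrow> a \<omega> + 2 * \<epsilon> \<le> b \<omega>"
  shows "AE \<omega> in M. a \<omega> < b \<omega> \<and> b \<omega> < c \<omega> \<and> c \<omega> < d \<omega> \<longrightarrow> \<not> 0 < curvature A B \<epsilon> \<omega>"
proof -
  have M': "prob_space M" "sets M = sets borel" using M by (auto simp: ergodic_measures_def)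
  interpret prob_space M by (rule M')
  have space: "space M = UNIV" using sets_eq_imp_space_eq[OF M'(2)] by simp
  note f0 = flow_simps(1)[OF flow]
  define E where "E = {\<omega>. a \<omega> < b \<omega> \<and> b \<omega> < c \<omega> \<and> c \<omega> < d \<omega>}"
  define X where "X \<omega> = (if \<omega> \<in> E then (b \<omega> - a \<omega>) * (d \<omega> - c \<omega>) / ((c \<omega> - a \<omega>) * (d \<omega> - b \<omega>)) else 0)" for \<omega>
  have E_sets: "E \<in> sets borel" unfolding E_def using meas by measurable
  have X_meas: "X \<in> borel_measurable borel"
    unfolding X_def using E_sets meas by (intro measurable_If_set borel_measurable_divide borel_measurable_times borel_measurable_diff) simp_all
  have X_M: "X \<in> borel_measurable M" using X_meas by (simp add: measurable_cong_sets[OF M'(2) refl])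
  have s_meas: "\<sigma> 1 \<in> measurable M borel"
    using borel_measurable_continuous_onI[OF flow_continuous(1)[OF flow, of 1]]
    by (simp add: measurable_cong_sets[OF M'(2) refl])
  have s_MM: "\<sigma> 1 \<in> measurable M M" using s_meas by (simp add: measurable_cong_sets[OF refl M'(2)])
  have distr: "distr M M (\<sigma> 1) = M"
  proof (rule measure_eqI)
    fix S assume "S \<in> sets (distr M M (\<sigma> 1))"
    then have S: "S \<in> sets borel" using M'(2) by simp
    have "emeasure (distr M M (\<sigma> 1)) S = emeasure M (\<sigma> 1 -` S \<inter> space M)"
      by (rule emeasure_distr[OF s_MM]) (use S M'(2) in simp)
    also have "\<dots> = emeasure M (\<sigma> (- 1) ` S)" by (simp add: flow_image_eq_vimage[OF flow] space)
    also have "\<dots> = emeasure M S"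
      using M S unfolding ergodic_measures_def by (simp add: emeasure_eq_measure)
    finally show "emeasure (distr M M (\<sigma> 1)) S = emeasure M S" .
  qed simp
  have E_inv: "\<sigma> t \<omega> \<in> E \<longleftrightarrow> \<omega> \<in> E" for t \<omega>
  proof -
    have *: "u (\<sigma> t \<omega>) < v (\<sigma> t \<omega>) \<longleftrightarrow> u \<omega> < v \<omega>"
      if "trajectory \<omega> (\<lambda>t. u (\<sigma> t \<omega>))" "trajectory \<omega> (\<lambda>t. v (\<sigma> t \<omega>))" for u v
      using trajectory_order[OF that, of 0 t] trajectory_order[OF that, of t 0] by (auto simp: f0)
    show ?thesis unfolding E_def using *[OF tr(1,2)] *[OF tr(2,3)] *[OF tr(3,4)] by simp
  qed
  have X01: "0 \<le> X \<omega>" "X \<omega> \<le> 1" for \<omega>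
  proof -
    show "0 \<le> X \<omega>" unfolding X_def E_def by auto
    have "(b \<omega> - a \<omega>) * (d \<omega> - c \<omega>) \<le> (c \<omega> - a \<omega>) * (d \<omega> - b \<omega>)" if "\<omega> \<in> E"
      using that unfolding E_def by (intro mult_mono) auto
    then show "X \<omega> \<le> 1" unfolding X_def by (auto simp: E_def divide_le_eq_1 mult_less_0_iff not_less)
  qed
  have drop: "X (\<sigma> 1 \<omega>) \<le> X \<omega> \<and> (\<omega> \<in> E \<longrightarrow> 0 < curvature A B \<epsilon> \<omega> \<longrightarrow> X (\<sigma> 1 \<omega>) < X \<omega>)" for \<omega>
  proof (cases "\<omega> \<in> E")
    case False
    then show ?thesis using E_inv[of 1 \<omega>] by (simp add: X_def)
  next
    case True
    then have inE: "\<sigma> t \<omega> \<in> E" for t using E_inv by simp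
    then have ord: "a (\<sigma> t \<omega>) < b (\<sigma> t \<omega>)" "b (\<sigma> t \<omega>) < c (\<sigma> t \<omega>)" "c (\<sigma> t \<omega>) < d (\<sigma> t \<omega>)" for t
      by (auto simp: E_def)
    let ?dd = "\<lambda>t. divdiff3 (f (\<sigma> t \<omega>)) (a (\<sigma> t \<omega>)) (b (\<sigma> t \<omega>)) (c (\<sigma> t \<omega>)) (d (\<sigma> t \<omega>))"
    let ?R = "\<lambda>t. (c (\<sigma> t \<omega>) - b (\<sigma> t \<omega>)) * (d (\<sigma> t \<omega>) - a (\<sigma> t \<omega>)) * ?dd t * X (\<sigma> t \<omega>)"
    have X_eq: "X (\<sigma> t \<omega>) = (b (\<sigma> t \<omega>) - a (\<sigma> t \<omega>)) * (d (\<sigma> t \<omega>) - c (\<sigma> t \<omega>)) /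
        ((c (\<sigma> t \<omega>) - a (\<sigma> t \<omega>)) * (d (\<sigma> t \<omega>) - b (\<sigma> t \<omega>)))" for t
      using inE by (simp add: X_def)
    have deriv: "((\<lambda>t. X (\<sigma> t \<omega>)) has_real_derivative ?R t) (at t)" for t
      unfolding X_eq
      by (rule cross_ratio_deriv) (use tr[of \<omega>] ord[of t] in \<open>auto simp: trajectory_def\<close>)
    have Xpos: "0 < X (\<sigma> t \<omega>)" for t
      unfolding X_eq using ord[of t] by (intro divide_pos_pos mult_pos_pos) auto
    have pre: "0 < (c (\<sigma> t \<omega>) - b (\<sigma> t \<omega>)) * (d (\<sigma> t \<omega>) - a (\<sigma> t \<omega>))" for t
      using ord[of t] by (intro mult_pos_pos) auto
    have dd: "?dd t \<le> - (\<epsilon> / (d (\<sigma> t \<omega>) - a (\<sigma> t \<omega>)) ^ 3 * curvature A B \<epsilon> (\<sigma> t \<omega>))" for t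
      by (rule divdiff3_le_curvature[OF DC \<epsilon> ord order_refl])
        (use range[of "\<sigma> t \<omega>"] gap[OF ord(1)[of t]] in linarith)
    have coef: "0 < \<epsilon> / (d (\<sigma> t \<omega>) - a (\<sigma> t \<omega>)) ^ 3" for t
      using \<epsilon> ord[of t] by (intro divide_pos_pos zero_less_power) auto
    have dd0: "?dd t \<le> 0" for t
      using dd[of t] coef[of t] curvature_props(2)[OF DC \<epsilon>, of "\<sigma> t \<omega>"]
      by (meson mult_nonneg_nonneg less_imp_le neg_le_0_iff_le order.trans)
    have R0: "?R t \<le> 0" for t
      using pre[of t] Xpos[of t] dd0[of t] by (intro mult_nonpos_nonneg mult_nonneg_nonpos) auto
    have mono: "X (\<sigma> t \<omega>) \<le> X (\<sigma> s \<omega>)" if "s \<le> t" for s t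
      by (rule DERIV_nonpos_imp_nonincreasing[OF that, where f = "\<lambda>t. X (\<sigma> t \<omega>)"]) (use deriv R0 in blast)
    have "X (\<sigma> 1 \<omega>) < X \<omega>" if pos: "0 < curvature A B \<epsilon> \<omega>"
    proof -
      have "?dd 0 < 0"
        using dd[of 0] mult_pos_pos[OF coef[of 0] pos] by (simp add: f0)
      then have "?R 0 < 0" using pre[of 0] Xpos[of 0] by (intro mult_neg_pos mult_pos_neg)
      from DERIV_neg_dec_right[OF deriv[of 0] this]
      obtain h where h: "0 < h" "\<And>k. 0 < k \<Longrightarrow> k < h \<Longrightarrow> X (\<sigma> (0 + k) \<omega>) < X (\<sigma> 0 \<omega>)" by blast
      define k where "k = min (h / 2) 1"
      have k: "0 < k" "k < h" "k \<le> 1" using h(1) by (auto simp: k_def)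
      show ?thesis using h(2)[OF k(1,2)] mono[OF k(3)] by (simp add: f0)
    qed
    then show ?thesis using mono[of 0 1] by (simp add: f0)
  qed
  have int: "integrable M X"
    by (rule integrable_const_bound[where B = 1, OF _ X_M]) (use X01 in auto)
  have int1: "integrable M (\<lambda>\<omega>. X (\<sigma> 1 \<omega>))"
    by (rule integrable_const_bound[where B = 1, OF _ measurable_compose[OF s_meas X_meas]]) (use X01 in auto)
  have "integral\<^sup>L (distr M M (\<sigma> 1)) X = integral\<^sup>L M (\<lambda>\<omega>. X (\<sigma> 1 \<omega>))"
    by (rule integral_distr[OF s_MM X_M])
  then have "integral\<^sup>L M (\<lambda>\<omega>. X \<omega> - X (\<sigma> 1 \<omega>)) = 0"
    using int int1 by (simp add: distr)
  then have "AE \<omega> in M. X \<omega> - X (\<sigma> 1 \<omega>) = 0"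
    using drop by (subst (asm) integral_nonneg_eq_0_iff_AE) (auto intro: int int1)
  then show ?thesis
  proof eventually_elim
    case (elim \<omega>)
    then have "\<not> X (\<sigma> 1 \<omega>) < X \<omega>" by simp
    then show ?case using drop[of \<omega>] unfolding E_def by blast
  qed
qed

lemma four_values_sorted:
  fixes x :: "nat \<Rightarrow> real"
  assumes "inj_on x {..<4}"
  shows "\<exists>p\<in>{..<4}. \<exists>q\<in>{..<4}. \<exists>r\<in>{..<4}. \<exists>s\<in>{..<4}. x p < x q \<and> x q < x r \<and> x r < x s"
proof -
  define l where "l = sort_key x [0, 1, 2, 3 :: nat]"
  have len: "length l = 4" by (simp add: l_def)
  have set: "set l = {..<4}" by (auto simp: l_def)
  have dist: "distinct l" by (simp add: l_def)
  have sorted: "sorted (map x l)" by (simp add: l_def)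
  have step: "x (l ! i) < x (l ! Suc i)" if "Suc i < 4" for i
  proof -
    have "x (l ! i) \<le> x (l ! Suc i)" using sorted_nth_mono[OF sorted, of i "Suc i"] that len by simp
    moreover have "l ! i \<noteq> l ! Suc i" using dist that len by (simp add: nth_eq_iff_index_eq)
    moreover have "l ! i \<in> {..<4}" "l ! Suc i \<in> {..<4}" using set that len nth_mem[of i l] nth_mem[of "Suc i" l] by auto
    ultimately show ?thesis using assms unfolding inj_on_def by (metis less_le)
  qed
  have mem: "l ! i \<in> {..<4}" if "i < 4" for i using set that len nth_mem[of i l] by auto
  show ?thesis
    using mem[of 0] mem[of 1] mem[of 2] mem[of 3] step[of 0] step[of 1] step[of 2]
    by (simp add: numeral_2_eq_2 numeral_3_eq_3) blast
qed

text \<open>The sets need not be ordered, and the order of their lower boundaries may depend on the base point; but every point belongs to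
the set \<open>E\<close> of one of finitely many orders.\<close>

lemma four_sets_null:
  fixes L :: "nat \<Rightarrow> ('w \<times> real) set"
  assumes DC: "DC f" and \<epsilon>: "0 < \<epsilon>" "\<epsilon> \<le> B - A" and M: "M \<in> ergodic_measures \<sigma>"
    and L: "\<And>i. i < 4 \<Longrightarrow> compact_invariant_onto \<sigma> f (L i)"
    and range: "\<And>i \<omega> x. i < 4 \<Longrightarrow> (\<omega>, x) \<in> L i \<Longrightarrow> x \<in> {A..B}"
    and gap: "\<And>i j \<omega> x y. i < 4 \<Longrightarrow> j < 4 \<Longrightarrow> i \<noteq> j \<Longrightarrow> (\<omega>, x) \<in> L i \<Longrightarrow> (\<omega>, y) \<in> L j \<Longrightarrow> 2 * \<epsilon> \<le> \<bar>x - y\<bar>"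
  shows "AE \<omega> in M. \<not> 0 < curvature A B \<epsilon> \<omega>"
proof -
  let ?a = "\<lambda>i. lower_equilibrium (L i)"
  note le = lower_equilibrium_props[OF L]
  have null: "AE \<omega> in M. ?a p \<omega> < ?a q \<omega> \<and> ?a q \<omega> < ?a r \<omega> \<and> ?a r \<omega> < ?a s \<omega> \<longrightarrow> \<not> 0 < curvature A B \<epsilon> \<omega>"
    if i: "p < 4" "q < 4" "r < 4" "s < 4" for p q r s
  proof (rule four_equilibria_null[OF DC \<epsilon> M])
    fix \<omega>
    show "A \<le> ?a p \<omega>" "?a q \<omega> \<le> B" using range[OF i(1) le(1)[OF i(1)]] range[OF i(2) le(1)[OF i(2)]] by auto
    show "?a p \<omega> + 2 * \<epsilon> \<le> ?a q \<omega>" if lt: "?a p \<omega> < ?a q \<omega>"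
    proof -
      have "p \<noteq> q" using lt by auto
      then show ?thesis using gap[OF i(1,2) _ le(1)[OF i(1)] le(1)[OF i(2)], of \<omega>] lt by simp
    qed
  qed (intro le i)+
  have "AE \<omega> in M. \<forall>p\<in>{..<4}. \<forall>q\<in>{..<4}. \<forall>r\<in>{..<4}. \<forall>s\<in>{..<4}.
      ?a p \<omega> < ?a q \<omega> \<and> ?a q \<omega> < ?a r \<omega> \<and> ?a r \<omega> < ?a s \<omega> \<longrightarrow> \<not> 0 < curvature A B \<epsilon> \<omega>"
    by (intro AE_finite_allI finite_lessThan null) simp_all
  then show ?thesis
  proof eventually_elim
    case (elim \<omega>)
    have "inj_on (\<lambda>i. ?a i \<omega>) {..<4}"
    proof (rule inj_onI, rule ccontr)
      fix i j assume "i \<in> {..<4 :: nat}" "j \<in> {..<4}" "?a i \<omega> = ?a j \<omega>" "i \<noteq> j"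
      then show False using gap[OF _ _ _ le(1) le(1), of i j \<omega>] \<epsilon> by simp
    qed
    from four_values_sorted[OF this] elim show ?case by blast
  qed
qed

end

lemma compact_disjoint_gap:
  fixes K L :: "('w::metric_space \<times> real) set"
  assumes "compact K" "compact L" "K \<inter> L = {}"
  shows "\<exists>e>0. \<forall>\<omega> x y. (\<omega>, x) \<in> K \<longrightarrow> (\<omega>, y) \<in> L \<longrightarrow> e \<le> \<bar>x - y\<bar>"
proof -
  have e: "\<exists>e>0. \<forall>p\<in>K. \<forall>q\<in>L. e \<le> dist p q"
  proof (cases "K \<times> L = {}")
    case True
    then show ?thesis by (intro exI[of _ 1]) auto
  next
    case False
    have "continuous_on (K \<times> L) (\<lambda>z. dist (fst z) (snd z))" by (intro continuous_intros)
    from continuous_attains_inf[OF compact_Times[OF assms(1,2)] False this]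
    obtain z where z: "z \<in> K \<times> L" "\<And>u. u \<in> K \<times> L \<Longrightarrow> dist (fst z) (snd z) \<le> dist (fst u) (snd u)" by blast
    have "fst z \<noteq> snd z" using z(1) assms(3) by auto
    moreover have "dist (fst z) (snd z) \<le> dist p q" if "p \<in> K" "q \<in> L" for p q using z(2)[of "(p, q)"] that by simp
    ultimately show ?thesis by (intro exI[of _ "dist (fst z) (snd z)"]) simp
  qed
  then obtain e where e: "0 < e" "\<And>p q. p \<in> K \<Longrightarrow> q \<in> L \<Longrightarrow> e \<le> dist p q" by blast
  have "e \<le> \<bar>x - y\<bar>" if "(\<omega>, x) \<in> K" "(\<omega>, y) \<in> L" for \<omega> x y
    using e(2)[OF that] by (simp add: dist_Pair_Pair dist_real_def)
  then show ?thesis using e(1) by blast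
qed

context skew_system
begin

lemma at_most_three:
  assumes DC: "DC f" and AB: "A < B" and K: "\<And>\<omega> x. (\<omega>, x) \<in> K \<Longrightarrow> x \<in> {A..B}"
    and pos: "\<And>\<epsilon>. 0 < \<epsilon> \<Longrightarrow> \<epsilon> \<le> (B - A) / 2 \<Longrightarrow> \<exists>M\<in>ergodic_measures \<sigma>. 0 < measure M {\<omega>. 0 < curvature A B \<epsilon> \<omega>}"
  shows "at_most_three_disjoint \<sigma> f K"
  unfolding at_most_three_disjoint_def
proof (intro allI impI, rule ccontr)
  fix \<F> assume F: "(\<forall>L\<in>\<F>. L \<subseteq> K \<and> compact_invariant_onto \<sigma> f L) \<and> disjoint \<F>"
    and "\<not> (finite \<F> \<and> card \<F> \<le> 3)"
  then have "infinite \<F> \<or> 4 \<le> card \<F>" by auto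
  then obtain \<G> where G: "\<G> \<subseteq> \<F>" "finite \<G>" "card \<G> = 4"
    using infinite_arbitrarily_large[of \<F> 4] obtain_subset_with_card_n[of 4 \<F>] by metis
  from ex_bij_betw_nat_finite[OF G(2)] G(3) obtain L where L: "bij_betw L {..<4 :: nat} \<G>"
    by (auto simp: atLeast0LessThan)
  have LF: "L i \<in> \<F>" if "i < 4" for i using L G(1) that by (auto simp: bij_betw_def)
  have inv: "compact_invariant_onto \<sigma> f (L i)" "L i \<subseteq> K" if "i < 4" for i using F LF[OF that] by auto
  have disj: "L i \<inter> L j = {}" if "i < 4" "j < 4" "i \<noteq> j" for i j
  proof -
    have "L i \<noteq> L j" using L that by (auto simp: bij_betw_def inj_on_def)
    then show ?thesis using F LF[OF that(1)] LF[OF that(2)] unfolding disjoint_def pairwise_def disjnt_def by blast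
  qed
  have "\<exists>e>0. \<forall>\<omega> x y. (\<omega>, x) \<in> L i \<longrightarrow> (\<omega>, y) \<in> L j \<longrightarrow> e \<le> \<bar>x - y\<bar>" if "i < 4" "j < 4" "i \<noteq> j" for i j
    using inv that by (intro compact_disjoint_gap disj) (auto simp: compact_invariant_onto_def)
  then have "\<exists>e>0. i < 4 \<longrightarrow> j < 4 \<longrightarrow> i \<noteq> j \<longrightarrow>
      (\<forall>\<omega> x y. (\<omega>, x) \<in> L i \<longrightarrow> (\<omega>, y) \<in> L j \<longrightarrow> e \<le> \<bar>x - y\<bar>)" for i j
    by (cases "i < 4 \<and> j < 4 \<and> i \<noteq> j") (auto intro: exI[of _ "1 :: real"])
  then obtain e where e: "\<And>i j. 0 < e i j"
    "\<And>i j \<omega> x y. i < 4 \<Longrightarrow> j < 4 \<Longrightarrow> i \<noteq> j \<Longrightarrow> (\<omega>, x) \<in> L i \<Longrightarrow> (\<omega>, y) \<in> L j \<Longrightarrow> e i j \<le> \<bar>x - y\<bar>"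
    by metis
  define m where "m = Min ((\<lambda>(i, j). e i j) ` ({..<4} \<times> {..<4}))"
  have m0: "0 < m" unfolding m_def using e(1) by (subst Min_gr_iff) (auto simp: lessThan_empty_iff)
  have m: "m \<le> e i j" if "i < 4" "j < 4" for i j
    unfolding m_def using that by (intro Min_le) (auto intro!: image_eqI[of _ _ "(i, j)"])
  define \<epsilon> where "\<epsilon> = min (m / 2) ((B - A) / 2)"
  have \<epsilon>: "0 < \<epsilon>" "\<epsilon> \<le> (B - A) / 2" "2 * \<epsilon> \<le> m" using m0 AB by (auto simp: \<epsilon>_def min_def)
  from pos[OF \<epsilon>(1,2)] obtain M where M: "M \<in> ergodic_measures \<sigma>" "0 < measure M {\<omega>. 0 < curvature A B \<epsilon> \<omega>}" by blast
  have "AE \<omega> in M. \<not> 0 < curvature A B \<epsilon> \<omega>"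
  proof (rule four_sets_null[OF DC \<epsilon>(1) _ M(1) inv(1)])
    show "\<epsilon> \<le> B - A" using \<epsilon> AB by simp
    show "x \<in> {A..B}" if "i < 4" "(\<omega>, x) \<in> L i" for i \<omega> x using K inv(2)[OF that(1)] that(2) by blast
    show "2 * \<epsilon> \<le> \<bar>x - y\<bar>" if "i < 4" "j < 4" "i \<noteq> j" "(\<omega>, x) \<in> L i" "(\<omega>, y) \<in> L j" for i j \<omega> x y
      using e(2)[OF that] m[OF that(1,2)] \<epsilon>(3) by linarith
  qed
  moreover have "{\<omega>. 0 < curvature A B \<epsilon> \<omega>} \<in> sets M"
    using M(2) measure_notin_sets by force
  moreover have "space M = UNIV" using M(1) sets_eq_imp_space_eq[of M borel] by (auto simp: ergodic_measures_def)
  ultimately have "emeasure M {\<omega>. 0 < curvature A B \<epsilon> \<omega>} = 0"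
    using AE_iff_measurable[of "{\<omega>. 0 < curvature A B \<epsilon> \<omega>}" M "\<lambda>\<omega>. \<not> 0 < curvature A B \<epsilon> \<omega>"] by simp
  then show False using M(2) by (simp add: measure_def)
qed

end

section \<open>Exponential decay of cross ratios\<close>

context skew_system
begin

text \<open>The square of the cross ratio is used so that its sign need not be known.\<close>

lemma cross_ratio_decay:
  assumes st: "s \<le> t" and g: "continuous_on UNIV g"
    and x: "\<And>u. u \<in> {s..t} \<Longrightarrow> (x\<^sub>1 has_real_derivative f (\<sigma> u \<omega>) (x\<^sub>1 u)) (at u)"
      "\<And>u. u \<in> {s..t} \<Longrightarrow> (x\<^sub>2 has_real_derivative f (\<sigma> u \<omega>) (x\<^sub>2 u)) (at u)"
      "\<And>u. u \<in> {s..t} \<Longrightarrow> (x\<^sub>3 has_real_derivative f (\<sigma> u \<omega>) (x\<^sub>3 u)) (at u)"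
      "\<And>u. u \<in> {s..t} \<Longrightarrow> (x\<^sub>4 has_real_derivative f (\<sigma> u \<omega>) (x\<^sub>4 u)) (at u)"
    and dist: "\<And>u. u \<in> {s..t} \<Longrightarrow> distinct [x\<^sub>1 u, x\<^sub>2 u, x\<^sub>3 u, x\<^sub>4 u]"
    and rate: "\<And>u. u \<in> {s..t} \<Longrightarrow>
      (x\<^sub>3 u - x\<^sub>2 u) * (x\<^sub>4 u - x\<^sub>1 u) * divdiff3 (f (\<sigma> u \<omega>)) (x\<^sub>1 u) (x\<^sub>2 u) (x\<^sub>3 u) (x\<^sub>4 u) \<le> - (\<kappa> * g (\<sigma> u \<omega>))"
  defines "X \<equiv> \<lambda>u. (x\<^sub>2 u - x\<^sub>1 u) * (x\<^sub>4 u - x\<^sub>3 u) / ((x\<^sub>3 u - x\<^sub>1 u) * (x\<^sub>4 u - x\<^sub>2 u))"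
    and "G \<equiv> primitive (\<lambda>u. g (\<sigma> u \<omega>))"
  shows "\<bar>X t\<bar> \<le> \<bar>X s\<bar> * exp (- \<kappa> * (G t - G s))"
proof -
  let ?\<rho> = "\<lambda>u. (x\<^sub>3 u - x\<^sub>2 u) * (x\<^sub>4 u - x\<^sub>1 u) * divdiff3 (f (\<sigma> u \<omega>)) (x\<^sub>1 u) (x\<^sub>2 u) (x\<^sub>3 u) (x\<^sub>4 u)"
  have gc: "continuous_on UNIV (\<lambda>u. g (\<sigma> u \<omega>))"
    by (rule continuous_on_compose2[OF g flow_continuous(2)[OF flow]]) simp
  have dX: "(X has_real_derivative ?\<rho> u * X u) (at u)" if "u \<in> {s..t}" for u
    unfolding X_def by (rule cross_ratio_deriv[OF x(1)[OF that] x(2)[OF that] x(3)[OF that] x(4)[OF that] dist[OF that]])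
  have dG: "(G has_real_derivative g (\<sigma> u \<omega>)) (at u)" for u
    unfolding G_def by (rule primitive_deriv[OF gc])
  have "(X t)\<^sup>2 * exp (2 * \<kappa> * G t) \<le> (X s)\<^sup>2 * exp (2 * \<kappa> * G s)"
  proof (rule DERIV_nonpos_imp_nonincreasing[OF st, where f = "\<lambda>u. (X u)\<^sup>2 * exp (2 * \<kappa> * G u)"])
    fix u assume "s \<le> u" "u \<le> t"
    then have u: "u \<in> {s..t}" by simp
    have "((\<lambda>u. (X u)\<^sup>2 * exp (2 * \<kappa> * G u)) has_real_derivative
        2 * (X u)\<^sup>2 * exp (2 * \<kappa> * G u) * (?\<rho> u + \<kappa> * g (\<sigma> u \<omega>))) (at u)"
      by (rule derivative_eq_intros dX[OF u] dG refl | simp add: algebra_simps power2_eq_square)+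
    moreover have "2 * (X u)\<^sup>2 * exp (2 * \<kappa> * G u) * (?\<rho> u + \<kappa> * g (\<sigma> u \<omega>)) \<le> 0"
      using rate[OF u] by (intro mult_nonneg_nonpos) auto
    ultimately show "\<exists>y. ((\<lambda>u. (X u)\<^sup>2 * exp (2 * \<kappa> * G u)) has_real_derivative y) (at u) \<and> y \<le> 0" by blast
  qed
  then have "(X t)\<^sup>2 * exp (2 * \<kappa> * G t) * exp (- (2 * \<kappa> * G t)) \<le> (X s)\<^sup>2 * exp (2 * \<kappa> * G s) * exp (- (2 * \<kappa> * G t))"
    by (rule mult_right_mono) simp
  moreover have "exp (2 * \<kappa> * G s) * exp (- (2 * \<kappa> * G t)) = (exp (- \<kappa> * (G t - G s)))\<^sup>2"
    by (simp add: power2_eq_square algebra_simps flip: exp_add)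
  ultimately have "(X t)\<^sup>2 \<le> (X s)\<^sup>2 * (exp (- \<kappa> * (G t - G s)))\<^sup>2"
    by (simp add: mult.assoc flip: exp_add)
  then have "\<bar>X t\<bar>\<^sup>2 \<le> (\<bar>X s\<bar> * exp (- \<kappa> * (G t - G s)))\<^sup>2" by (simp add: power_mult_distrib)
  then show ?thesis by (rule power2_le_imp_le) simp
qed

end

lemma ratio_bounds:
  fixes r D w :: real
  assumes "0 < r" "r \<le> N" "N \<le> D" "r \<le> R" "R \<le> D" "r \<le> S" "S \<le> D" "0 \<le> w"
  shows "w * (r / D\<^sup>2) \<le> N * w / (R * S)" "N * w / (R * S) \<le> w * (D / r\<^sup>2)"
proof -
  have "R * S \<le> D * D" using assms by (intro mult_mono) auto
  then have "r / (D * D) \<le> N / (R * S)" using assms by (intro frac_le mult_pos_pos) auto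
  from mult_left_mono[OF this assms(8)] show "w * (r / D\<^sup>2) \<le> N * w / (R * S)" by (simp add: power2_eq_square ac_simps)
  have "r * r \<le> R * S" using assms by (intro mult_mono) auto
  then have "N / (R * S) \<le> D / (r * r)" using assms by (intro frac_le mult_pos_pos) auto
  from mult_left_mono[OF this assms(8)] show "N * w / (R * S) \<le> w * (D / r\<^sup>2)" by (simp add: power2_eq_square ac_simps)
qed

text \<open>This turns decay of a cross ratio into decay of the difference \<open>w\<close> in it, if the other factors lie in \<open>[r, D]\<close>.\<close>

lemma ratio_decay_imp:
  fixes r D w w' :: real
  assumes "0 < r" "0 < D" "w * (r / D\<^sup>2) \<le> X" "X \<le> X' * E" "X' \<le> w' * (D / r\<^sup>2)" "0 \<le> E"
  shows "w \<le> (D / r) ^ 3 * E * w'"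
proof -
  have "X' * E \<le> w' * (D / r\<^sup>2) * E" using assms by (intro mult_right_mono) auto
  then have "w * (r / D\<^sup>2) \<le> w' * (D / r\<^sup>2) * E" using assms by linarith
  then have "w * (r / D\<^sup>2) * (D\<^sup>2 / r) \<le> w' * (D / r\<^sup>2) * E * (D\<^sup>2 / r)" using assms by (intro mult_right_mono) auto
  moreover have "w * (r / D\<^sup>2) * (D\<^sup>2 / r) = w" using assms by simp
  moreover have "w' * (D / r\<^sup>2) * E * (D\<^sup>2 / r) = (D / r) ^ 3 * E * w'"
    by (simp add: power2_eq_square power3_eq_cube power_divide)
  ultimately show ?thesis by simp
qed

lemma exp_decay_imp_nonpos:
  fixes w :: real
  assumes \<rho>: "0 < \<rho>" and w: "\<And>T. 0 \<le> T \<Longrightarrow> w \<le> K * exp (- \<rho> * T)"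
  shows "w \<le> 0"
proof (rule ccontr)
  assume "\<not> w \<le> 0"
  then have w0: "0 < w" by simp
  have K: "w \<le> K" using w[of 0] by simp
  define T where "T = K / (w * \<rho>)"
  have T: "0 \<le> T" "w * (\<rho> * T) = K" using w0 K \<rho> by (auto simp: T_def)
  have "w * exp (\<rho> * T) \<le> K * exp (- \<rho> * T) * exp (\<rho> * T)" using w[OF T(1)] by (intro mult_right_mono) auto
  also have "\<dots> = K" by (simp add: mult.assoc flip: exp_add)
  finally have "w * exp (\<rho> * T) \<le> K" .
  moreover have "w * (1 + \<rho> * T) \<le> w * exp (\<rho> * T)" using w0 exp_ge_add_one_self by (intro mult_left_mono) auto
  ultimately show False using T w0 by (simp add: distrib_left)
qed

text \<open>A continuity argument: an estimate that holds as long as \<open>w \<le> r\<close>, and which gives \<open>w < r\<close>, holds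
forever.  Otherwise consider the first time at which \<open>w \<ge> r\<close>.\<close>

lemma bootstrap:
  fixes w :: "real \<Rightarrow> real"
  assumes w: "continuous_on {0..} w" "w 0 < r"
    and step: "\<And>T. 0 \<le> T \<Longrightarrow> (\<And>u. 0 \<le> u \<Longrightarrow> u \<le> T \<Longrightarrow> w u \<le> r) \<Longrightarrow> w T < r"
    and t: "0 \<le> t"
  shows "w t < r"
proof (rule ccontr)
  assume nt: "\<not> w t < r"
  define S where "S = {u \<in> {0..t}. r \<le> w u}"
  have c: "continuous_on {0..t} w" by (rule continuous_on_subset[OF w(1)]) auto
  have "closed S" unfolding S_def
    by (intro continuous_on_closed_Collect_le continuous_on_const c) simp
  then have "compact ({0..t} \<inter> S)" by (intro compact_Int_closed compact_Icc)
  moreover have "{0..t} \<inter> S = S" by (auto simp: S_def)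
  ultimately have "compact S" by simp
  moreover have "S \<noteq> {}" using nt t by (auto simp: S_def)
  ultimately obtain T where T: "T \<in> S" "\<And>u. u \<in> S \<Longrightarrow> T \<le> u" by (meson compact_attains_inf)
  have T0: "0 \<le> T" "T \<le> t" "r \<le> w T" using T(1) by (auto simp: S_def)
  have before: "w u < r" if "0 \<le> u" "u < T" for u
  proof (rule ccontr)
    assume "\<not> w u < r"
    then have "u \<in> S" using that T0 by (simp add: S_def)
    then show False using T(2)[of u] that by simp
  qed
  have "w T \<le> r"
  proof (rule ccontr)
    assume "\<not> w T \<le> r"
    then have "\<exists>v\<ge>0. v \<le> T \<and> w v = r"
      using w(2) T0 by (intro IVT' continuous_on_subset[OF c]) auto
    then obtain v where v: "0 \<le> v" "v \<le> T" "w v = r" by blast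
    then show False using before[of v] \<open>\<not> w T \<le> r\<close> by (cases "v = T") auto
  qed
  then have "w u \<le> r" if "0 \<le> u" "u \<le> T" for u
    using before[of u] that by (cases "u = T") (auto intro: less_imp_le)
  from step[OF T0(1) this] T0(3) show False by simp
qed

text \<open>Three ordered invariant sets in the strip \<open>[A, B]\<close> with gaps \<open>e\<close>, together with the uniform growth of the integrated
curvature.\<close>

locale three_sets = skew_system \<sigma> f
  for \<sigma> :: "real \<Rightarrow> 'w::metric_space \<Rightarrow> 'w" and f :: "'w \<Rightarrow> real \<Rightarrow> real" +
  fixes K\<^sub>1 K\<^sub>2 K\<^sub>3 :: "('w \<times> real) set" and A B e \<epsilon> \<gamma> :: real
  assumes DC: "DC f"
    and inv: "compact_invariant_onto \<sigma> f K\<^sub>1" "compact_invariant_onto \<sigma> f K\<^sub>2" "compact_invariant_onto \<sigma> f K\<^sub>3"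
    and strip: "K\<^sub>1 \<subseteq> UNIV \<times> {A..B}" "K\<^sub>2 \<subseteq> UNIV \<times> {A..B}" "K\<^sub>3 \<subseteq> UNIV \<times> {A..B}"
    and gap12: "(\<omega>, x) \<in> K\<^sub>1 \<Longrightarrow> (\<omega>, y) \<in> K\<^sub>2 \<Longrightarrow> x + e \<le> y"
    and gap23: "(\<omega>, x) \<in> K\<^sub>2 \<Longrightarrow> (\<omega>, y) \<in> K\<^sub>3 \<Longrightarrow> x + e \<le> y"
    and \<epsilon>: "0 < \<epsilon>" "4 * \<epsilon> \<le> e" "\<epsilon> \<le> B - A" and \<gamma>: "0 < \<gamma>"
    and growth: "s \<le> t \<Longrightarrow> \<gamma> * (t - s) - 1 \<le>
      primitive (\<lambda>u. curvature A B \<epsilon> (\<sigma> u \<omega>)) t - primitive (\<lambda>u. curvature A B \<epsilon> (\<sigma> u \<omega>)) s"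
begin

text \<open>Solutions up to distance \<open>r\<close> of one of the sets keep the distance \<open>r\<close> from the other two, since
\<open>e = 2 r\<close>; all distances between the four solutions considered are at most \<open>D\<close>.  The
constants \<open>\<kappa>\<close>, \<open>C\<close> and \<open>\<rho>\<close> are the resulting bounds for the rate relative to the curvature, the constant
factor and the exponential rate.\<close>

definition r where "r = e / 2"
definition D where "D = B - A + e"
definition \<kappa> where "\<kappa> = r * r * (\<epsilon> / D ^ 3)"
definition C where "C = (D / r) ^ 3 * exp \<kappa>"
definition \<rho> where "\<rho> = \<kappa> * \<gamma>"

lemma constants_pos: "0 < e" "0 < r" "r \<le> D" "0 < D" "0 < \<kappa>" "0 < \<rho>" "1 \<le> C" "e = 2 * r" "2 * \<epsilon> \<le> r"
proof -
  show e: "0 < e" and re: "e = 2 * r" "2 * \<epsilon> \<le> r" using \<epsilon> by (auto simp: r_def)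
  show r: "0 < r" using e by (simp add: r_def)
  show rD: "r \<le> D" using \<epsilon> e by (simp add: r_def D_def)
  then show D: "0 < D" using r by simp
  show k: "0 < \<kappa>" unfolding \<kappa>_def using r D \<epsilon> by simp
  show "0 < \<rho>" unfolding \<rho>_def using k \<gamma> by simp
  have "1 \<le> D / r" using r rD by simp
  then have "1 * 1 \<le> (D / r) ^ 3 * exp \<kappa>" using k by (intro mult_mono) (auto simp: one_le_power)
  then show "1 \<le> C" by (simp add: C_def)
qed

lemma trajectory_in:
  assumes "compact_invariant_onto \<sigma> f K"
  obtains x where "trajectory \<omega> x" "\<And>t. (\<sigma> t \<omega>, x t) \<in> K"
proof -
  have "\<omega> \<in> fst ` K" using assms by (simp add: compact_invariant_onto_def)
  then obtain x\<^sub>0 where "(\<omega>, x\<^sub>0) \<in> K" by auto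
  moreover have "skew_invariant \<sigma> f K" using assms by (simp add: compact_invariant_onto_def)
  ultimately show thesis using invariant_trajectory that by metis
qed

lemma cross_ratio_exp_decay:
  assumes st: "s \<le> t"
    and x: "\<And>u. u \<in> {s..t} \<Longrightarrow> (x\<^sub>1 has_real_derivative f (\<sigma> u \<omega>) (x\<^sub>1 u)) (at u)"
      "\<And>u. u \<in> {s..t} \<Longrightarrow> (x\<^sub>2 has_real_derivative f (\<sigma> u \<omega>) (x\<^sub>2 u)) (at u)"
      "\<And>u. u \<in> {s..t} \<Longrightarrow> (x\<^sub>3 has_real_derivative f (\<sigma> u \<omega>) (x\<^sub>3 u)) (at u)"
      "\<And>u. u \<in> {s..t} \<Longrightarrow> (x\<^sub>4 has_real_derivative f (\<sigma> u \<omega>) (x\<^sub>4 u)) (at u)"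
    and dist: "\<And>u. u \<in> {s..t} \<Longrightarrow> distinct [x\<^sub>1 u, x\<^sub>2 u, x\<^sub>3 u, x\<^sub>4 u]"
    and dd: "\<And>u. u \<in> {s..t} \<Longrightarrow>
      divdiff3 (f (\<sigma> u \<omega>)) (x\<^sub>1 u) (x\<^sub>2 u) (x\<^sub>3 u) (x\<^sub>4 u) \<le> - (\<epsilon> / D ^ 3 * curvature A B \<epsilon> (\<sigma> u \<omega>))"
    and far: "\<And>u. u \<in> {s..t} \<Longrightarrow> r \<le> x\<^sub>3 u - x\<^sub>2 u" "\<And>u. u \<in> {s..t} \<Longrightarrow> r \<le> x\<^sub>4 u - x\<^sub>1 u"
  defines "X \<equiv> \<lambda>u. (x\<^sub>2 u - x\<^sub>1 u) * (x\<^sub>4 u - x\<^sub>3 u) / ((x\<^sub>3 u - x\<^sub>1 u) * (x\<^sub>4 u - x\<^sub>2 u))"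
  shows "\<bar>X t\<bar> \<le> \<bar>X s\<bar> * (exp \<kappa> * exp (- \<rho> * (t - s)))"
proof -
  note cp = curvature_props[OF DC \<epsilon>(1,3)]
  let ?G = "primitive (\<lambda>u. curvature A B \<epsilon> (\<sigma> u \<omega>))"
  have "\<bar>X t\<bar> \<le> \<bar>X s\<bar> * exp (- \<kappa> * (?G t - ?G s))"
    unfolding X_def
  proof (rule cross_ratio_decay[OF st cp(1) x dist])
    fix u assume u: "u \<in> {s..t}"
    let ?k = "\<epsilon> / D ^ 3 * curvature A B \<epsilon> (\<sigma> u \<omega>)"
    have k0: "0 \<le> ?k" using cp(2)[of "\<sigma> u \<omega>"] \<epsilon> constants_pos by simp
    have "r * r \<le> (x\<^sub>3 u - x\<^sub>2 u) * (x\<^sub>4 u - x\<^sub>1 u)" using far[OF u] constants_pos by (intro mult_mono) auto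
    then have "r * r * ?k \<le> (x\<^sub>3 u - x\<^sub>2 u) * (x\<^sub>4 u - x\<^sub>1 u) * ?k" by (rule mult_right_mono[OF _ k0])
    also have "\<dots> \<le> (x\<^sub>3 u - x\<^sub>2 u) * (x\<^sub>4 u - x\<^sub>1 u) * - divdiff3 (f (\<sigma> u \<omega>)) (x\<^sub>1 u) (x\<^sub>2 u) (x\<^sub>3 u) (x\<^sub>4 u)"
      using dd[OF u] far[OF u] constants_pos by (intro mult_left_mono mult_nonneg_nonneg) auto
    finally show "(x\<^sub>3 u - x\<^sub>2 u) * (x\<^sub>4 u - x\<^sub>1 u) * divdiff3 (f (\<sigma> u \<omega>)) (x\<^sub>1 u) (x\<^sub>2 u) (x\<^sub>3 u) (x\<^sub>4 u)
        \<le> - (\<kappa> * curvature A B \<epsilon> (\<sigma> u \<omega>))"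
      by (simp add: \<kappa>_def ac_simps)
  qed auto
  also have "\<dots> \<le> \<bar>X s\<bar> * (exp \<kappa> * exp (- \<rho> * (t - s)))"
  proof (rule mult_left_mono)
    have "\<kappa> * (\<gamma> * (t - s) - 1) \<le> \<kappa> * (?G t - ?G s)"
      using growth[OF st] constants_pos by (intro mult_left_mono) auto
    then have "- \<kappa> * (?G t - ?G s) \<le> \<kappa> + - \<rho> * (t - s)" by (simp add: \<rho>_def algebra_simps)
    then show "exp (- \<kappa> * (?G t - ?G s)) \<le> exp \<kappa> * exp (- \<rho> * (t - s))" by (simp flip: exp_add)
  qed simp
  finally show ?thesis .
qed

text \<open>Here \<open>p\<close> and \<open>q\<close> are solutions above the middle set, and the curvature is found in the gap
between the lower and the middle set.\<close>

lemma pair_decay_upper: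
  assumes st: "s \<le> t"
    and a: "trajectory \<omega> a" "\<And>u. (\<sigma> u \<omega>, a u) \<in> K\<^sub>1" and b: "trajectory \<omega> b" "\<And>u. (\<sigma> u \<omega>, b u) \<in> K\<^sub>2"
    and p: "\<And>u. u \<in> {s..t} \<Longrightarrow> (p has_real_derivative f (\<sigma> u \<omega>) (p u)) (at u)"
    and q: "\<And>u. u \<in> {s..t} \<Longrightarrow> (q has_real_derivative f (\<sigma> u \<omega>) (q u)) (at u)"
    and ord: "\<And>u. u \<in> {s..t} \<Longrightarrow> b u + r \<le> p u \<and> p u < q u \<and> q u \<le> B + r"
  shows "q t - p t \<le> C * exp (- \<rho> * (t - s)) * (q s - p s)"
proof -
  have ab: "A \<le> a u" "b u \<le> B" "a u + e \<le> b u" for u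
    using gap12[OF a(2) b(2), of u] a(2)[of u] b(2)[of u] strip by auto
  let ?X = "\<lambda>u. (b u - a u) * (q u - p u) / ((p u - a u) * (q u - b u))"
  have ends: "s \<in> {s..t}" "t \<in> {s..t}" using st by auto
  have nonneg: "0 \<le> ?X u" if "u \<in> {s..t}" for u
    using ab[of u] ord[OF that] constants_pos by (intro divide_nonneg_nonneg mult_nonneg_nonneg) linarith+
  have bounds: "(q u - p u) * (r / D\<^sup>2) \<le> ?X u" "?X u \<le> (q u - p u) * (D / r\<^sup>2)" if "u \<in> {s..t}" for u
    by (rule ratio_bounds; use ab[of u] ord[OF that] constants_pos D_def in linarith)+
  have "\<bar>?X t\<bar> \<le> \<bar>?X s\<bar> * (exp \<kappa> * exp (- \<rho> * (t - s)))"
  proof (rule cross_ratio_exp_decay[OF st])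
    fix u assume u: "u \<in> {s..t}"
    note o = ab[of u] ord[OF u] constants_pos D_def
    show "distinct [a u, b u, p u, q u]" using o by auto
    show "divdiff3 (f (\<sigma> u \<omega>)) (a u) (b u) (p u) (q u) \<le> - (\<epsilon> / D ^ 3 * curvature A B \<epsilon> (\<sigma> u \<omega>))"
      by (rule divdiff3_le_curvature[OF DC \<epsilon>(1,3)]) (use o \<epsilon> in linarith)+
    show "r \<le> p u - b u" "r \<le> q u - a u" using o by linarith+
  qed (use a(1) b(1) p q in \<open>auto simp: trajectory_def\<close>)
  then have "?X t \<le> ?X s * (exp \<kappa> * exp (- \<rho> * (t - s)))"
    unfolding abs_of_nonneg[OF nonneg[OF ends(1)]] abs_of_nonneg[OF nonneg[OF ends(2)]] .
  then have "q t - p t \<le> (D / r) ^ 3 * (exp \<kappa> * exp (- \<rho> * (t - s))) * (q s - p s)"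
    using st by (intro ratio_decay_imp[OF constants_pos(2,4) bounds(1) _ bounds(2)]) auto
  then show ?thesis by (simp add: C_def mult.assoc)
qed

text \<open>Here \<open>p\<close> and \<open>q\<close> are solutions below the middle set, and the curvature is found in the gap
between the middle and the upper set.\<close>

lemma pair_decay_lower:
  assumes st: "s \<le> t"
    and c: "trajectory \<omega> c" "\<And>u. (\<sigma> u \<omega>, c u) \<in> K\<^sub>2" and d: "trajectory \<omega> d" "\<And>u. (\<sigma> u \<omega>, d u) \<in> K\<^sub>3"
    and p: "\<And>u. u \<in> {s..t} \<Longrightarrow> (p has_real_derivative f (\<sigma> u \<omega>) (p u)) (at u)"
    and q: "\<And>u. u \<in> {s..t} \<Longrightarrow> (q has_real_derivative f (\<sigma> u \<omega>) (q u)) (at u)"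
    and ord: "\<And>u. u \<in> {s..t} \<Longrightarrow> A - r \<le> p u \<and> p u < q u \<and> q u + r \<le> c u"
  shows "q t - p t \<le> C * exp (- \<rho> * (t - s)) * (q s - p s)"
proof -
  have cd: "A \<le> c u" "d u \<le> B" "c u + e \<le> d u" for u
    using gap23[OF c(2) d(2), of u] c(2)[of u] d(2)[of u] strip by auto
  let ?X = "\<lambda>u. (q u - p u) * (d u - c u) / ((c u - p u) * (d u - q u))"
  have ends: "s \<in> {s..t}" "t \<in> {s..t}" using st by auto
  have nonneg: "0 \<le> ?X u" if "u \<in> {s..t}" for u
    using cd[of u] ord[OF that] constants_pos by (intro divide_nonneg_nonneg mult_nonneg_nonneg) linarith+
  have bounds: "(q u - p u) * (r / D\<^sup>2) \<le> ?X u" "?X u \<le> (q u - p u) * (D / r\<^sup>2)" if "u \<in> {s..t}" for u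
    unfolding mult.commute[of "q u - p u" "d u - c u"]
    by (rule ratio_bounds; use cd[of u] ord[OF that] constants_pos D_def in linarith)+
  have "\<bar>?X t\<bar> \<le> \<bar>?X s\<bar> * (exp \<kappa> * exp (- \<rho> * (t - s)))"
  proof (rule cross_ratio_exp_decay[OF st])
    fix u assume u: "u \<in> {s..t}"
    note o = cd[of u] ord[OF u] constants_pos D_def
    show "distinct [p u, q u, c u, d u]" using o by auto
    show "divdiff3 (f (\<sigma> u \<omega>)) (p u) (q u) (c u) (d u) \<le> - (\<epsilon> / D ^ 3 * curvature A B \<epsilon> (\<sigma> u \<omega>))"
      by (rule divdiff3_le_curvature[OF DC \<epsilon>(1,3)]) (use o \<epsilon> in linarith)+
    show "r \<le> c u - q u" "r \<le> d u - p u" using o by linarith+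
  qed (use c(1) d(1) p q in \<open>auto simp: trajectory_def\<close>)
  then have "?X t \<le> ?X s * (exp \<kappa> * exp (- \<rho> * (t - s)))"
    unfolding abs_of_nonneg[OF nonneg[OF ends(1)]] abs_of_nonneg[OF nonneg[OF ends(2)]] .
  then have "q t - p t \<le> (D / r) ^ 3 * (exp \<kappa> * exp (- \<rho> * (t - s))) * (q s - p s)"
    using st by (intro ratio_decay_imp[OF constants_pos(2,4) bounds(1) _ bounds(2)]) auto
  then show ?thesis by (simp add: C_def mult.assoc)
qed

text \<open>The decreasing cross ratio is the one of \<open>a, p, d, q\<close> in this order, which has the
difference \<open>q - p\<close> in the denominator; \<open>Y\<close> is its reciprocal up to sign.\<close>

lemma pair_growth_middle:
  assumes st: "s \<le> t"
    and a: "trajectory \<omega> a" "\<And>u. (\<sigma> u \<omega>, a u) \<in> K\<^sub>1" and d: "trajectory \<omega> d" "\<And>u. (\<sigma> u \<omega>, d u) \<in> K\<^sub>3"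
    and p: "\<And>u. u \<in> {s..t} \<Longrightarrow> (p has_real_derivative f (\<sigma> u \<omega>) (p u)) (at u)"
    and q: "\<And>u. u \<in> {s..t} \<Longrightarrow> (q has_real_derivative f (\<sigma> u \<omega>) (q u)) (at u)"
    and ord: "\<And>u. u \<in> {s..t} \<Longrightarrow> a u + r \<le> p u \<and> p u < q u \<and> q u + r \<le> d u"
  shows "q s - p s \<le> C * exp (- \<rho> * (t - s)) * (q t - p t)"
proof -
  have ad: "A \<le> a u" "d u \<le> B" for u using a(2)[of u] d(2)[of u] strip by auto
  let ?X = "\<lambda>u. (p u - a u) * (q u - d u) / ((d u - a u) * (q u - p u))"
  let ?Y = "\<lambda>u. (d u - a u) * (q u - p u) / ((p u - a u) * (d u - q u))"
  let ?E = "exp \<kappa> * exp (- \<rho> * (t - s))"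
  have ends: "s \<in> {s..t}" "t \<in> {s..t}" using st by auto
  have invert: "y' \<le> y * E" if "1 / y \<le> 1 / y' * E" "0 < y" "0 < y'" for y y' E :: real
    using that by (simp add: field_simps)
  have bounds: "(q u - p u) * (r / D\<^sup>2) \<le> ?Y u" "?Y u \<le> (q u - p u) * (D / r\<^sup>2)" if "u \<in> {s..t}" for u
    by (rule ratio_bounds; use ad[of u] ord[OF that] constants_pos D_def in linarith)+
  have XY: "\<bar>?X u\<bar> = 1 / ?Y u" "0 < ?Y u" if "u \<in> {s..t}" for u
  proof -
    have pos: "0 < p u - a u" "0 < d u - q u" "0 < d u - a u" "0 < q u - p u" using ord[OF that] constants_pos by linarith+
    then show "\<bar>?X u\<bar> = 1 / ?Y u" by (simp add: abs_mult)
    show "0 < ?Y u" using pos by (intro divide_pos_pos mult_pos_pos)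
  qed
  have "\<bar>?X t\<bar> \<le> \<bar>?X s\<bar> * ?E"
  proof (rule cross_ratio_exp_decay[OF st])
    fix u assume u: "u \<in> {s..t}"
    note o = ad[of u] ord[OF u] constants_pos D_def
    show "distinct [a u, p u, d u, q u]" using o by auto
    have "divdiff3 (f (\<sigma> u \<omega>)) (a u) (p u) (q u) (d u) \<le> - (\<epsilon> / D ^ 3 * curvature A B \<epsilon> (\<sigma> u \<omega>))"
      by (rule divdiff3_le_curvature[OF DC \<epsilon>(1,3)]) (use o \<epsilon> in linarith)+
    then show "divdiff3 (f (\<sigma> u \<omega>)) (a u) (p u) (d u) (q u) \<le> - (\<epsilon> / D ^ 3 * curvature A B \<epsilon> (\<sigma> u \<omega>))"
      by (simp only: divdiff3_swap_last)
    show "r \<le> d u - p u" "r \<le> q u - a u" using o by linarith+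
  qed (use a(1) d(1) p q in \<open>auto simp: trajectory_def\<close>)
  then have "1 / ?Y t \<le> 1 / ?Y s * ?E" unfolding XY(1)[OF ends(1)] XY(1)[OF ends(2)] .
  then have "?Y s \<le> ?Y t * ?E" by (rule invert) (rule XY(2)[OF ends(2)], rule XY(2)[OF ends(1)])
  then have "q s - p s \<le> (D / r) ^ 3 * ?E * (q t - p t)"
    using st by (intro ratio_decay_imp[OF constants_pos(2,4) bounds(1) _ bounds(2)]) auto
  then show ?thesis by (simp add: C_def mult.assoc)
qed

end

section \<open>Hyperbolic copies of the base\<close>

text \<open>The projection to the base is a continuous bijection from a compact set, hence a homeomorphism.\<close>

lemma graph_of_compact_continuous:
  fixes K :: "('w::metric_space \<times> real) set"
  assumes "compact K" "fst ` K = UNIV" and single: "\<And>\<omega> x y. (\<omega>, x) \<in> K \<Longrightarrow> (\<omega>, y) \<in> K \<Longrightarrow> x = y"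
  obtains \<beta> where "continuous_on UNIV \<beta>" "K = range (\<lambda>\<omega>. (\<omega>, \<beta> \<omega>))"
proof -
  have "\<forall>\<omega>. \<exists>x. (\<omega>, x) \<in> K" using assms(2) by (metis UNIV_I imageE prod.collapse)
  then obtain \<beta> where \<beta>: "\<And>\<omega>. (\<omega>, \<beta> \<omega>) \<in> K" by metis
  have "continuous_on (fst ` K) (\<lambda>\<omega>. (\<omega>, \<beta> \<omega>))"
  proof (rule continuous_on_inv[OF continuous_on_fst[OF continuous_on_id] assms(1)])
    show "\<forall>p\<in>K. (fst p, \<beta> (fst p)) = p" using single \<beta> by (metis prod.collapse)
  qed
  then have "continuous_on UNIV (\<lambda>\<omega>. snd (\<omega>, \<beta> \<omega>))" unfolding assms(2) by (rule continuous_on_snd)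
  moreover have "K = range (\<lambda>\<omega>. (\<omega>, \<beta> \<omega>))"
  proof (intro equalityI subsetI)
    fix p assume "p \<in> K"
    then have "p = (fst p, \<beta> (fst p))" using single \<beta> by (metis prod.collapse)
    then show "p \<in> range (\<lambda>\<omega>. (\<omega>, \<beta> \<omega>))" by blast
  qed (use \<beta> in blast)
  ultimately show thesis using that by simp
qed

context skew_system
begin

lemma copy_of_baseI:
  assumes K: "compact_invariant_onto \<sigma> f K" and single: "\<And>\<omega> x y. (\<omega>, x) \<in> K \<Longrightarrow> (\<omega>, y) \<in> K \<Longrightarrow> \<not> x < y"
  shows "copy_of_base \<sigma> f K"
proof -
  have K': "compact K" "skew_invariant \<sigma> f K" "fst ` K = UNIV" using K by (auto simp: compact_invariant_onto_def)
  obtain \<beta> where \<beta>: "continuous_on UNIV \<beta>" "K = range (\<lambda>\<omega>. (\<omega>, \<beta> \<omega>))"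
    by (rule graph_of_compact_continuous[OF K'(1,3)]) (use single in \<open>metis linorder_neqE_linordered_idom\<close>)
  have "equilibrium \<sigma> f \<beta>"
    unfolding equilibrium_def
  proof (intro allI)
    fix \<omega> t
    have "t \<in> sol_dom \<sigma> f \<omega> (\<beta> \<omega>) \<and> (\<sigma> t \<omega>, sol \<sigma> f t \<omega> (\<beta> \<omega>)) \<in> K"
      using K'(2) \<beta>(2) unfolding skew_invariant_def skewproduct_def by auto
    then show "t \<in> sol_dom \<sigma> f \<omega> (\<beta> \<omega>) \<and> \<beta> (\<sigma> t \<omega>) = sol \<sigma> f t \<omega> (\<beta> \<omega>)" unfolding \<beta>(2) by auto
  qed
  then show ?thesis unfolding copy_of_base_def using \<beta> by blast
qed

text \<open>Stability for times of sign \<open>sg\<close>.  The decay hypothesis is only about solutions that stay at distance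
at most \<open>r\<close>; a solution that starts at distance less than \<open>r / (2 C)\<close> does so forever, by \<open>bootstrap\<close>.
The perturbed solution is taken from the clamped equation, so that it exists before this is known.\<close>

lemma unif_exp_stableI:
  fixes sg C \<rho> r e A B :: real
  assumes sg: "sg = 1 \<or> sg = -1" and inv: "skew_invariant \<sigma> f K" and strip: "K \<subseteq> UNIV \<times> {A..B}"
    and r: "0 < r" "r < e" and C: "1 \<le> C" and \<rho>: "0 < \<rho>"
    and decay: "\<And>\<omega> x y T. trajectory \<omega> x \<Longrightarrow> (\<And>t. (\<sigma> t \<omega>, x t) \<in> K) \<Longrightarrow> 0 \<le> T \<Longrightarrow>
      (\<And>u. 0 \<le> u \<Longrightarrow> u \<le> T \<Longrightarrow> \<bar>y (sg * u) - x (sg * u)\<bar> \<le> r \<and>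
        (y has_real_derivative f (\<sigma> (sg * u) \<omega>) (y (sg * u))) (at (sg * u))) \<Longrightarrow>
      (\<forall>t. x t < y t) \<or> (\<forall>t. y t < x t) \<Longrightarrow>
      \<bar>y (sg * T) - x (sg * T)\<bar> \<le> C * exp (- \<rho> * T) * \<bar>y 0 - x 0\<bar>"
  shows "unif_exp_stable \<sigma> f {t. 0 \<le> sg * t} K"
proof -
  define \<delta> where "\<delta> = r / (2 * C)"
  have \<delta>: "0 < \<delta>" "C * \<delta> < r" "\<delta> < r"
  proof -
    show "0 < \<delta>" "C * \<delta> < r" using r C by (auto simp: \<delta>_def)
    moreover have "1 * \<delta> \<le> C * \<delta>" using C \<open>0 < \<delta>\<close> by (intro mult_right_mono) auto
    ultimately show "\<delta> < r" by linarith
  qed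
  have sg2: "sg * (sg * t) = t" "\<bar>sg * t\<bar> = \<bar>t\<bar>" for t using sg by auto
  have main: "t \<in> sol_dom \<sigma> f \<omega> y\<^sub>0 \<and> \<bar>sol \<sigma> f t \<omega> y\<^sub>0 - sol \<sigma> f t \<omega> x\<^sub>0\<bar> \<le> C * exp (- \<rho> * \<bar>t\<bar>) * \<bar>y\<^sub>0 - x\<^sub>0\<bar>"
    if mem: "(\<omega>, x\<^sub>0) \<in> K" and near: "\<bar>y\<^sub>0 - x\<^sub>0\<bar> < \<delta>" and t: "0 \<le> sg * t" for \<omega> x\<^sub>0 y\<^sub>0 t
  proof -
    obtain x where x: "trajectory \<omega> x" "x 0 = x\<^sub>0" "\<And>t. (\<sigma> t \<omega>, x t) \<in> K"
      by (rule invariant_trajectory[OF inv mem]) blast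
    note solx = trajectory_sol[OF x(1), unfolded x(2)]
    show ?thesis
    proof (cases "y\<^sub>0 = x\<^sub>0")
      case True then show ?thesis using solx by simp
    next
      case False
      have xr: "A \<le> x u" "x u \<le> B" for u using x(3)[of u] strip by auto
      have AB: "A - e \<le> B + e" using xr[of 0] r by linarith
      obtain y where y: "y 0 = y\<^sub>0" "clamped (A - e) (B + e) \<omega> y" using clamped_exists[OF AB] by blast
      have xc: "clamped (A - e) (B + e) \<omega> x"
      proof (rule trajectory_clamped[OF x(1)])
        show "x u \<in> {A - e..B + e}" for u using xr[of u] r by simp
      qed
      have side: "(\<forall>t. x t < y t) \<or> (\<forall>t. y t < x t)"
      proof (cases "x\<^sub>0 < y\<^sub>0")
        case True
        then have "x 0 < y 0" using x(2) y(1) by simp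
        then show ?thesis using clamped_order[OF AB xc y(2)] by blast
      next
        case le: False
        then have "y 0 < x 0" using x(2) y(1) False by simp
        then show ?thesis using clamped_order[OF AB y(2) xc] by blast
      qed
      have inside: "A - e < y u \<and> y u < B + e" if "\<bar>y u - x u\<bar> \<le> r" for u
        using that xr[of u] r by linarith
      have yd: "(y has_real_derivative f (\<sigma> u \<omega>) (y u)) (at u)" if "\<bar>y u - x u\<bar> \<le> r" for u
      proof -
        have "max (A - e) (min (B + e) (y u)) = y u" using inside[OF that] by auto
        then show ?thesis using y(2) unfolding clamped_def by metis
      qed
      have est: "\<bar>y (sg * T) - x (sg * T)\<bar> \<le> C * exp (- \<rho> * T) * \<bar>y\<^sub>0 - x\<^sub>0\<bar>"
        if "0 \<le> T" "\<And>u. 0 \<le> u \<Longrightarrow> u \<le> T \<Longrightarrow> \<bar>y (sg * u) - x (sg * u)\<bar> \<le> r" for T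
      proof -
        have "\<bar>y (sg * T) - x (sg * T)\<bar> \<le> C * exp (- \<rho> * T) * \<bar>y 0 - x 0\<bar>"
          by (rule decay[OF x(1,3) that(1) _ side]) (intro conjI that(2) yd)
        then show ?thesis unfolding x(2) y(1) .
      qed
      have close: "\<bar>y (sg * T) - x (sg * T)\<bar> < r" if "0 \<le> T" for T
      proof (rule bootstrap[OF _ _ _ that, where w = "\<lambda>T. \<bar>y (sg * T) - x (sg * T)\<bar>"])
        have "continuous_on UNIV y"
          using y(2) unfolding clamped_def by (intro continuous_at_imp_continuous_on ballI DERIV_isCont) blast
        then have "continuous_on {0..} (\<lambda>T. y (sg * T))"
          by (rule continuous_on_compose2[OF _ continuous_on_mult_left[OF continuous_on_id]]) simp
        moreover have "continuous_on {0..} (\<lambda>T. x (sg * T))"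
          by (rule continuous_on_compose2[OF trajectory_continuous[OF x(1), of UNIV]
                continuous_on_mult_left[OF continuous_on_id]]) simp
        ultimately show "continuous_on {0..} (\<lambda>T. \<bar>y (sg * T) - x (sg * T)\<bar>)"
          by (intro continuous_on_rabs continuous_on_diff)
        show "\<bar>y (sg * 0) - x (sg * 0)\<bar> < r" using near \<delta>(3) x(2) y(1) by simp
        fix T :: real assume T: "0 \<le> T" "\<And>u. 0 \<le> u \<Longrightarrow> u \<le> T \<Longrightarrow> \<bar>y (sg * u) - x (sg * u)\<bar> \<le> r"
        have "\<bar>y (sg * T) - x (sg * T)\<bar> \<le> C * exp (- \<rho> * T) * \<bar>y\<^sub>0 - x\<^sub>0\<bar>" by (rule est[OF T])
        also have "\<dots> \<le> C * 1 * \<delta>"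
          using T(1) C \<rho> near by (intro mult_mono) auto
        finally show "\<bar>y (sg * T) - x (sg * T)\<bar> < r" using \<delta>(2) by simp
      qed
      have close': "\<bar>y u - x u\<bar> \<le> r" if "0 \<le> sg * u" for u
        using close[OF that] by (simp add: sg2)
      have soly: "sol \<sigma> f t \<omega> (y 0) = y t \<and> t \<in> sol_dom \<sigma> f \<omega> (y 0)"
      proof (rule clamped_sol[OF y(2)])
        fix s assume "s \<in> {min 0 t..max 0 t}"
        then have "0 \<le> sg * s" using t sg by (auto simp: min_def max_def split: if_splits)
        then show "A - e < y s \<and> y s < B + e" by (intro inside close')
      qed
      have "\<bar>y (sg * (sg * t)) - x (sg * (sg * t))\<bar> \<le> C * exp (- \<rho> * (sg * t)) * \<bar>y\<^sub>0 - x\<^sub>0\<bar>"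
        by (rule est[OF t]) (rule less_imp_le[OF close])
      then have "\<bar>y t - x t\<bar> \<le> C * exp (- \<rho> * (sg * t)) * \<bar>y\<^sub>0 - x\<^sub>0\<bar>" unfolding sg2(1) .
      moreover have "sg * t = \<bar>t\<bar>" using t sg2(2)[of t] by simp
      ultimately have "\<bar>y t - x t\<bar> \<le> C * exp (- \<rho> * \<bar>t\<bar>) * \<bar>y\<^sub>0 - x\<^sub>0\<bar>" by (simp only:)
      then show ?thesis using soly[unfolded y(1)] solx(1)[of t] by simp
    qed
  qed
  show ?thesis
    unfolding unif_exp_stable_def
  proof (rule exI[of _ \<delta>], rule exI[of _ C], rule exI[of _ \<rho>], intro conjI \<delta>(1) C \<rho> ballI, clarify)
    fix \<omega> x y t assume "(\<omega>, x) \<in> K" "\<bar>y - x\<bar> < \<delta>" "0 \<le> sg * t"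
    then show "t \<in> sol_dom \<sigma> f \<omega> y \<and> \<bar>sol \<sigma> f t \<omega> y - sol \<sigma> f t \<omega> x\<bar> \<le> C * exp (- \<rho> * \<bar>t\<bar>) * \<bar>y - x\<bar>"
      by (rule main)
  qed
qed

text \<open>The two values at time \<open>u\<close> lie within \<open>r\<close> of the span of the fiber.  This covers two points of
one fiber as well as a point of the fiber and a point near it, so that one decay estimate gives both that fibers
are singletons and that they are stable.\<close>

definition close_pair where
  "close_pair K r \<omega> p q u \<longleftrightarrow> (p has_real_derivative f (\<sigma> u \<omega>) (p u)) (at u) \<and>
     (q has_real_derivative f (\<sigma> u \<omega>) (q u)) (at u) \<and> p u < q u \<and>
     (\<exists>x x'. (\<sigma> u \<omega>, x) \<in> K \<and> (\<sigma> u \<omega>, x') \<in> K \<and> x \<le> p u + r \<and> q u \<le> x' + r)"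

text \<open>Two points of one fiber come from a time \<open>-sg T\<close> at which their distance was at most \<open>B - A\<close>; by the decay
estimate it is now at most \<open>C (B - A) exp (- \<rho> T)\<close>, for every \<open>T\<close>.\<close>

lemma copy_and_stableI:
  fixes sg C \<rho> r e A B :: real
  assumes sg: "sg = 1 \<or> sg = -1" and K: "compact_invariant_onto \<sigma> f K" and strip: "K \<subseteq> UNIV \<times> {A..B}"
    and r: "0 < r" "r < e" and C: "1 \<le> C" and \<rho>: "0 < \<rho>"
    and decay: "\<And>\<omega> p q T. 0 \<le> T \<Longrightarrow>
      (\<And>u. 0 \<le> u \<Longrightarrow> u \<le> T \<Longrightarrow> close_pair K r \<omega> p q (sg * u)) \<Longrightarrow>
      q (sg * T) - p (sg * T) \<le> C * exp (- \<rho> * T) * (q 0 - p 0)"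
  shows "copy_of_base \<sigma> f K \<and> unif_exp_stable \<sigma> f {t. 0 \<le> sg * t} K"
proof
  have inv: "skew_invariant \<sigma> f K" using K by (simp add: compact_invariant_onto_def)
  show "copy_of_base \<sigma> f K"
  proof (rule copy_of_baseI[OF K], rule notI)
    fix \<omega> p\<^sub>0 q\<^sub>0 assume mem: "(\<omega>, p\<^sub>0) \<in> K" "(\<omega>, q\<^sub>0) \<in> K" and lt: "p\<^sub>0 < q\<^sub>0"
    obtain p where p: "trajectory \<omega> p" "p 0 = p\<^sub>0" "\<And>t. (\<sigma> t \<omega>, p t) \<in> K"
      by (rule invariant_trajectory[OF inv mem(1)]) blast
    obtain q where q: "trajectory \<omega> q" "q 0 = q\<^sub>0" "\<And>t. (\<sigma> t \<omega>, q t) \<in> K"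
      by (rule invariant_trajectory[OF inv mem(2)]) blast
    have pq: "p u < q u" for u by (rule trajectory_order[OF p(1) q(1), of 0]) (use lt p q in simp)
    have "q\<^sub>0 - p\<^sub>0 \<le> C * (B - A) * exp (- \<rho> * T)" if T: "0 \<le> T" for T
    proof -
      let ?s = "- (sg * T)"
      have "q (sg * T + ?s) - p (sg * T + ?s) \<le> C * exp (- \<rho> * T) * (q (0 + ?s) - p (0 + ?s))"
      proof (rule decay[OF T])
        fix u
        have K: "(\<sigma> u (\<sigma> ?s \<omega>), p (u + ?s)) \<in> K" "(\<sigma> u (\<sigma> ?s \<omega>), q (u + ?s)) \<in> K" for u
          unfolding flow_simps[OF flow] by (rule p(3), rule q(3))
        have "p (u + ?s) \<le> p (u + ?s) + r" "q (u + ?s) \<le> q (u + ?s) + r" for u using r by simp_all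
        then show "close_pair K r (\<sigma> ?s \<omega>) (\<lambda>t. p (t + ?s)) (\<lambda>t. q (t + ?s)) (sg * u)"
          using trajectory_shift[OF p(1), of ?s] trajectory_shift[OF q(1), of ?s] pq K
          unfolding trajectory_def close_pair_def by blast
      qed
      moreover have "q (0 + ?s) - p (0 + ?s) \<le> B - A" 
        using subsetD[OF strip p(3)[of ?s]] subsetD[OF strip q(3)[of ?s]] by simp
      then have "C * exp (- \<rho> * T) * (q (0 + ?s) - p (0 + ?s)) \<le> C * exp (- \<rho> * T) * (B - A)"
        using C by (intro mult_left_mono) auto
      ultimately show ?thesis using p(2) q(2) by (simp add: ac_simps)
    qed
    from exp_decay_imp_nonpos[OF \<rho> this] lt show False by simp
  qed
  show "unif_exp_stable \<sigma> f {t. 0 \<le> sg * t} K"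
  proof (rule unif_exp_stableI[OF sg inv strip r C \<rho>])
    fix \<omega> x y T
    assume x: "trajectory \<omega> x" "\<And>t. (\<sigma> t \<omega>, x t) \<in> K" and T: "0 \<le> (T :: real)"
      and y: "\<And>u. 0 \<le> u \<Longrightarrow> u \<le> T \<Longrightarrow> \<bar>y (sg * u) - x (sg * u)\<bar> \<le> r \<and>
        (y has_real_derivative f (\<sigma> (sg * u) \<omega>) (y (sg * u))) (at (sg * u))"
      and side: "(\<forall>t. x t < y t) \<or> (\<forall>t. y t < x t)"
    have xd: "(x has_real_derivative f (\<sigma> u \<omega>) (x u)) (at u)" for u using x(1) by (simp add: trajectory_def)
    have xx: "x u \<le> x u + r" for u using r by simp
    have yd: "(y has_real_derivative f (\<sigma> (sg * u) \<omega>) (y (sg * u))) (at (sg * u))"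
      and yx: "y (sg * u) \<le> x (sg * u) + r" "x (sg * u) \<le> y (sg * u) + r" if "0 \<le> u" "u \<le> T" for u
      using y[OF that] by (blast, linarith, linarith)
    from side show "\<bar>y (sg * T) - x (sg * T)\<bar> \<le> C * exp (- \<rho> * T) * \<bar>y 0 - x 0\<bar>"
    proof
      assume lt: "\<forall>t. x t < y t"
      have "y (sg * T) - x (sg * T) \<le> C * exp (- \<rho> * T) * (y 0 - x 0)"
        by (rule decay[OF T, where \<omega> = \<omega> and p = x and q = y])
          (use lt xd x(2) xx yd yx in \<open>unfold close_pair_def, blast\<close>)
      then show ?thesis using lt by (simp add: abs_of_pos)
    next
      assume lt: "\<forall>t. y t < x t"
      have "x (sg * T) - y (sg * T) \<le> C * exp (- \<rho> * T) * (x 0 - y 0)"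
        by (rule decay[OF T, where \<omega> = \<omega> and p = y and q = x])
          (use lt xd x(2) xx yd yx in \<open>unfold close_pair_def, blast\<close>)
      then show ?thesis using lt by (simp add: abs_of_neg)
    qed
  qed
qed

end

context three_sets
begin

lemma r_less: "r < e"
  using constants_pos by simp

lemma upper_hyperbolic: "hyperbolic_attractive_copy \<sigma> f K\<^sub>3"
proof -
  have "copy_of_base \<sigma> f K\<^sub>3 \<and> unif_exp_stable \<sigma> f {t. 0 \<le> 1 * t} K\<^sub>3"
  proof (rule copy_and_stableI[OF _ inv(3) strip(3) constants_pos(2) r_less constants_pos(7,6)], unfold mult_1)
    fix \<omega> p q T
    assume T: "0 \<le> (T :: real)" and H: "\<And>u. 0 \<le> u \<Longrightarrow> u \<le> T \<Longrightarrow>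
      close_pair K\<^sub>3 r \<omega> p q u"
    obtain a where a: "trajectory \<omega> a" "\<And>t. (\<sigma> t \<omega>, a t) \<in> K\<^sub>1" by (rule trajectory_in[OF inv(1)]) blast
    obtain b where b: "trajectory \<omega> b" "\<And>t. (\<sigma> t \<omega>, b t) \<in> K\<^sub>2" by (rule trajectory_in[OF inv(2)]) blast
    have "q T - p T \<le> C * exp (- \<rho> * (T - 0)) * (q 0 - p 0)"
    proof (rule pair_decay_upper[OF T a b])
      fix u assume "u \<in> {0..T}"
      then have "0 \<le> u" "u \<le> T" by auto
      note Hu = H[OF this, unfolded close_pair_def]
      show "(p has_real_derivative f (\<sigma> u \<omega>) (p u)) (at u)" "(q has_real_derivative f (\<sigma> u \<omega>) (q u)) (at u)"
        using Hu by blast+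
      obtain x x' where x: "(\<sigma> u \<omega>, x) \<in> K\<^sub>3" "(\<sigma> u \<omega>, x') \<in> K\<^sub>3" "x \<le> p u + r" "q u \<le> x' + r" "p u < q u"
        using Hu by blast
      have "x' \<le> B" using x(2) strip(3) by auto
      then show "b u + r \<le> p u \<and> p u < q u \<and> q u \<le> B + r"
        using x(3-5) gap23[OF b(2) x(1)] constants_pos(8) by linarith
    qed
    then show "q T - p T \<le> C * exp (- \<rho> * T) * (q 0 - p 0)" by simp
  qed simp
  moreover have "{t :: real. 0 \<le> 1 * t} = {0..}" by auto
  ultimately show ?thesis by (simp add: hyperbolic_attractive_copy_def)
qed

lemma lower_hyperbolic: "hyperbolic_attractive_copy \<sigma> f K\<^sub>1"
proof -
  have "copy_of_base \<sigma> f K\<^sub>1 \<and> unif_exp_stable \<sigma> f {t. 0 \<le> 1 * t} K\<^sub>1"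
  proof (rule copy_and_stableI[OF _ inv(1) strip(1) constants_pos(2) r_less constants_pos(7,6)], unfold mult_1)
    fix \<omega> p q T
    assume T: "0 \<le> (T :: real)" and H: "\<And>u. 0 \<le> u \<Longrightarrow> u \<le> T \<Longrightarrow>
      close_pair K\<^sub>1 r \<omega> p q u"
    obtain c where c: "trajectory \<omega> c" "\<And>t. (\<sigma> t \<omega>, c t) \<in> K\<^sub>2" by (rule trajectory_in[OF inv(2)]) blast
    obtain d where d: "trajectory \<omega> d" "\<And>t. (\<sigma> t \<omega>, d t) \<in> K\<^sub>3" by (rule trajectory_in[OF inv(3)]) blast
    have "q T - p T \<le> C * exp (- \<rho> * (T - 0)) * (q 0 - p 0)"
    proof (rule pair_decay_lower[OF T c d])
      fix u assume "u \<in> {0..T}"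
      then have "0 \<le> u" "u \<le> T" by auto
      note Hu = H[OF this, unfolded close_pair_def]
      show "(p has_real_derivative f (\<sigma> u \<omega>) (p u)) (at u)" "(q has_real_derivative f (\<sigma> u \<omega>) (q u)) (at u)"
        using Hu by blast+
      obtain x x' where x: "(\<sigma> u \<omega>, x) \<in> K\<^sub>1" "(\<sigma> u \<omega>, x') \<in> K\<^sub>1" "x \<le> p u + r" "q u \<le> x' + r" "p u < q u"
        using Hu by blast
      have "A \<le> x" using x(1) strip(1) by auto
      then show "A - r \<le> p u \<and> p u < q u \<and> q u + r \<le> c u"
        using x(3-5) gap12[OF x(2) c(2)] constants_pos(8) by linarith
    qed
    then show "q T - p T \<le> C * exp (- \<rho> * T) * (q 0 - p 0)" by simp
  qed simp
  moreover have "{t :: real. 0 \<le> 1 * t} = {0..}" by auto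
  ultimately show ?thesis by (simp add: hyperbolic_attractive_copy_def)
qed

lemma middle_hyperbolic: "hyperbolic_repulsive_copy \<sigma> f K\<^sub>2"
proof -
  have "copy_of_base \<sigma> f K\<^sub>2 \<and> unif_exp_stable \<sigma> f {t. 0 \<le> -1 * t} K\<^sub>2"
  proof (rule copy_and_stableI[OF _ inv(2) strip(2) constants_pos(2) r_less constants_pos(7,6)], unfold mult_minus1)
    fix \<omega> p q T
    assume T: "0 \<le> (T :: real)" and H: "\<And>u. 0 \<le> u \<Longrightarrow> u \<le> T \<Longrightarrow>
      close_pair K\<^sub>2 r \<omega> p q (- u)"
    obtain a where a: "trajectory \<omega> a" "\<And>t. (\<sigma> t \<omega>, a t) \<in> K\<^sub>1" by (rule trajectory_in[OF inv(1)]) blast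
    obtain d where d: "trajectory \<omega> d" "\<And>t. (\<sigma> t \<omega>, d t) \<in> K\<^sub>3" by (rule trajectory_in[OF inv(3)]) blast
    have "q (- T) - p (- T) \<le> C * exp (- \<rho> * (0 - - T)) * (q 0 - p 0)"
    proof (rule pair_growth_middle[OF _ a d])
      fix u assume "u \<in> {- T..0}"
      then have "0 \<le> - u" "- u \<le> T" by auto
      note Hu = H[OF this, unfolded minus_minus close_pair_def]
      show "(p has_real_derivative f (\<sigma> u \<omega>) (p u)) (at u)" "(q has_real_derivative f (\<sigma> u \<omega>) (q u)) (at u)"
        using Hu by blast+
      obtain x x' where x: "(\<sigma> u \<omega>, x) \<in> K\<^sub>2" "(\<sigma> u \<omega>, x') \<in> K\<^sub>2" "x \<le> p u + r" "q u \<le> x' + r" "p u < q u"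
        using Hu by blast
      show "a u + r \<le> p u \<and> p u < q u \<and> q u + r \<le> d u"
        using x(3-5) gap12[OF a(2) x(1)] gap23[OF x(2) d(2)] constants_pos(8) by linarith
    qed (use T in simp)
    then show "q (- T) - p (- T) \<le> C * exp (- \<rho> * T) * (q 0 - p 0)" by simp
  qed simp
  moreover have "{t :: real. 0 \<le> -1 * t} = {..0}" by auto
  ultimately show ?thesis by (simp add: hyperbolic_repulsive_copy_def)
qed

end

section \<open>Equations that are (sDC) or (SDC)\<close>

lemma variation_interval_props:
  fixes K :: "('w::metric_space \<times> real) set"
  assumes "compact K" "K \<noteq> {}" "\<nexists>c. variation_interval K = {c}"
  obtains A B where "A < B" "variation_interval K = {A..B}" "K \<subseteq> UNIV \<times> {A..B}"
proof -
  have "bounded (snd ` K)"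
    by (intro compact_imp_bounded compact_continuous_image continuous_on_snd continuous_on_id assms(1))
  then have bdd: "bdd_below (snd ` K)" "bdd_above (snd ` K)" by (rule bounded_imp_bdd_below, rule bounded_imp_bdd_above)
  define A where "A = (INF p\<in>K. snd p)"
  define B where "B = (SUP p\<in>K. snd p)"
  have range: "A \<le> snd p" "snd p \<le> B" if "p \<in> K" for p
    unfolding A_def B_def using that bdd by (auto intro: cINF_lower cSUP_upper)
  obtain p where "p \<in> K" using assms(2) by blast
  then have "A \<le> B" using range by (meson order.trans)
  moreover have "A \<noteq> B" using assms(3) unfolding variation_interval_def A_def[symmetric] B_def[symmetric] by auto
  ultimately have "A < B" by simp
  moreover have "K \<subseteq> UNIV \<times> {A..B}" using range by auto
  ultimately show thesis using that unfolding variation_interval_def A_def B_def by blast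
qed

context skew_system
begin

lemma at_most_three_weak:
  assumes "weak_sDC \<sigma> f {A..B}" "A < B" "K \<subseteq> UNIV \<times> {A..B}"
  shows "at_most_three_disjoint \<sigma> f K"
proof (rule at_most_three)
  show "DC f" using assms(1) by (simp add: weak_sDC_def)
  show "\<exists>M\<in>ergodic_measures \<sigma>. 0 < measure M {\<omega>. 0 < curvature A B \<epsilon> \<omega>}" if "0 < \<epsilon>" "\<epsilon> \<le> (B - A) / 2" for \<epsilon>
  proof -
    have "\<epsilon> \<in> {0<..interval_length {A..B} / 2}" using that assms(2) by (simp add: interval_length_def)
    moreover have "{\<omega>. 0 < b_fun f {A..B} \<epsilon> \<omega>} = {\<omega>. 0 < curvature A B \<epsilon> \<omega>}"
      using that assms(2) by (intro Collect_cong b_fun_pos_iff) auto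
    ultimately show ?thesis using assms(1) unfolding weak_sDC_def by metis
  qed
qed (use assms in auto)

lemma exists_ergodic_measure: "ergodic_measures \<sigma> \<noteq> {}"
proof -
  have "\<exists>M\<in>ergodic_measures \<sigma>. integral\<^sup>L M (\<lambda>_. 0 :: real) \<le> 0"
    by (rule exists_ergodic_measure_below_average[OF compact_base flow continuous_on_const])
      (simp add: primitive_const)
  then show ?thesis by blast
qed

text \<open>This implication rests on the existence of an ergodic measure; without one, (SDC) would be void.\<close>

lemma strong_SDC_imp_weak_sDC: "strong_SDC \<sigma> f J \<Longrightarrow> weak_sDC \<sigma> f J"
  using exists_ergodic_measure unfolding strong_SDC_def weak_sDC_def by blast

lemma three_ordered_sets:
  assumes strong: "strong_SDC \<sigma> f {A..B}" and AB: "A < B" and sub: "K\<^sub>1 \<subseteq> UNIV \<times> {A..B}" "K\<^sub>2 \<subseteq> UNIV \<times> {A..B}" "K\<^sub>3 \<subseteq> UNIV \<times> {A..B}"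
    and inv: "compact_invariant_onto \<sigma> f K\<^sub>1" "compact_invariant_onto \<sigma> f K\<^sub>2" "compact_invariant_onto \<sigma> f K\<^sub>3"
    and less: "fiber_less K\<^sub>1 K\<^sub>2" "fiber_less K\<^sub>2 K\<^sub>3"
  shows "hyperbolic_attractive_copy \<sigma> f K\<^sub>1 \<and> hyperbolic_repulsive_copy \<sigma> f K\<^sub>2 \<and> hyperbolic_attractive_copy \<sigma> f K\<^sub>3"
proof -
  have gap: "\<exists>e>0. \<forall>\<omega> x y. (\<omega>, x) \<in> K \<longrightarrow> (\<omega>, y) \<in> L \<longrightarrow> x + e \<le> y"
    if "compact_invariant_onto \<sigma> f K" "compact_invariant_onto \<sigma> f L" and lt: "fiber_less K L" for K L
  proof -
    have "K \<inter> L = {}" using lt unfolding fiber_less_def by force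
    from compact_disjoint_gap[OF _ _ this] that(1,2) obtain e where e: "0 < e"
      "\<And>\<omega> x y. (\<omega>, x) \<in> K \<Longrightarrow> (\<omega>, y) \<in> L \<Longrightarrow> e \<le> \<bar>x - y\<bar>"
      unfolding compact_invariant_onto_def by blast
    have "x + e \<le> y" if "(\<omega>, x) \<in> K" "(\<omega>, y) \<in> L" for \<omega> x y
    proof -
      have "x < y" using lt that unfolding fiber_less_def by blast
      then show ?thesis using e(2)[OF that] by simp
    qed
    then show ?thesis using e(1) by blast
  qed
  obtain e\<^sub>1 where e1: "0 < e\<^sub>1" "\<And>\<omega> x y. (\<omega>, x) \<in> K\<^sub>1 \<Longrightarrow> (\<omega>, y) \<in> K\<^sub>2 \<Longrightarrow> x + e\<^sub>1 \<le> y"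
    using gap[OF inv(1,2) less(1)] by blast
  obtain e\<^sub>2 where e2: "0 < e\<^sub>2" "\<And>\<omega> x y. (\<omega>, x) \<in> K\<^sub>2 \<Longrightarrow> (\<omega>, y) \<in> K\<^sub>3 \<Longrightarrow> x + e\<^sub>2 \<le> y"
    using gap[OF inv(2,3) less(2)] by blast
  define e where "e = min e\<^sub>1 e\<^sub>2"
  define \<epsilon> where "\<epsilon> = min (e / 4) ((B - A) / 2)"
  have e: "0 < e" "e \<le> e\<^sub>1" "e \<le> e\<^sub>2" using e1(1) e2(1) by (auto simp: e_def)
  have \<epsilon>: "0 < \<epsilon>" "4 * \<epsilon> \<le> e" "\<epsilon> \<le> (B - A) / 2" "\<epsilon> \<le> B - A" using e AB by (auto simp: \<epsilon>_def min_def)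
  have DC: "DC f" using strong by (simp add: strong_SDC_def)
  have pos: "0 < measure M {\<omega>. 0 < curvature A B \<epsilon> \<omega>}" if "M \<in> ergodic_measures \<sigma>" for M
  proof -
    have "\<epsilon> \<in> {0<..interval_length {A..B} / 2}" using \<epsilon> AB by (simp add: interval_length_def)
    moreover have "{\<omega>. 0 < b_fun f {A..B} \<epsilon> \<omega>} = {\<omega>. 0 < curvature A B \<epsilon> \<omega>}"
      by (intro Collect_cong b_fun_pos_iff \<epsilon>)
    ultimately show ?thesis using strong that unfolding strong_SDC_def by metis
  qed
  obtain \<gamma> where \<gamma>: "0 < \<gamma>" and growth: "\<And>\<omega> s t. s \<le> t \<Longrightarrow> \<gamma> * (t - s) - 1 \<le>
      primitive (\<lambda>u. curvature A B \<epsilon> (\<sigma> u \<omega>)) t - primitive (\<lambda>u. curvature A B \<epsilon> (\<sigma> u \<omega>)) s"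
    using average_growth[OF curvature_props(1,2)[OF DC \<epsilon>(1,4)] pos] by blast
  interpret three_sets \<sigma> f K\<^sub>1 K\<^sub>2 K\<^sub>3 A B e \<epsilon> \<gamma>
  proof
    show "x + e \<le> y" if "(\<omega>, x) \<in> K\<^sub>1" "(\<omega>, y) \<in> K\<^sub>2" for \<omega> x y using e1(2)[OF that] e(2) by linarith
    show "x + e \<le> y" if "(\<omega>, x) \<in> K\<^sub>2" "(\<omega>, y) \<in> K\<^sub>3" for \<omega> x y using e2(2)[OF that] e(3) by linarith
  qed (fact DC inv sub \<epsilon> \<gamma> growth)+
  show ?thesis using upper_hyperbolic middle_hyperbolic lower_hyperbolic by blast
qed

end

theorem theorem4p2:
  fixes \<sigma> :: "real \<Rightarrow> 'w::metric_space \<Rightarrow> 'w"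
    and f :: "'w \<Rightarrow> real \<Rightarrow> real"
    and K :: "('w \<times> real) set"
  assumes "compact (UNIV :: 'w set)"
    and "continuous_flow \<sigma>"
    and "C01 f"
    and "compact_invariant_onto \<sigma> f K"
    and "\<nexists>c. variation_interval K = {c}"
  shows "(weak_sDC \<sigma> f (variation_interval K) \<longrightarrow> at_most_three_disjoint \<sigma> f K) \<and>
    (strong_SDC \<sigma> f (variation_interval K) \<longrightarrow>
       at_most_three_disjoint \<sigma> f K \<and>
       (\<forall>K\<^sub>1 K\<^sub>2 K\<^sub>3.
          K\<^sub>1 \<subseteq> K \<and> K\<^sub>2 \<subseteq> K \<and> K\<^sub>3 \<subseteq> K \<and>
          compact_invariant_onto \<sigma> f K\<^sub>1 \<and> compact_invariant_onto \<sigma> f K\<^sub>2 \<and>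
          compact_invariant_onto \<sigma> f K\<^sub>3 \<and>
          fiber_less K\<^sub>1 K\<^sub>2 \<and> fiber_less K\<^sub>2 K\<^sub>3 \<longrightarrow>
          hyperbolic_attractive_copy \<sigma> f K\<^sub>1 \<and>
          hyperbolic_repulsive_copy \<sigma> f K\<^sub>2 \<and>
          hyperbolic_attractive_copy \<sigma> f K\<^sub>3))"
proof -
  interpret skew_system \<sigma> f by unfold_locales (fact assms)+
  have "compact K" "K \<noteq> {}" using assms(4) by (auto simp: compact_invariant_onto_def)
  then obtain A B where AB: "A < B" and J: "variation_interval K = {A..B}" and K: "K \<subseteq> UNIV \<times> {A..B}"
    by (rule variation_interval_props[OF _ _ assms(5)])
  show ?thesis
    unfolding J
  proof (intro conjI impI allI)
    show "at_most_three_disjoint \<sigma> f K" if "weak_sDC \<sigma> f {A..B}"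
      by (rule at_most_three_weak[OF that AB K])
    show "at_most_three_disjoint \<sigma> f K" if "strong_SDC \<sigma> f {A..B}"
      by (rule at_most_three_weak[OF strong_SDC_imp_weak_sDC[OF that] AB K])
    fix K\<^sub>1 K\<^sub>2 K\<^sub>3
    assume strong: "strong_SDC \<sigma> f {A..B}" and sets: "K\<^sub>1 \<subseteq> K \<and> K\<^sub>2 \<subseteq> K \<and> K\<^sub>3 \<subseteq> K \<and>
          compact_invariant_onto \<sigma> f K\<^sub>1 \<and> compact_invariant_onto \<sigma> f K\<^sub>2 \<and>
          compact_invariant_onto \<sigma> f K\<^sub>3 \<and> fiber_less K\<^sub>1 K\<^sub>2 \<and> fiber_less K\<^sub>2 K\<^sub>3"
    then have sub: "K\<^sub>1 \<subseteq> UNIV \<times> {A..B}" "K\<^sub>2 \<subseteq> UNIV \<times> {A..B}" "K\<^sub>3 \<subseteq> UNIV \<times> {A..B}" using K by blast+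
    have "hyperbolic_attractive_copy \<sigma> f K\<^sub>1 \<and> hyperbolic_repulsive_copy \<sigma> f K\<^sub>2 \<and> hyperbolic_attractive_copy \<sigma> f K\<^sub>3"
      by (rule three_ordered_sets[OF strong AB sub]) (use sets in simp_all)
    then show "hyperbolic_attractive_copy \<sigma> f K\<^sub>1" "hyperbolic_repulsive_copy \<sigma> f K\<^sub>2" "hyperbolic_attractive_copy \<sigma> f K\<^sub>3"
      by simp_all
  qed
qed

end
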